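(* Let $(\overline{M}^{n+1},\overline{g})$ be a Riemannian manifold and let $\xi$ be a closed conformal vector field on $\overline{M}$ with constant norm $1$. Let $\mathcal{F}$ be a codimension-one foliation of $\overline{M}$ with complete noncompact leaves, with unit normal vector field $N$, such that $\mathcal{F}$ is transversal to $\xi$, $\overline{g}(N,\xi)>0$, and $\overline{g}(N,H_\xi\cdot\xi)\le 0$. If the second fundamental form $A$ of each leaf $L\in\mathcal{F}$ with respect to $N$ is nonnegative and $N$ converges to $\xi$ at infinity, then $\mathcal{F}$ is a totally geodesic foliation (every leaf is totally geodesic).
   Context: A vector field $\xi$ is closed and conformal if there is a function $\sigma\in C^\infty(\overline{M})$ with $\overline{\nabla}_X\xi=\sigma X$ for all vector fields $X$, where $\overline{\nabla}$ is the Levi-Civita connection; then $\sigma=\frac{1}{n+1}\operatorname{div}\xi$. Set $H_\xi=-\frac{\operatorname{div}\xi}{(n+1)\|\xi\|}=-\frac{\sigma}{\|\xi\|}$. The second fundamental form of a leaf with respect to $N$ is $A(Y)=-\overline{\nabla}_YN$ for $Y$ tangent to the leaf; it is nonnegative if $\overline{g}(A(Y),Y)\ge0$ for all tangent $Y$. Let $\theta:\overline{M}\to[0,\pi/2)$ be the acute angle between $N$ and $\xi$, defined by $\overline{g}(N,\xi)=\cos\theta$. We say that $N$ converges to $\xi$ at infinity if $\theta$ converges to $0$ at infinity, i.e. for every $\varepsilon>0$ there is a compact $K\subset\overline{M}$ with $\theta<\varepsilon$ on $\overline{M}\setminus K$. *)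

theory Defs
  imports "HOL-Analysis.Analysis"
begin

section \<open>Smooth maps between open subsets of Euclidean spaces\<close>

primrec Ck_on :: "nat \<Rightarrow> 'e::euclidean_space set \<Rightarrow> ('e \<Rightarrow> 'f::real_normed_vector) \<Rightarrow> bool" where
  "Ck_on 0 S f \<longleftrightarrow> continuous_on S f"
| "Ck_on (Suc k) S f \<longleftrightarrow> (\<forall>x\<in>S. f differentiable at x) \<and>
     (\<forall>v. Ck_on k S (\<lambda>x. frechet_derivative f (at x) v))"

text \<open>Only used for open \<open>S\<close>.\<close>

definition smooth_on :: "'e::euclidean_space set \<Rightarrow> ('e \<Rightarrow> 'f::real_normed_vector) \<Rightarrow> bool" where
  "smooth_on S f \<longleftrightarrow> (\<forall>k. Ck_on k S f)"


section \<open>Smooth manifolds\<close>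

text \<open>The manifold is the whole type \<open>'a\<close> (of class \<open>t2_space\<close> and
  \<open>second_countable_topology\<close>); it is modelled on the Euclidean space \<open>'e\<close>, so that its
  dimension is \<open>DIM('e)\<close>. A chart consists of its domain and its coordinate map; the values of the
  coordinate map outside the domain are irrelevant.\<close>

type_synonym ('a, 'e) chart = "'a set \<times> ('a \<Rightarrow> 'e)"

abbreviation cdom :: "('a, 'e) chart \<Rightarrow> 'a set" where "cdom c \<equiv> fst c"

abbreviation cmap :: "('a, 'e) chart \<Rightarrow> 'a \<Rightarrow> 'e" where "cmap c \<equiv> snd c"

definition cimg :: "('a, 'e) chart \<Rightarrow> 'e set" where "cimg c = cmap c ` cdom c"

definition cinv :: "('a, 'e) chart \<Rightarrow> 'e \<Rightarrow> 'a" where "cinv c = inv_into (cdom c) (cmap c)"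

definition is_chart :: "('a::topological_space, 'e::euclidean_space) chart \<Rightarrow> bool" where
  "is_chart c \<longleftrightarrow> open (cdom c) \<and> open (cimg c) \<and> homeomorphism (cdom c) (cimg c) (cmap c) (cinv c)"

definition smooth_transition ::
    "('a, 'e::euclidean_space) chart \<Rightarrow> ('a, 'e) chart \<Rightarrow> bool" where
  "smooth_transition c d \<longleftrightarrow> smooth_on (cmap c ` (cdom c \<inter> cdom d)) (cmap d \<circ> cinv c)"

text \<open>A smooth structure is a maximal smooth atlas.\<close>

definition smooth_structure ::
    "('a::{t2_space,second_countable_topology}, 'e::euclidean_space) chart set \<Rightarrow> bool" where
  "smooth_structure \<A> \<longleftrightarrow>
     (\<forall>c\<in>\<A>. is_chart c) \<and> (\<Union>c\<in>\<A>. cdom c) = UNIV \<and>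
     (\<forall>c\<in>\<A>. \<forall>d\<in>\<A>. smooth_transition c d) \<and>
     (\<forall>c. is_chart c \<and> (\<forall>d\<in>\<A>. smooth_transition c d \<and> smooth_transition d c) \<longrightarrow> c \<in> \<A>)"

definition smooth_function ::
    "('a, 'e::euclidean_space) chart set \<Rightarrow> ('a \<Rightarrow> real) \<Rightarrow> bool" where
  "smooth_function \<A> f \<longleftrightarrow> (\<forall>c\<in>\<A>. smooth_on (cimg c) (f \<circ> cinv c))"


section \<open>Tangent vectors and vector fields\<close>

text \<open>A tangent vector at \<open>p\<close> is the family of its components with respect to all charts around
  \<open>p\<close>, any two of which are related by the derivative of the transition map. The components with
  respect to charts not containing \<open>p\<close> are set to 0 by convention.\<close>

type_synonym ('a, 'e) tvec = "('a, 'e) chart \<Rightarrow> 'e"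

definition transition_deriv ::
    "('a, 'e::euclidean_space) chart \<Rightarrow> ('a, 'e) chart \<Rightarrow> 'a \<Rightarrow> 'e \<Rightarrow> 'e" where
  "transition_deriv c d p = frechet_derivative (cmap d \<circ> cinv c) (at (cmap c p))"

definition tangent_space ::
    "('a, 'e::euclidean_space) chart set \<Rightarrow> 'a \<Rightarrow> ('a, 'e) tvec set" where
  "tangent_space \<A> p = {v.
     (\<forall>c\<in>\<A>. \<forall>d\<in>\<A>. p \<in> cdom c \<inter> cdom d \<longrightarrow> v d = transition_deriv c d p (v c)) \<and>
     (\<forall>c. c \<notin> \<A> \<or> p \<notin> cdom c \<longrightarrow> v c = 0)}"

definition tzero :: "('a, 'e::euclidean_space) tvec" where
  "tzero = (\<lambda>c. 0)"

definition tadd :: "('a, 'e::euclidean_space) tvec \<Rightarrow> ('a, 'e) tvec \<Rightarrow> ('a, 'e) tvec" where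
  "tadd u v = (\<lambda>c. u c + v c)"

definition tscale :: "real \<Rightarrow> ('a, 'e::euclidean_space) tvec \<Rightarrow> ('a, 'e) tvec" where
  "tscale a v = (\<lambda>c. a *\<^sub>R v c)"

text \<open>The tangent vector at \<open>p\<close> with components \<open>w\<close> in the chart \<open>c\<close>.\<close>

definition coord_vec ::
    "('a, 'e::euclidean_space) chart set \<Rightarrow> ('a, 'e) chart \<Rightarrow> 'a \<Rightarrow> 'e \<Rightarrow> ('a, 'e) tvec" where
  "coord_vec \<A> c p w =
     (\<lambda>d. if d \<in> \<A> \<and> p \<in> cdom d then transition_deriv c d p w else 0)"

definition vector_field ::
    "('a, 'e::euclidean_space) chart set \<Rightarrow> ('a \<Rightarrow> ('a, 'e) tvec) \<Rightarrow> bool" where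
  "vector_field \<A> X \<longleftrightarrow> (\<forall>p. X p \<in> tangent_space \<A> p) \<and>
     (\<forall>c\<in>\<A>. smooth_on (cimg c) (\<lambda>x. X (cinv c x) c))"


section \<open>Riemannian metrics and the Levi-Civita connection\<close>

type_synonym ('a, 'e) metric = "'a \<Rightarrow> ('a, 'e) tvec \<Rightarrow> ('a, 'e) tvec \<Rightarrow> real"

definition local_metric ::
    "('a, 'e::euclidean_space) chart set \<Rightarrow> ('a, 'e) metric \<Rightarrow> ('a, 'e) chart \<Rightarrow> 'e \<Rightarrow> 'e \<Rightarrow> 'e \<Rightarrow> real"
  where
  "local_metric \<A> g c x u v =
     g (cinv c x) (coord_vec \<A> c (cinv c x) u) (coord_vec \<A> c (cinv c x) v)"

definition riemannian_metric ::
    "('a, 'e::euclidean_space) chart set \<Rightarrow> ('a, 'e) metric \<Rightarrow> bool" where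
  "riemannian_metric \<A> g \<longleftrightarrow>
     (\<forall>p. \<forall>u\<in>tangent_space \<A> p. \<forall>v\<in>tangent_space \<A> p.
        g p u v = g p v u \<and>
        (\<forall>w\<in>tangent_space \<A> p. g p (tadd u w) v = g p u v + g p w v) \<and>
        (\<forall>a. g p (tscale a u) v = a * g p u v) \<and>
        (u \<noteq> tzero \<longrightarrow> g p u u > 0)) \<and>
     (\<forall>c\<in>\<A>. \<forall>u v. smooth_on (cimg c) (\<lambda>x. local_metric \<A> g c x u v))"

definition tnorm :: "('a, 'e) metric \<Rightarrow> 'a \<Rightarrow> ('a, 'e::euclidean_space) tvec \<Rightarrow> real" where
  "tnorm g p v = sqrt (g p v v)"

text \<open>The Christoffel symbols of \<open>g\<close> in the chart \<open>c\<close> at the coordinate point \<open>x\<close>, as a bilinear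
  map: \<open>christoffel \<A> g c x u v\<close> is the vector determined by the Koszul formula for vector fields
  with constant coordinates in \<open>c\<close> (whose Lie brackets vanish); for basis vectors this is the usual
  \<open>\<Gamma>\<^sup>k\<^sub>i\<^sub>j = (1/2) g\<^sup>k\<^sup>l (\<partial>\<^sub>i g\<^sub>j\<^sub>l + \<partial>\<^sub>j g\<^sub>i\<^sub>l - \<partial>\<^sub>l g\<^sub>i\<^sub>j)\<close>.\<close>

definition christoffel ::
    "('a, 'e::euclidean_space) chart set \<Rightarrow> ('a, 'e) metric \<Rightarrow> ('a, 'e) chart \<Rightarrow> 'e \<Rightarrow> 'e \<Rightarrow> 'e \<Rightarrow> 'e"
  where
  "christoffel \<A> g c x u v = (THE w. \<forall>z.
     2 * local_metric \<A> g c x w z =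
       frechet_derivative (\<lambda>y. local_metric \<A> g c y v z) (at x) u +
       frechet_derivative (\<lambda>y. local_metric \<A> g c y u z) (at x) v -
       frechet_derivative (\<lambda>y. local_metric \<A> g c y u v) (at x) z)"

text \<open>The Levi-Civita derivative at \<open>p\<close> of the vector field \<open>X\<close> in the direction of the tangent
  vector \<open>v\<close>: in every chart it is \<open>dX(v) + \<Gamma>(v, X)\<close>. For vector fields \<open>X, Y\<close> the field usually
  written as the covariant derivative of \<open>X\<close> along \<open>Y\<close> is \<open>\<lambda>p. cov_deriv \<A> g X p (Y p)\<close>.\<close>

definition cov_deriv ::
    "('a, 'e::euclidean_space) chart set \<Rightarrow> ('a, 'e) metric \<Rightarrow> ('a \<Rightarrow> ('a, 'e) tvec) \<Rightarrow>
     'a \<Rightarrow> ('a, 'e) tvec \<Rightarrow> ('a, 'e) tvec" where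
  "cov_deriv \<A> g X p v = (\<lambda>c. if c \<in> \<A> \<and> p \<in> cdom c
     then frechet_derivative (\<lambda>x. X (cinv c x) c) (at (cmap c p)) (v c)
          + christoffel \<A> g c (cmap c p) (v c) (X p c)
     else 0)"

text \<open>The divergence is the trace of the covariant differential; being a trace, it can be computed
  in any chart around \<open>p\<close>.\<close>

definition divergence ::
    "('a, 'e::euclidean_space) chart set \<Rightarrow> ('a, 'e) metric \<Rightarrow> ('a \<Rightarrow> ('a, 'e) tvec) \<Rightarrow> 'a \<Rightarrow> real"
  where
  "divergence \<A> g X p =
     (let c = (SOME c. c \<in> \<A> \<and> p \<in> cdom c)
      in \<Sum>b\<in>Basis. cov_deriv \<A> g X p (coord_vec \<A> c p b) c \<bullet> b)"

definition closed_conformal ::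
    "('a, 'e::euclidean_space) chart set \<Rightarrow> ('a, 'e) metric \<Rightarrow> ('a \<Rightarrow> ('a, 'e) tvec) \<Rightarrow> bool" where
  "closed_conformal \<A> g \<xi> \<longleftrightarrow> vector_field \<A> \<xi> \<and>
     (\<exists>\<sigma>. smooth_function \<A> \<sigma> \<and>
        (\<forall>p. \<forall>v\<in>tangent_space \<A> p. cov_deriv \<A> g \<xi> p v = tscale (\<sigma> p) v))"

text \<open>In the next definition \<open>DIM('e)\<close> is the dimension \<open>n + 1\<close> of the manifold.\<close>

definition H_xi ::
    "('a, 'e::euclidean_space) chart set \<Rightarrow> ('a, 'e) metric \<Rightarrow> ('a \<Rightarrow> ('a, 'e) tvec) \<Rightarrow> 'a \<Rightarrow> real"
  where
  "H_xi \<A> g \<xi> p = - (divergence \<A> g \<xi> p / (real DIM('e) * tnorm g p (\<xi> p)))"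


section \<open>Codimension-one foliations\<close>

text \<open>The transverse coordinate of the model space is the coefficient of one basis vector, chosen
  once and for all.\<close>

definition height :: "'e::euclidean_space \<Rightarrow> real" where
  "height x = x \<bullet> (SOME b. b \<in> Basis)"

text \<open>A codimension-one foliation is given by an atlas of foliated charts: their images are open
  boxes, and around each point the transverse coordinate of one chart is a function of the transverse
  coordinate of the other one, i.e. the transition map is locally of the form
  \<open>(x, y) \<mapsto> (h\<^sub>1(x, y), h\<^sub>2(y))\<close> with \<open>y\<close> the transverse coordinate.\<close>

definition foliation ::
    "('a::topological_space, 'e::euclidean_space) chart set \<Rightarrow> ('a, 'e) chart set \<Rightarrow> bool" where
  "foliation \<A> \<Phi> \<longleftrightarrow> \<Phi> \<subseteq> \<A> \<and> (\<Union>c\<in>\<Phi>. cdom c) = UNIV \<and>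
     (\<forall>c\<in>\<Phi>. \<exists>l u. cimg c = box l u) \<and>
     (\<forall>c\<in>\<Phi>. \<forall>d\<in>\<Phi>. \<forall>p\<in>cdom c \<inter> cdom d. \<exists>W. open W \<and> p \<in> W \<and> W \<subseteq> cdom c \<inter> cdom d \<and>
        (\<forall>q\<in>W. \<forall>r\<in>W. height (cmap c q) = height (cmap c r) \<longrightarrow>
                        height (cmap d q) = height (cmap d r)))"

text \<open>Plaques are the level sets of the transverse coordinate in a foliated chart; the leaves are the
  equivalence classes of points under being joined by a finite chain of plaques.\<close>

definition plaque_rel :: "('a, 'e::euclidean_space) chart set \<Rightarrow> ('a \<times> 'a) set" where
  "plaque_rel \<Phi> = {(p, q). \<exists>c\<in>\<Phi>. p \<in> cdom c \<and> q \<in> cdom c \<and> height (cmap c p) = height (cmap c q)}"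

definition leaves :: "('a, 'e::euclidean_space) chart set \<Rightarrow> 'a set set" where
  "leaves \<Phi> = UNIV // (plaque_rel \<Phi>)\<^sup>*"

text \<open>The intrinsic topology of a leaf \<open>L\<close>, generated by the open subsets of plaques. It is in
  general finer than the subspace topology.\<close>

definition leaf_topology ::
    "('a, 'e::euclidean_space) chart set \<Rightarrow> 'a set \<Rightarrow> 'a topology" where
  "leaf_topology \<Phi> L = subtopology
     (topology_generated_by
        {{p \<in> cdom c. height (cmap c p) = t \<and> cmap c p \<in> W} | c t W. c \<in> \<Phi> \<and> open W}) L"

definition leaf_tangent_space ::
    "('a, 'e::euclidean_space) chart set \<Rightarrow> ('a, 'e) chart set \<Rightarrow> 'a \<Rightarrow> ('a, 'e) tvec set" where
  "leaf_tangent_space \<A> \<Phi> p =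
     {v \<in> tangent_space \<A> p. \<forall>c\<in>\<Phi>. p \<in> cdom c \<longrightarrow> height (v c) = 0}"

definition noncompact_leaf :: "('a, 'e::euclidean_space) chart set \<Rightarrow> 'a set \<Rightarrow> bool" where
  "noncompact_leaf \<Phi> L \<longleftrightarrow> \<not> compact_space (leaf_topology \<Phi> L)"

text \<open>The Riemannian distance of a leaf is the infimum of the lengths of the \<open>C\<^sup>1\<close> curves in the leaf.
  These curves may have zero velocity, so that a piecewise \<open>C\<^sup>1\<close> curve can be reparametrized
  to a \<open>C\<^sup>1\<close> curve of the same length; hence piecewise \<open>C\<^sup>1\<close> curves give the same infimum.\<close>

definition velocity ::
    "('a, 'e::euclidean_space) chart set \<Rightarrow> (real \<Rightarrow> 'a) \<Rightarrow> real \<Rightarrow> ('a, 'e) tvec" where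
  "velocity \<A> \<gamma> t = (\<lambda>c. if c \<in> \<A> \<and> \<gamma> t \<in> cdom c
     then vector_derivative (cmap c \<circ> \<gamma>) (at t within {0..1}) else 0)"

definition C1_curve ::
    "('a::topological_space, 'e::euclidean_space) chart set \<Rightarrow> (real \<Rightarrow> 'a) \<Rightarrow> bool" where
  "C1_curve \<A> \<gamma> \<longleftrightarrow> continuous_on {0..1} \<gamma> \<and>
     (\<forall>c\<in>\<A>. (\<forall>t\<in>{0..1}. \<gamma> t \<in> cdom c \<longrightarrow> (cmap c \<circ> \<gamma>) differentiable (at t within {0..1})) \<and>
             continuous_on {t\<in>{0..1}. \<gamma> t \<in> cdom c} (\<lambda>t. velocity \<A> \<gamma> t c))"

definition curve_length ::
    "('a, 'e::euclidean_space) chart set \<Rightarrow> ('a, 'e) metric \<Rightarrow> (real \<Rightarrow> 'a) \<Rightarrow> real" where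
  "curve_length \<A> g \<gamma> = integral {0..1} (\<lambda>t. tnorm g (\<gamma> t) (velocity \<A> \<gamma> t))"

definition leaf_dist ::
    "('a::topological_space, 'e::euclidean_space) chart set \<Rightarrow> ('a, 'e) metric \<Rightarrow>
     ('a, 'e) chart set \<Rightarrow> 'a set \<Rightarrow> 'a \<Rightarrow> 'a \<Rightarrow> real" where
  "leaf_dist \<A> g \<Phi> L p q = Inf {curve_length \<A> g \<gamma> | \<gamma>.
     C1_curve \<A> \<gamma> \<and> pathin (leaf_topology \<Phi> L) \<gamma> \<and> \<gamma> 0 = p \<and> \<gamma> 1 = q}"

definition complete_leaf ::
    "('a::topological_space, 'e::euclidean_space) chart set \<Rightarrow> ('a, 'e) metric \<Rightarrow>
     ('a, 'e) chart set \<Rightarrow> 'a set \<Rightarrow> bool" where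
  "complete_leaf \<A> g \<Phi> L \<longleftrightarrow> Metric_space.mcomplete L (leaf_dist \<A> g \<Phi> L)"

definition transversal ::
    "('a, 'e::euclidean_space) chart set \<Rightarrow> ('a, 'e) chart set \<Rightarrow> ('a \<Rightarrow> ('a, 'e) tvec) \<Rightarrow> bool" where
  "transversal \<A> \<Phi> X \<longleftrightarrow> (\<forall>p. X p \<notin> leaf_tangent_space \<A> \<Phi> p)"

definition unit_normal_field ::
    "('a, 'e::euclidean_space) chart set \<Rightarrow> ('a, 'e) metric \<Rightarrow> ('a, 'e) chart set \<Rightarrow>
     ('a \<Rightarrow> ('a, 'e) tvec) \<Rightarrow> bool" where
  "unit_normal_field \<A> g \<Phi> N \<longleftrightarrow> vector_field \<A> N \<and>
     (\<forall>p. tnorm g p (N p) = 1 \<and> (\<forall>Y\<in>leaf_tangent_space \<A> \<Phi> p. g p (N p) Y = 0))"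

text \<open>The second fundamental form \<open>A\<close> of the leaves with respect to \<open>N\<close>, as an operator on vectors
  tangent to the leaf through \<open>p\<close>.\<close>

definition second_fundamental_form ::
    "('a, 'e::euclidean_space) chart set \<Rightarrow> ('a, 'e) metric \<Rightarrow> ('a \<Rightarrow> ('a, 'e) tvec) \<Rightarrow>
     'a \<Rightarrow> ('a, 'e) tvec \<Rightarrow> ('a, 'e) tvec" where
  "second_fundamental_form \<A> g N p Y = tscale (-1) (cov_deriv \<A> g N p Y)"

definition nonneg_second_fundamental_form ::
    "('a, 'e::euclidean_space) chart set \<Rightarrow> ('a, 'e) metric \<Rightarrow> ('a, 'e) chart set \<Rightarrow>
     ('a \<Rightarrow> ('a, 'e) tvec) \<Rightarrow> 'a set \<Rightarrow> bool" where
  "nonneg_second_fundamental_form \<A> g \<Phi> N L \<longleftrightarrow>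
     (\<forall>p\<in>L. \<forall>Y\<in>leaf_tangent_space \<A> \<Phi> p. g p (second_fundamental_form \<A> g N p Y) Y \<ge> 0)"

definition totally_geodesic_leaf ::
    "('a, 'e::euclidean_space) chart set \<Rightarrow> ('a, 'e) metric \<Rightarrow> ('a, 'e) chart set \<Rightarrow>
     ('a \<Rightarrow> ('a, 'e) tvec) \<Rightarrow> 'a set \<Rightarrow> bool" where
  "totally_geodesic_leaf \<A> g \<Phi> N L \<longleftrightarrow>
     (\<forall>p\<in>L. \<forall>Y\<in>leaf_tangent_space \<A> \<Phi> p. second_fundamental_form \<A> g N p Y = tzero)"

text \<open>For unit vector fields \<open>N\<close> and \<open>\<xi>\<close> with \<open>g(N, \<xi>) > 0\<close> this is the acute angle \<open>\<theta>\<close> determined by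
  \<open>g(N, \<xi>) = cos \<theta>\<close>.\<close>

definition angle ::
    "('a, 'e::euclidean_space) metric \<Rightarrow> ('a \<Rightarrow> ('a, 'e) tvec) \<Rightarrow> ('a \<Rightarrow> ('a, 'e) tvec) \<Rightarrow> 'a \<Rightarrow> real"
  where
  "angle g N \<xi> p = arccos (g p (N p) (\<xi> p))"

definition converges_at_infinity ::
    "('a::topological_space, 'e::euclidean_space) metric \<Rightarrow> ('a \<Rightarrow> ('a, 'e) tvec) \<Rightarrow>
     ('a \<Rightarrow> ('a, 'e) tvec) \<Rightarrow> bool" where
  "converges_at_infinity g N \<xi> \<longleftrightarrow>
     (\<forall>\<epsilon>>0. \<exists>K. compact K \<and> (\<forall>p. p \<notin> K \<longrightarrow> angle g N \<xi> p < \<epsilon>))"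

end

(* A unit closed conformal field is parallel, since differentiating its norm gives sigma = 0.
   Let f = g(N, xi) and let T be the projection of xi to the leaves, so that df(T) = - g(A T, T) <= 0. For real
   functions a, b with b' = f a' the field X = a(f) xi - b(f) N satisfies
   div X = - a'(f) g(A T, T) + b(f) tr A, which is nonnegative if a' <= 0 <= b.
   Choosing a and b to vanish for f >= s, where s < 1, makes X compactly supported, because f tends to 1 at
   infinity. The divergence theorem gives tr A = 0 where f < s, so A = 0 wherever f < 1; in the interior of
   {f = 1} we have N = xi, which is parallel, and continuity covers the rest. *)
theory Submission
  imports Defs
begin

section \<open>Continuously differentiable maps\<close>

text \<open>Fields and functions are handled in class C1 only: the divergence involves one
  derivative, and the cutoffs can then be squares of positive parts, whose primitives are explicit
  polynomials. The connection and the divergence are given by chart formulas, so the tensorial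
  character of the covariant derivative has to be earned from the transformation law of the
  Christoffel symbols, which rests on the symmetry of second derivatives of the transition maps. It
  matters because \<open>riemannian_metric\<close> constrains the metric on tangent vectors only.
  The divergence theorem is proved without a global volume measure. A compactly supported field is
  cut by a partition of unity, each piece is integrated in one chart against the density sqrt(det
  g), and pieces on overlaps are compared by change of variables; densities change by the absolute
  value of the Jacobian determinant, so the charts may have any orientation. Since the integrands
  are continuous and nonnegative, the vanishing of the total integral gives vanishing at every
  point, not merely almost everywhere.\<close>

definition C1_on :: "'e::euclidean_space set \<Rightarrow> ('e \<Rightarrow> 'f::real_normed_vector) \<Rightarrow> bool" where
  "C1_on S f \<longleftrightarrow> (\<exists>f'. (\<forall>x\<in>S. (f has_derivative f' x) (at x)) \<and> (\<forall>v. continuous_on S (\<lambda>x. f' x v)))"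

abbreviation fder :: "('e::euclidean_space \<Rightarrow> 'f::real_normed_vector) \<Rightarrow> 'e \<Rightarrow> 'e \<Rightarrow> 'f" where
  "fder f x \<equiv> frechet_derivative f (at x)"

lemma C1_onI:
  assumes "\<And>x. x \<in> S \<Longrightarrow> (f has_derivative f' x) (at x)" "\<And>v. continuous_on S (\<lambda>x. f' x v)"
  shows "C1_on S f"
  unfolding C1_on_def using assms by blast

lemma C1_onE:
  assumes "C1_on S f"
  obtains f' where "\<And>x. x \<in> S \<Longrightarrow> (f has_derivative f' x) (at x)" "\<And>v. continuous_on S (\<lambda>x. f' x v)"
  using assms unfolding C1_on_def by blast

lemma C1_on_has_derivative: "C1_on S f \<Longrightarrow> x \<in> S \<Longrightarrow> (f has_derivative fder f x) (at x)"
  by (metis C1_onE differentiableI frechet_derivative_works)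

lemma C1_on_continuous_fder:
  assumes "C1_on S f" shows "continuous_on S (\<lambda>x. fder f x v)"
proof -
  obtain f' where f': "\<And>x. x \<in> S \<Longrightarrow> (f has_derivative f' x) (at x)" "\<And>v. continuous_on S (\<lambda>x. f' x v)"
    using assms unfolding C1_on_def by blast
  have "fder f x = f' x" if "x \<in> S" for x
    using f'(1)[OF that] by (metis frechet_derivative_at)
  then show ?thesis using f'(2)[of v] by (simp cong: continuous_on_cong)
qed

lemma C1_on_continuous: "C1_on S f \<Longrightarrow> continuous_on S f"
  by (meson C1_on_has_derivative has_derivative_at_withinI has_derivative_continuous_on)

text \<open>Unfolding the recursion of \<open>Ck_on\<close> once gives exactly this class; all
  smooth data enter the proof through this equivalence.\<close>

lemma C1_on_iff_Ck: "C1_on S f \<longleftrightarrow> Ck_on (Suc 0) S f"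
proof
  assume "Ck_on (Suc 0) S f"
  then show "C1_on S f"
    by (intro C1_onI[of _ _ "\<lambda>x. fder f x"]) (auto simp: frechet_derivative_works[symmetric])
next
  assume f: "C1_on S f"
  then show "Ck_on (Suc 0) S f"
    by (auto simp: C1_on_continuous_fder intro: C1_on_has_derivative differentiableI)
qed

lemma C1_on_subset: "C1_on S f \<Longrightarrow> T \<subseteq> S \<Longrightarrow> C1_on T f"
  unfolding C1_on_def by (meson continuous_on_subset subsetD)

lemma C1_on_Un:
  assumes "C1_on S f" "C1_on T f" "open S" "open T"
  shows "C1_on (S \<union> T) f"
proof (rule C1_onI[of _ _ "\<lambda>x. fder f x"])
  show "continuous_on (S \<union> T) (\<lambda>x. fder f x v)" for v
    using assms by (intro continuous_on_open_Un C1_on_continuous_fder)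
qed (use assms C1_on_has_derivative in blast)

lemma C1_on_cong:
  assumes "open S" "\<And>x. x \<in> S \<Longrightarrow> f x = g x" "C1_on S g"
  shows "C1_on S f"
proof -
  obtain g' where g': "\<And>x. x \<in> S \<Longrightarrow> (g has_derivative g' x) (at x)" "\<And>v. continuous_on S (\<lambda>x. g' x v)"
    using assms(3) unfolding C1_on_def by blast
  show ?thesis
    by (rule C1_onI[OF _ g'(2)], rule has_derivative_transform_within_open[OF g'(1) assms(1)])
      (use assms(2) in auto)
qed

lemma C1_on_const [simp]: "C1_on S (\<lambda>x. c)"
  by (rule C1_onI[of _ _ "\<lambda>x v. 0"]) auto

lemma C1_on_bounded_linear: "bounded_linear f \<Longrightarrow> C1_on S f"
  by (rule C1_onI[of _ _ "\<lambda>x. f"]) (auto intro: bounded_linear_imp_has_derivative)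

lemma C1_on_add: assumes "C1_on S f" "C1_on S g" shows "C1_on S (\<lambda>x. f x + g x)"
  by (rule C1_onI, rule has_derivative_add[OF C1_on_has_derivative[OF assms(1)] C1_on_has_derivative[OF assms(2)]])
    (use assms in \<open>auto intro: continuous_on_add C1_on_continuous_fder\<close>)

lemma C1_on_sum: "(\<And>i. i \<in> I \<Longrightarrow> C1_on S (f i)) \<Longrightarrow> C1_on S (\<lambda>x. \<Sum>i\<in>I. f i x)"
  by (induction I rule: infinite_finite_induct) (auto intro: C1_on_add)

lemma (in bounded_bilinear) C1_on:
  fixes f :: "'e::euclidean_space \<Rightarrow> 'a" and g :: "'e::euclidean_space \<Rightarrow> 'b"
  assumes "C1_on S f" "C1_on S g" shows "C1_on S (\<lambda>x. prod (f x) (g x))"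
  by (rule C1_onI, rule FDERIV[OF C1_on_has_derivative[OF assms(1)] C1_on_has_derivative[OF assms(2)]])
    (assumption | intro continuous_on_add continuous_on C1_on_continuous_fder C1_on_continuous assms)+

lemmas C1_on_mult = bounded_bilinear.C1_on[OF bounded_bilinear_mult]
lemmas C1_on_scaleR = bounded_bilinear.C1_on[OF bounded_bilinear_scaleR]
lemmas C1_on_inner = bounded_bilinear.C1_on[OF bounded_bilinear_inner]

lemma C1_on_minus: assumes "C1_on S f" "C1_on S g" shows "C1_on S (\<lambda>x. f x - g x)"
  by (rule C1_onI, rule has_derivative_diff[OF C1_on_has_derivative[OF assms(1)] C1_on_has_derivative[OF assms(2)]])
    (use assms in \<open>auto intro: continuous_on_diff C1_on_continuous_fder\<close>)

lemma C1_on_prod: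
  fixes f :: "'i \<Rightarrow> 'e::euclidean_space \<Rightarrow> real"
  shows "(\<And>i. i \<in> I \<Longrightarrow> C1_on S (f i)) \<Longrightarrow> C1_on S (\<lambda>x. \<Prod>i\<in>I. f i x)"
  by (induction I rule: infinite_finite_induct) (auto intro: C1_on_mult)

text \<open>Differentiability of \<open>h\<close> is asked only at values taken by \<open>f\<close>,
  which admits \<open>sqrt\<close> on positive numbers and \<open>inverse\<close> away from
  0.\<close>

lemma C1_on_real_compose:
  fixes f :: "'e::euclidean_space \<Rightarrow> real"
  assumes "C1_on S f" "\<And>t. t \<in> f ` S \<Longrightarrow> (h has_real_derivative h' t) (at t)" "continuous_on (f ` S) h'"
  shows "C1_on S (\<lambda>x. h (f x))"
proof (rule C1_onI[of _ _ "\<lambda>x v. h' (f x) * fder f x v"])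
  show "((\<lambda>x. h (f x)) has_derivative (\<lambda>v. h' (f x) * fder f x v)) (at x)" if "x \<in> S" for x
    using has_derivative_compose[OF C1_on_has_derivative[OF assms(1) that]
        assms(2)[of "f x", unfolded has_field_derivative_def]] that by auto
  show "continuous_on S (\<lambda>x. h' (f x) * fder f x v)" for v
    using assms by (intro continuous_on_mult C1_on_continuous_fder continuous_on_compose2[OF assms(3)] C1_on_continuous) auto
qed

lemma linear_sum_Basis:
  fixes v :: "'e::euclidean_space"
  assumes "linear f"
  shows "f v = (\<Sum>b\<in>Basis. (v \<bullet> b) *\<^sub>R f b)"
proof -
  have "f v = f (\<Sum>b\<in>Basis. (v \<bullet> b) *\<^sub>R b)" by (simp add: euclidean_representation)
  also have "\<dots> = (\<Sum>b\<in>Basis. (v \<bullet> b) *\<^sub>R f b)"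
    using assms by (simp add: linear_sum linear_scale)
  finally show ?thesis .
qed

lemma C1_on_compose:
  fixes f :: "'e::euclidean_space \<Rightarrow> 'e2::euclidean_space" and h :: "'e2 \<Rightarrow> 'f::real_normed_vector"
  assumes f: "C1_on S f" and h: "C1_on T h" and T: "f ` S \<subseteq> T"
  shows "C1_on S (\<lambda>x. h (f x))"
proof (rule C1_onI[of _ _ "\<lambda>x v. fder h (f x) (fder f x v)"])
  show "((\<lambda>x. h (f x)) has_derivative (\<lambda>v. fder h (f x) (fder f x v))) (at x)" if "x \<in> S" for x
    by (rule has_derivative_compose[OF C1_on_has_derivative[OF f that] C1_on_has_derivative[OF h]])
      (use T that in auto)
  have lin: "linear (fder h (f x))" if "x \<in> S" for x
    using C1_on_has_derivative[OF h] T that by (metis has_derivative_linear image_subset_iff)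
  show "continuous_on S (\<lambda>x. fder h (f x) (fder f x v))" for v
  \<comment> \<open>The direction fed to the derivative of \<open>h\<close> varies with
    \<open>x\<close>, while \<open>C1_on\<close> controls fixed directions only. Expanding that
    direction in the basis bridges the difference.\<close>
  proof (subst continuous_on_cong[OF refl linear_sum_Basis[OF lin]])
    show "continuous_on S (\<lambda>x. \<Sum>b\<in>Basis. (fder f x v \<bullet> b) *\<^sub>R fder h (f x) b)"
      by (intro continuous_intros continuous_on_compose2[OF C1_on_continuous_fder[OF h] _ T]
          C1_on_continuous_fder[OF f] C1_on_continuous[OF f])
  qed
qed

text \<open>The zero function off \<open>C\<close> and \<open>f\<close> on \<open>T\<close> are
  glued along two open sets that cover the space.\<close>

lemma C1_on_UNIV_if_support:
  fixes f :: "'e::euclidean_space \<Rightarrow> 'f::real_normed_vector"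
  assumes "C1_on T f" "open T" "closed C" "C \<subseteq> T" "\<And>x. x \<notin> C \<Longrightarrow> f x = 0"
  shows "C1_on UNIV f"
proof -
  have "C1_on (- C) f"
    by (rule C1_on_cong[of _ _ "\<lambda>_. 0"]) (use assms in auto)
  then have "C1_on (T \<union> - C) f"
    using assms by (intro C1_on_Un) auto
  moreover have "T \<union> - C = UNIV" using assms by auto
  ultimately show ?thesis by simp
qed

lemma fder_eq_0_off_support:
  assumes "closed C" "\<And>x. x \<notin> C \<Longrightarrow> f x = 0" "x \<notin> C"
  shows "fder f x v = 0"
proof -
  have "(f has_derivative (\<lambda>_. 0)) (at x)"
    by (rule has_derivative_transform_within_open[of "\<lambda>_. 0" _ x UNIV "- C"]) (use assms in auto)
  then show ?thesis by (metis frechet_derivative_at)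
qed

lemma fder_eqI: "(f has_derivative f') (at x) \<Longrightarrow> fder f x = f'"
  by (metis frechet_derivative_at)

lemma fder_cong_open:
  assumes "open S" "x \<in> S" "\<And>y. y \<in> S \<Longrightarrow> f y = g y" 
  shows "fder f x = fder g x"
proof -
  have "(f has_derivative D) (at x) \<longleftrightarrow> (g has_derivative D) (at x)" for D
    using assms by (metis has_derivative_transform_within_open)
  then show ?thesis by (simp add: frechet_derivative_def)
qed

section \<open>Integrals of compactly supported functions\<close>

lemma integrable_compact_support:
  fixes f :: "'e::euclidean_space \<Rightarrow> real"
  assumes "continuous_on UNIV f" "compact C" "\<And>x. x \<notin> C \<Longrightarrow> f x = 0"
  shows "integrable lborel f"
proof -
  have "integrable lborel (\<lambda>x. indicator C x *\<^sub>R f x)"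
    by (rule borel_integrable_compact) (use assms in \<open>auto intro: continuous_on_subset\<close>)
  moreover have "(\<lambda>x. indicator C x *\<^sub>R f x) = f"
    using assms(3) by (auto simp: fun_eq_iff indicator_def)
  ultimately show ?thesis by simp
qed

lemma lborel_integral_translate:
  fixes f :: "'e::euclidean_space \<Rightarrow> real"
  assumes "f \<in> borel_measurable borel"
  shows "(\<integral>x. f (x + c) \<partial>lborel) = integral\<^sup>L lborel f"
proof -
  have "integral\<^sup>L lborel f = integral\<^sup>L (distr lborel borel ((+) c)) f"
    by (simp add: lborel_distr_plus)
  also have "\<dots> = (\<integral>x. f (c + x) \<partial>lborel)"
    using assms by (intro integral_distr) auto
  finally show ?thesis by (simp add: add.commute)
qed

text \<open>The integral of \<open>f (x + t *\<^sub>R v)\<close> does not depend on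
  \<open>t\<close>, by translation invariance. Differentiating under the integral sign at
  \<open>t = 0\<close> yields the integral of the directional derivative, which is therefore
  0.\<close>

lemma integral_fder_compact_support:
  fixes f :: "'e::euclidean_space \<Rightarrow> real"
  assumes f: "C1_on UNIV f" and C: "compact C" "\<And>x. x \<notin> C \<Longrightarrow> f x = 0"
  shows "(\<integral>x. fder f x v \<partial>lborel) = 0"
proof -
  obtain r where r: "C \<subseteq> cbox (-r) r"
    using C(1) bounded_subset_cbox_symmetric compact_imp_bounded by metis
  \<comment> \<open>\<open>D\<close> contains the supports of all translates with \<open>t\<close>
    in [-1, 1], so a single box serves for every such \<open>t\<close> and the Leibniz rule applies
    on a fixed domain.\<close>
  define D where "D = (\<lambda>(t::real, x). x - t *\<^sub>R v) ` ({-1..1} \<times> cbox (-r) r)"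
  have "compact D" unfolding D_def
    by (intro compact_continuous_image compact_Times) (auto intro!: continuous_intros simp: case_prod_unfold)
  then obtain R where R: "D \<subseteq> cbox (-R) R"
    using bounded_subset_cbox_symmetric compact_imp_bounded by metis
  have supp: "f (x + t *\<^sub>R v) = 0" if "t \<in> {-1..1}" "x \<notin> cbox (-R) R" for t x
  proof (rule C(2), rule notI)
    assume "x + t *\<^sub>R v \<in> C"
    then have "(t, x + t *\<^sub>R v) \<in> {-1..1} \<times> cbox (-r) r" using r that by auto
    then have "x \<in> D" unfolding D_def by (force intro: image_eqI[where x="(t, x + t *\<^sub>R v)"])
    then show False using R that by auto
  qed
  have cont: "continuous_on UNIV f" using C1_on_continuous[OF f] .
  have F: "integral (cbox (-R) R) (\<lambda>x. f (x + t *\<^sub>R v)) = integral\<^sup>L lborel f" if "t \<in> {-1..1}" for t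
  proof -
    have "integral (cbox (-R) R) (\<lambda>x. f (x + t *\<^sub>R v)) = integral UNIV (\<lambda>x. if x \<in> cbox (-R) R then f (x + t *\<^sub>R v) else 0)"
      by (rule integral_restrict_UNIV[symmetric])
    also have "\<dots> = integral UNIV (\<lambda>x. f (x + t *\<^sub>R v))"
      using supp[OF that] by (intro integral_cong) auto
    also have "\<dots> = (\<integral>x. f (x + t *\<^sub>R v) \<partial>lborel)"
    proof (intro integral_lborel integrable_compact_support[of _ "cbox (-R) R"])
      show "continuous_on UNIV (\<lambda>x. f (x + t *\<^sub>R v))"
        by (intro continuous_on_compose2[OF cont] continuous_intros) auto
    qed (use supp[OF that] in auto)
    also have "\<dots> = integral\<^sup>L lborel f"
      by (intro lborel_integral_translate borel_measurable_continuous_onI cont)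
    finally show ?thesis .
  qed
  have "((\<lambda>t. integral (cbox (-R) R) (\<lambda>x. f (x + t *\<^sub>R v))) has_vector_derivative
          integral (cbox (-R) R) (\<lambda>x. fder f (x + 0 *\<^sub>R v) v)) (at 0 within {-1..1})"
  proof (rule leibniz_rule_vector_derivative)
    show "((\<lambda>t. f (x + t *\<^sub>R v)) has_vector_derivative fder f (x + t *\<^sub>R v) v) (at t within {-1..1})" for t x
    proof -
      have "((\<lambda>t. x + t *\<^sub>R v) has_derivative (\<lambda>h. h *\<^sub>R v)) (at t)"
        by (auto intro!: derivative_eq_intros)
      from has_derivative_compose[OF this C1_on_has_derivative[OF f UNIV_I]]
      have "((\<lambda>t. f (x + t *\<^sub>R v)) has_derivative (\<lambda>h. fder f (x + t *\<^sub>R v) (h *\<^sub>R v))) (at t)" .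
      moreover have "fder f (x + t *\<^sub>R v) (h *\<^sub>R v) = h *\<^sub>R fder f (x + t *\<^sub>R v) v" for h
        using has_derivative_linear[OF C1_on_has_derivative[OF f UNIV_I]] by (rule linear_scale)
      ultimately show ?thesis unfolding has_vector_derivative_def
        by (auto intro: has_derivative_at_withinI)
    qed
    show "(\<lambda>x. f (x + t *\<^sub>R v)) integrable_on cbox (- R) R" for t
      by (intro integrable_continuous continuous_on_compose2[OF cont] continuous_intros) auto
    show "continuous_on ({- 1..1} \<times> cbox (- R) R) (\<lambda>(t, x). fder f (x + t *\<^sub>R v) v)"
      unfolding case_prod_unfold
      by (intro continuous_on_compose2[OF C1_on_continuous_fder[OF f]] continuous_intros) auto
  qed auto
  moreover have "((\<lambda>t. integral (cbox (-R) R) (\<lambda>x. f (x + t *\<^sub>R v))) has_vector_derivative 0) (at 0 within {-1..1})"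
    by (rule has_vector_derivative_transform[where f="\<lambda>_. integral\<^sup>L lborel f"]) (use F in auto)
  ultimately have "integral (cbox (-R) R) (\<lambda>x. fder f x v) = 0"
    using vector_derivative_unique_within[of 0 "{-1..1::real}"] by (fastforce simp: trivial_limit_within islimpt_Icc)
  moreover have "fder f x v = 0" if "x \<notin> cbox (-R) R" for x
    by (rule fder_eq_0_off_support[of "cbox (-R) R"]) (use supp[of 0] that in auto)
  then have "integral UNIV (\<lambda>x. fder f x v) = integral UNIV (\<lambda>x. if x \<in> cbox (-R) R then fder f x v else 0)"
    by (intro integral_cong) auto
  moreover have "integrable lborel (\<lambda>x. fder f x v)"
    using C1_on_continuous_fder[OF f] fder_eq_0_off_support[OF compact_imp_closed C(2)] C
    by (intro integrable_compact_support[of _ C]) auto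
  ultimately show ?thesis by (simp add: integral_restrict_UNIV integral_lborel[symmetric])
qed

section \<open>Symmetry of second derivatives\<close>

lemma second_derivative_symmetric_real:
  fixes f :: "'e::euclidean_space \<Rightarrow> real"
  assumes S: "open S" "x \<in> S" and f: "\<And>y. y \<in> S \<Longrightarrow> f differentiable (at y)"
    and f1: "\<And>v. C1_on S (\<lambda>y. fder f y v)"
  shows "fder (\<lambda>y. fder f y u) x v = fder (\<lambda>y. fder f y v) x u"
proof -
  define F where "F = (\<lambda>u v y. fder (\<lambda>y. fder f y u) y v)"
  have line: "((\<lambda>t. h (z + t *\<^sub>R w)) has_real_derivative fder h (z + t *\<^sub>R w) w) (at t)"
    if "h differentiable (at (z + t *\<^sub>R w))" for h :: "'e \<Rightarrow> real" and z w t
  proof -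
    have *: "(h has_derivative fder h (z + t *\<^sub>R w)) (at (z + t *\<^sub>R w))"
      using that by (simp add: frechet_derivative_works[symmetric])
    have "((\<lambda>t. z + t *\<^sub>R w) has_derivative (\<lambda>h. h *\<^sub>R w)) (at t)"
      by (auto intro!: derivative_eq_intros)
    from has_derivative_compose[OF this *]
    show ?thesis unfolding has_field_derivative_def
      by (simp add: linear_scale[OF has_derivative_linear[OF *]] mult.commute[of _ "fder h _ _"])
  qed
  obtain e where e: "e > 0" "ball x e \<subseteq> S" using S openE by blast
  \<comment> \<open>The second difference of \<open>f\<close> over a small parallelogram, evaluated by the mean value theorem.\<close>
  have key: "\<exists>a b. 0 < a \<and> a < s \<and> 0 < b \<and> b < s \<and>
      f (x + s *\<^sub>R u + s *\<^sub>R v) - f (x + s *\<^sub>R u) - f (x + s *\<^sub>R v) + f x = s * (s * F u v (x + a *\<^sub>R u + b *\<^sub>R v))"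
    if s: "s > 0" "s * (norm u + norm v) < e" for u v s
  proof -
    have inS: "x + a *\<^sub>R u + b *\<^sub>R v \<in> S" if "0 \<le> a" "a \<le> s" "0 \<le> b" "b \<le> s" for a b
    proof -
      have "norm (a *\<^sub>R u + b *\<^sub>R v) \<le> a * norm u + b * norm v"
        using that norm_triangle_ineq[of "a *\<^sub>R u" "b *\<^sub>R v"] by simp
      also have "\<dots> \<le> s * (norm u + norm v)"
        using that by (simp add: distrib_left add_mono mult_right_mono)
      finally show ?thesis using s e
        by (auto simp: dist_norm add.assoc norm_minus_commute add.commute[of "b *\<^sub>R v"] intro!: subsetD[OF e(2)])
    qed
    define h where "h = (\<lambda>a. f ((x + s *\<^sub>R v) + a *\<^sub>R u) - f (x + a *\<^sub>R u))"
    have "\<exists>z>0. z < s \<and> h s - h 0 = (s - 0) * (fder f ((x + s *\<^sub>R v) + z *\<^sub>R u) u - fder f (x + z *\<^sub>R u) u)"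
      unfolding h_def
    proof (rule MVT2[OF s(1)])
      fix a assume a: "0 \<le> a" "a \<le> s"
      have "f differentiable (at ((x + s *\<^sub>R v) + a *\<^sub>R u))" "f differentiable (at (x + a *\<^sub>R u))"
        using inS[of a s] inS[of a 0] a s by (auto intro!: f simp: add_ac)
      then show "((\<lambda>a. f ((x + s *\<^sub>R v) + a *\<^sub>R u) - f (x + a *\<^sub>R u)) has_real_derivative
           (fder f ((x + s *\<^sub>R v) + a *\<^sub>R u) u - fder f (x + a *\<^sub>R u) u)) (at a)"
        by (intro DERIV_diff line)
    qed
    then obtain a where a: "0 < a" "a < s"
      "h s - h 0 = s * (fder f ((x + a *\<^sub>R u) + s *\<^sub>R v) u - fder f (x + a *\<^sub>R u) u)"
      by (auto simp: add_ac)
    have "\<exists>z>0. z < s \<and> fder f ((x + a *\<^sub>R u) + s *\<^sub>R v) u - fder f ((x + a *\<^sub>R u) + 0 *\<^sub>R v) u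
        = (s - 0) * F u v ((x + a *\<^sub>R u) + z *\<^sub>R v)"
      unfolding F_def
    proof (rule MVT2[OF s(1)])
      fix b assume b: "0 \<le> b" "b \<le> s"
      have "(\<lambda>y. fder f y u) differentiable (at ((x + a *\<^sub>R u) + b *\<^sub>R v))"
        using inS[of a b] a b by (intro differentiableI[OF C1_on_has_derivative[OF f1]]) auto
      then show "((\<lambda>b. fder f ((x + a *\<^sub>R u) + b *\<^sub>R v) u) has_real_derivative
          fder (\<lambda>y. fder f y u) ((x + a *\<^sub>R u) + b *\<^sub>R v) v) (at b)"
        by (rule line)
    qed
    then obtain b where b: "0 < b" "b < s" "h s - h 0 = s * (s * F u v (x + a *\<^sub>R u + b *\<^sub>R v))"
      using a(3) by auto
    then show ?thesis using a by (intro exI[of _ a] exI[of _ b]) (auto simp: h_def algebra_simps)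
  qed
  have cont: "continuous (at x) (F u v)" for u v
    unfolding F_def using C1_on_continuous_fder[OF f1, of u v] S continuous_on_eq_continuous_at by blast
  show ?thesis
  proof (rule ccontr)
    assume ne: "\<not> ?thesis"
    \<comment> \<open>The second difference is symmetric in \<open>u\<close> and \<open>v\<close>,
      so the mixed derivatives in the two orders take a common value at two points close to
      \<open>x\<close>. If each stays within half the gap of its value at \<open>x\<close>, the gap
      cannot be positive.\<close>
    define d where "d = \<bar>F u v x - F v u x\<bar> / 2"
    have d: "d > 0" using ne by (auto simp: d_def F_def)
    obtain d1 where d1: "d1 > 0" "\<And>y. dist y x < d1 \<Longrightarrow> \<bar>F u v y - F u v x\<bar> < d"
      using cont[of u v] d unfolding continuous_at_eps_delta dist_real_def by blast
    obtain d2 where d2: "d2 > 0" "\<And>y. dist y x < d2 \<Longrightarrow> \<bar>F v u y - F v u x\<bar> < d"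
      using cont[of v u] d unfolding continuous_at_eps_delta dist_real_def by blast
    define m where "m = min e (min d1 d2)"
    have m: "m > 0" using e d1 d2 by (auto simp: m_def)
    define s where "s = m / (norm u + norm v + 1)"
    have np: "norm u + norm v + 1 > 0" by (smt (verit) norm_ge_zero)
    have s: "s > 0" using m np by (simp add: s_def)
    have "s * (norm u + norm v) < s * (norm u + norm v + 1)" using s by simp
    also have "\<dots> = m" using np by (simp add: s_def)
    finally have sm: "s * (norm u + norm v) < m" .
    have sm': "s * (norm v + norm u) < m" using sm by (simp add: add.commute)
    have small: "dist (x + a *\<^sub>R u + b *\<^sub>R v) x < m" if "0 < a" "a < s" "0 < b" "b < s" for a b
    proof -
      have "norm (a *\<^sub>R u + b *\<^sub>R v) \<le> a * norm u + b * norm v"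
        using that norm_triangle_ineq[of "a *\<^sub>R u" "b *\<^sub>R v"] by simp
      also have "\<dots> \<le> s * (norm u + norm v)"
        using that by (simp add: distrib_left add_mono mult_right_mono)
      finally show ?thesis using sm by (simp add: dist_norm add.assoc)
    qed
    obtain a b where ab: "0 < a" "a < s" "0 < b" "b < s"
       "f (x + s *\<^sub>R u + s *\<^sub>R v) - f (x + s *\<^sub>R u) - f (x + s *\<^sub>R v) + f x = s * (s * F u v (x + a *\<^sub>R u + b *\<^sub>R v))"
      using key[of s u v] s sm by (auto simp: m_def)
    obtain a' b' where ab': "0 < a'" "a' < s" "0 < b'" "b' < s"
       "f (x + s *\<^sub>R v + s *\<^sub>R u) - f (x + s *\<^sub>R v) - f (x + s *\<^sub>R u) + f x = s * (s * F v u (x + a' *\<^sub>R v + b' *\<^sub>R u))"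
      using key[of s v u] s sm' by (auto simp: m_def)
    have "s * (s * F u v (x + a *\<^sub>R u + b *\<^sub>R v)) = s * (s * F v u (x + b' *\<^sub>R u + a' *\<^sub>R v))"
      using ab(5) ab'(5) by (simp add: algebra_simps)
    then have "F u v (x + a *\<^sub>R u + b *\<^sub>R v) = F v u (x + b' *\<^sub>R u + a' *\<^sub>R v)" using s by simp
    moreover have "\<bar>F u v (x + a *\<^sub>R u + b *\<^sub>R v) - F u v x\<bar> < d"
      using d1(2) small[of a b] ab by (auto simp: m_def)
    moreover have "\<bar>F v u (x + b' *\<^sub>R u + a' *\<^sub>R v) - F v u x\<bar> < d"
      using d2(2) small[of b' a'] ab' by (auto simp: m_def)
    ultimately show False unfolding d_def by (smt (verit) field_sum_of_halves)
  qed
qed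

section \<open>Change of variables in Euclidean spaces\<close>

text \<open>The change of variables theorem of the library is stated for \<open>real ^ 'n\<close> with a finite
  well-ordered index type \<open>'n\<close>; this type makes it available in every Euclidean space.\<close>

typedef (overloaded) 'e bidx = "Basis :: 'e::euclidean_space set"
  by (rule ex_in_conv[THEN iffD2]) simp

instance bidx :: (euclidean_space) finite
proof
  have "finite (Abs_bidx ` (Basis :: 'a set))" by simp
  moreover have "(UNIV :: 'a bidx set) = Abs_bidx ` Basis"
    by (metis Rep_bidx Rep_bidx_inverse UNIV_eq_I image_eqI)
  ultimately show "finite (UNIV :: 'a bidx set)" by simp
qed

instantiation bidx :: (euclidean_space) wellorder
begin

text \<open>Any well-order would do: the class constraint of the change of variables theorem asks
  for one, and determinants do not depend on the order of the indices.\<close>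

definition less_eq_bidx :: "'a bidx \<Rightarrow> 'a bidx \<Rightarrow> bool" where
  "i \<le> j \<longleftrightarrow> to_nat_on (Basis :: 'a set) (Rep_bidx i) \<le> to_nat_on (Basis :: 'a set) (Rep_bidx j)"

definition less_bidx :: "'a bidx \<Rightarrow> 'a bidx \<Rightarrow> bool" where
  "i < j \<longleftrightarrow> to_nat_on (Basis :: 'a set) (Rep_bidx i) < to_nat_on (Basis :: 'a set) (Rep_bidx j)"

instance
proof
  fix i j :: "'a bidx" and P
  show "i \<le> j \<Longrightarrow> j \<le> i \<Longrightarrow> i = j"
    unfolding less_eq_bidx_def
    by (metis Rep_bidx Rep_bidx_inject antisym countable_finite finite_Basis inj_onD inj_on_to_nat_on)
  assume H: "\<And>x :: 'a bidx. (\<And>y. y < x \<Longrightarrow> P y) \<Longrightarrow> P x"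
  show "P i"
    by (induction "to_nat_on (Basis :: 'a set) (Rep_bidx i)" arbitrary: i rule: less_induct)
      (rule H, simp add: less_bidx_def)
qed (auto simp: less_eq_bidx_def less_bidx_def)

end

definition to_vec :: "'e::euclidean_space \<Rightarrow> real ^ 'e bidx" where
  "to_vec x = (\<chi> i. x \<bullet> Rep_bidx i)"

definition of_vec :: "real ^ 'e bidx \<Rightarrow> 'e::euclidean_space" where
  "of_vec y = (\<Sum>i\<in>UNIV. (y $ i) *\<^sub>R Rep_bidx i)"

lemma bij_betw_Rep_bidx: "bij_betw Rep_bidx (UNIV :: 'e bidx set) (Basis :: 'e::euclidean_space set)"
  unfolding bij_betw_def inj_on_def
  by (auto simp: Rep_bidx_inject Rep_bidx) (metis Abs_bidx_inverse rangeI)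

lemma sum_bidx: "(\<Sum>i\<in>UNIV. F (Rep_bidx i)) = (\<Sum>b\<in>(Basis :: 'e::euclidean_space set). F b)"
  by (rule sum.reindex_bij_betw[OF bij_betw_Rep_bidx])

lemma prod_bidx: "(\<Prod>i\<in>UNIV. F (Rep_bidx i)) = (\<Prod>b\<in>(Basis :: 'e::euclidean_space set). F b)"
  by (rule prod.reindex_bij_betw[OF bij_betw_Rep_bidx])

lemma Rep_bidx_inner: "Rep_bidx i \<bullet> Rep_bidx (j :: 'e::euclidean_space bidx) = (if i = j then 1 else 0)"
  using Rep_bidx[of i] Rep_bidx[of j] by (auto simp: inner_Basis Rep_bidx_inject)

lemma of_vec_to_vec [simp]: "of_vec (to_vec x) = x"
  unfolding of_vec_def to_vec_def
  by (simp add: sum_bidx[of "\<lambda>b. (x \<bullet> b) *\<^sub>R b"] euclidean_representation)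

lemma to_vec_of_vec [simp]: "to_vec (of_vec y) = y"
  unfolding of_vec_def to_vec_def vec_eq_iff
  by (simp add: inner_sum_left Rep_bidx_inner if_distrib[of "(*) _"] sum.delta' cong: if_cong)

lemma linear_to_vec: "linear to_vec"
  by (rule linearI) (auto simp: to_vec_def vec_eq_iff inner_add_left)

lemma linear_of_vec: "linear of_vec"
  by (rule linearI) (auto simp: of_vec_def sum.distrib scaleR_left_distrib scaleR_sum_right)

lemma of_vec_axis: "of_vec (axis i 1) = Rep_bidx (i :: 'e::euclidean_space bidx)"
proof -
  have "to_vec (Rep_bidx i) = axis i 1"
    by (auto simp: to_vec_def vec_eq_iff Rep_bidx_inner axis_def)
  then show ?thesis by (metis of_vec_to_vec)
qed

lemma continuous_on_to_vec: "continuous_on S to_vec"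
  by (simp add: linear_continuous_on linear_conv_bounded_linear[THEN iffD1] linear_to_vec)

lemma continuous_on_of_vec: "continuous_on S of_vec"
  by (simp add: linear_continuous_on linear_conv_bounded_linear[THEN iffD1] linear_of_vec)

text \<open>Preimages of boxes are boxes with the same side lengths, and \<open>lborel\<close> is
  characterised by the volumes of boxes.\<close>

lemma lborel_distr_to_vec: "distr lborel borel (to_vec :: 'e::euclidean_space \<Rightarrow> _) = lborel"
proof (rule lborel_eqI[symmetric])
  fix l u :: "real ^ 'e bidx" assume lu: "\<And>b. b \<in> Basis \<Longrightarrow> l \<bullet> b \<le> u \<bullet> b"
  have le: "l $ i \<le> u $ i" for i using lu[of "axis i 1"] by (simp add: inner_axis)
  have vimage: "to_vec -` box l u = box (of_vec l) (of_vec u)"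
  proof -
    have "y \<bullet> Rep_bidx i = to_vec y $ i" for y :: 'e and i by (simp add: to_vec_def)
    moreover have "(x \<in> box (of_vec l) (of_vec u)) \<longleftrightarrow>
        (\<forall>i. of_vec l \<bullet> Rep_bidx i < x \<bullet> Rep_bidx i \<and> x \<bullet> Rep_bidx i < of_vec u \<bullet> Rep_bidx i)" for x
      unfolding mem_box using bij_betw_Rep_bidx[where 'e='e] unfolding bij_betw_def
      by (metis (no_types, lifting) Rep_bidx imageE)
    ultimately show ?thesis by (auto simp: mem_box_cart)
  qed
  have "emeasure (distr lborel borel to_vec) (box l u) = emeasure lborel (to_vec -` box l u)"
    by (subst emeasure_distr) (auto intro!: borel_measurable_continuous_onI continuous_on_to_vec)
  also have "\<dots> = (\<Prod>b\<in>Basis. (of_vec u - of_vec l) \<bullet> b)"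
    unfolding vimage
  proof (rule emeasure_lborel_box)
    fix b :: 'e assume "b \<in> Basis"
    then obtain i where "b = Rep_bidx i" by (metis Abs_bidx_inverse)
    then show "of_vec l \<bullet> b \<le> of_vec u \<bullet> b"
      using le[of i] by (metis to_vec_of_vec to_vec_def vec_lambda_beta)
  qed
  also have "(\<Prod>b\<in>Basis. (of_vec u - of_vec l) \<bullet> b) = (\<Prod>i\<in>UNIV. (of_vec u - of_vec l) \<bullet> Rep_bidx i)"
    by (rule prod_bidx[symmetric])
  also have "\<dots> = (\<Prod>i\<in>UNIV. (u - l) $ i)"
    by (metis linear_diff linear_of_vec to_vec_of_vec to_vec_def vec_lambda_beta)
  also have "\<dots> = (\<Prod>b\<in>Basis. (u - l) \<bullet> b)"
    unfolding Basis_vec_def by (subst prod.UNION_disjoint | subst prod.reindex | simp add: inner_axis axis_eq_axis inj_on_def)+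
  finally show "emeasure (distr lborel borel to_vec) (box l u) = (\<Prod>b\<in>Basis. (u - l) \<bullet> b)" .
qed simp

lemma integral_of_vec:
  fixes h :: "'e::euclidean_space \<Rightarrow> real"
  assumes "h \<in> borel_measurable borel"
  shows "(\<integral>y. h (of_vec y) \<partial>lborel) = integral\<^sup>L lborel h"
proof -
  have "(\<integral>y. h (of_vec y) \<partial>lborel) = (\<integral>y. h (of_vec y) \<partial>(distr lborel borel to_vec))"
    by (simp add: lborel_distr_to_vec)
  also have "\<dots> = (\<integral>x. h (of_vec (to_vec x)) \<partial>lborel)"
    using assms by (intro integral_distr)
      (auto intro!: borel_measurable_continuous_onI continuous_on_to_vec continuous_on_of_vec
        measurable_compose[OF _ assms])
  finally show ?thesis by simp
qed

lemma integrable_of_vec: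
  fixes h :: "'e::euclidean_space \<Rightarrow> real"
  assumes "integrable lborel h"
  shows "integrable lborel (\<lambda>y. h (of_vec y))"
proof -
  have "integrable (distr lborel borel to_vec) (\<lambda>y. h (of_vec y))"
    using assms by (subst integrable_distr_eq)
      (auto intro!: borel_measurable_continuous_onI[OF continuous_on_to_vec]
        measurable_compose[OF borel_measurable_continuous_onI[OF continuous_on_of_vec]])
  then show ?thesis by (simp add: lborel_distr_to_vec)
qed

section \<open>Determinants and traces of endomorphisms, and the change of variables formula\<close>

definition edet :: "('e::euclidean_space \<Rightarrow> 'e) \<Rightarrow> real" where
  "edet f = det (\<chi> i j. f (Rep_bidx j) \<bullet> Rep_bidx i)"

definition etrace :: "('e::euclidean_space \<Rightarrow> 'e) \<Rightarrow> real" where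
  "etrace f = (\<Sum>b\<in>Basis. f b \<bullet> b)"

lemma matrix_conj_vec: "matrix (\<lambda>y. to_vec (f (of_vec y))) = (\<chi> i j. f (Rep_bidx j) \<bullet> Rep_bidx i)"
  by (simp add: matrix_def of_vec_axis to_vec_def vec_eq_iff)

text \<open>Pulling a form back along \<open>L\<close> turns its Gram matrix into M^T G M, with M
  the matrix of \<open>L\<close>. This serves twice: to normalise a metric at a point, and to
  compare the densities of two charts.\<close>

lemma edet_bilinear_form:
  fixes G :: "'e::euclidean_space \<Rightarrow> 'e \<Rightarrow> real"
  assumes "linear L" "\<And>v. linear (\<lambda>u. G u v)" "\<And>u. linear (G u)"
  shows "det (\<chi> i j. G (L (Rep_bidx i)) (L (Rep_bidx j))) = (edet L)\<^sup>2 * det (\<chi> i j. G (Rep_bidx i) (Rep_bidx j))"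
proof -
  define M where "M = (\<chi> i j. L (Rep_bidx j) \<bullet> Rep_bidx i)"
  have "G (L (Rep_bidx i)) (L (Rep_bidx j)) =
      (\<Sum>k\<in>UNIV. (\<Sum>l\<in>UNIV. M $ l $ i * G (Rep_bidx l) (Rep_bidx k)) * M $ k $ j)" for i j
  proof -
    have "G (L (Rep_bidx i)) (L (Rep_bidx j)) = (\<Sum>c\<in>Basis. (L (Rep_bidx j) \<bullet> c) * G (L (Rep_bidx i)) c)"
      using linear_sum_Basis[OF assms(3), of "L (Rep_bidx i)" "L (Rep_bidx j)"] by simp
    also have "\<dots> = (\<Sum>c\<in>Basis. (L (Rep_bidx j) \<bullet> c) * (\<Sum>b\<in>Basis. (L (Rep_bidx i) \<bullet> b) * G b c))"
      using linear_sum_Basis[OF assms(2), of "L (Rep_bidx i)"] by simp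
    also have "\<dots> = (\<Sum>k\<in>UNIV. (\<Sum>l\<in>UNIV. M $ l $ i * G (Rep_bidx l) (Rep_bidx k)) * M $ k $ j)"
      unfolding M_def by (simp add: sum_bidx[symmetric] mult.commute)
    finally show ?thesis .
  qed
  then have "(\<chi> i j. G (L (Rep_bidx i)) (L (Rep_bidx j))) =
      transpose M ** (\<chi> i j. G (Rep_bidx i) (Rep_bidx j)) ** M"
    by (simp add: vec_eq_iff matrix_matrix_mult_def transpose_def)
  moreover have "det M = edet L" by (simp add: M_def edet_def)
  ultimately show ?thesis by (simp add: det_mul det_transpose power2_eq_square)
qed

lemma etrace_commute:
  fixes f g :: "'e::euclidean_space \<Rightarrow> 'e"
  assumes "linear f" "linear g" shows "etrace (\<lambda>x. f (g x)) = etrace (\<lambda>x. g (f x))"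
proof -
  have *: "etrace (\<lambda>x. f (g x)) = (\<Sum>b\<in>Basis. \<Sum>c\<in>Basis. (g b \<bullet> c) * (f c \<bullet> b))"
    if "linear f" for f g :: "'e \<Rightarrow> 'e"
    unfolding etrace_def
    by (subst linear_sum_Basis[OF that]) (simp add: inner_sum_left)
  show ?thesis unfolding *[OF assms(1)] *[OF assms(2)]
    by (subst sum.swap) (simp add: mult.commute)
qed

text \<open>In the Leibniz expansion a permutation other than the identity moves at least two
  indices, so differentiating one factor leaves another off-diagonal factor, which is 0. The case of
  the identity matrix suffices later because a basis orthonormal at the point is used.\<close>

lemma has_derivative_det_at_mat_1:
  fixes M :: "'e::real_normed_vector \<Rightarrow> real^'n^'n"
  assumes M: "\<And>i j. ((\<lambda>x. M x $ i $ j) has_derivative M' i j) (at x)" and 1: "M x = mat 1"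
  shows "((\<lambda>x. det (M x)) has_derivative (\<lambda>v. \<Sum>i\<in>UNIV. M' i i v)) (at x)"
proof -
  let ?P = "{p. p permutes (UNIV :: 'n set)}"
  have D: "((\<lambda>x. det (M x)) has_derivative (\<lambda>v. \<Sum>p\<in>?P. of_int (sign p) *
      (\<Sum>i\<in>UNIV. M' i (p i) v * (\<Prod>j\<in>UNIV - {i}. M x $ j $ p j)))) (at x)"
    unfolding det_def
    by (intro has_derivative_sum has_derivative_mult_right has_derivative_prod M)
  have 0: "(\<Prod>j\<in>UNIV - {i}. M x $ j $ p j) = 0" if p: "p \<in> ?P" "p \<noteq> id" for p i
  proof -
    obtain k where k: "p k \<noteq> k" using p(2) by (auto simp: fun_eq_iff)
    have "inj p" using p(1) permutes_inj by auto
    then have "p (p k) \<noteq> p k" using k by (auto dest: injD)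
    then obtain j where "j \<noteq> i" "p j \<noteq> j" using k by metis
    then show ?thesis by (intro prod_zero) (auto simp: 1 mat_def intro!: bexI[of _ j])
  qed
  have "(\<Sum>p\<in>?P. of_int (sign p) * (\<Sum>i\<in>UNIV. M' i (p i) v * (\<Prod>j\<in>UNIV - {i}. M x $ j $ p j)))
      = (\<Sum>i\<in>UNIV. M' i i v)" for v
  proof -
    have "(\<Sum>p\<in>?P. of_int (sign p) * (\<Sum>i\<in>UNIV. M' i (p i) v * (\<Prod>j\<in>UNIV - {i}. M x $ j $ p j)))
      = (\<Sum>p\<in>{id}. of_int (sign p) * (\<Sum>i\<in>UNIV. M' i (p i) v * (\<Prod>j\<in>UNIV - {i}. M x $ j $ p j)))"
      by (rule sum.mono_neutral_right) (auto simp: 0 permutes_id)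
    also have "\<dots> = (\<Sum>i\<in>UNIV. M' i i v)" by (simp add: 1 mat_def)
    finally show ?thesis .
  qed
  then show ?thesis using D by simp
qed

text \<open>The library theorem speaks of absolute gauge integrals of vector-valued functions over
  sets. The work here is the passage to \<open>real^1\<close> and back, and from set integrals to
  Lebesgue integrals with an indicator.\<close>

lemma change_of_variables_lborel_vec:
  fixes g :: "real^'n::{finite,wellorder} \<Rightarrow> real^'n::_" and f :: "real^'n::_ \<Rightarrow> real"
  assumes S: "open S" and der: "\<And>x. x \<in> S \<Longrightarrow> (g has_derivative g' x) (at x)" and inj: "inj_on g S"
    and f: "integrable lborel (\<lambda>y. indicator (g ` S) y * f y)"
    and meas: "(\<lambda>x. indicator S x * (\<bar>det (matrix (g' x))\<bar> * f (g x))) \<in> borel_measurable borel"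
  shows "(\<integral>x. indicator S x * (\<bar>det (matrix (g' x))\<bar> * f (g x)) \<partial>lborel) = (\<integral>y. indicator (g ` S) y * f y \<partial>lborel)"
proof -
  define F where "F = (\<lambda>x. \<bar>det (matrix (g' x))\<bar> * f (g x))"
  have iff: "(\<lambda>x. vec (F x) :: real^1) absolutely_integrable_on S \<and> integral S (\<lambda>x. vec (F x) :: real^1) = b \<longleftrightarrow>
     (\<lambda>y. vec (f y) :: real^1) absolutely_integrable_on (g ` S) \<and> integral (g ` S) (\<lambda>y. vec (f y) :: real^1) = b" for b
  proof -
    have "(\<lambda>x. vec (F x) :: real^1) = (\<lambda>x. \<bar>det (matrix (g' x))\<bar> *\<^sub>R vec (f (g x)))"
      by (auto simp: F_def vec_eq_iff fun_eq_iff)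
    then show ?thesis
      using has_absolute_integral_change_of_variables[of S g g' "\<lambda>y. vec (f y) :: real^1" b] S der inj
      by (simp add: has_derivative_at_withinI lmeasurable_open)
  qed
  have "(\<lambda>y. indicator (g ` S) y *\<^sub>R f y) = (\<lambda>y. indicator (g ` S) y * f y)" by auto
  then have af: "f absolutely_integrable_on (g ` S)"
    using f by (simp add: set_integrable_def integrable_completion borel_measurable_integrable)
  have "(\<lambda>x. vec (F x) :: real^1) absolutely_integrable_on S" and
    eq: "integral S (\<lambda>x. vec (F x) :: real^1) = integral (g ` S) (\<lambda>y. vec (f y) :: real^1)"
    using iff[of "integral (g ` S) (\<lambda>y. vec (f y) :: real^1)"] af by (auto simp: absolutely_integrable_on_1_iff)
  then have aF: "F absolutely_integrable_on S" by (simp add: absolutely_integrable_on_1_iff)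
  have eq': "integral S F = integral (g ` S) f"
    using eq by (simp add: integral_on_1_eq vec_eq_iff)
  \<comment> \<open>Absolute integrability only gives integrability for the completed measure; the
    hypothesis \<open>meas\<close> brings it back to \<open>lborel\<close>.\<close>
  have iF: "integrable lborel (\<lambda>x. indicator S x * F x)"
    using aF meas by (simp add: set_integrable_def integrable_completion F_def)
  have HK: "integral T h = (\<integral>x. indicator T x * h x \<partial>lborel)"
    if "integrable lborel (\<lambda>x. indicator T x * h x)" for T :: "(real^'n::_) set" and h :: "_ \<Rightarrow> real"
  proof -
    have "integral T h = integral UNIV (\<lambda>x. indicator T x * h x)"
      unfolding integral_restrict_UNIV[of T h, symmetric] by (intro integral_cong) auto
    then show ?thesis using integral_lborel[OF that] by simp
  qed
  show ?thesis using eq' HK[OF iF] HK[OF f] by (simp add: F_def)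
qed

theorem change_of_variables_lborel:
  fixes \<phi> :: "'e::euclidean_space \<Rightarrow> 'e" and h :: "'e \<Rightarrow> real"
  assumes S: "open S" and der: "\<And>x. x \<in> S \<Longrightarrow> (\<phi> has_derivative \<phi>' x) (at x)" and inj: "inj_on \<phi> S"
    and h: "integrable lborel (\<lambda>y. indicator (\<phi> ` S) y * h y)"
    and meas: "(\<lambda>x. indicator S x * (\<bar>edet (\<phi>' x)\<bar> * h (\<phi> x))) \<in> borel_measurable borel"
  shows "(\<integral>x. indicator S x * (\<bar>edet (\<phi>' x)\<bar> * h (\<phi> x)) \<partial>lborel) = (\<integral>y. indicator (\<phi> ` S) y * h y \<partial>lborel)"
proof -
  define g where "g = (\<lambda>y. to_vec (\<phi> (of_vec y)))"
  define g' where "g' = (\<lambda>y v. to_vec (\<phi>' (of_vec y) (of_vec v)))"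
  have vimage: "to_vec ` T = of_vec -` T" for T :: "'e set"
    by (auto simp: image_iff) (metis to_vec_of_vec)
  have ind: "indicator (to_vec ` T) y = indicator T (of_vec y)" for T :: "'e set" and y
    by (simp add: vimage indicator_def)
  have image: "g ` to_vec ` S = to_vec ` \<phi> ` S"
    unfolding g_def image_image by simp
  have det: "det (matrix (g' y)) = edet (\<phi>' (of_vec y))" for y
    unfolding g'_def edet_def matrix_conj_vec ..
  have bl: "bounded_linear (to_vec :: 'e \<Rightarrow> _)" "bounded_linear (of_vec :: _ \<Rightarrow> 'e)"
    using linear_to_vec linear_of_vec by (auto simp: linear_conv_bounded_linear)
  have "(\<integral>x. indicator S x * (\<bar>edet (\<phi>' x)\<bar> * h (\<phi> x)) \<partial>lborel) =
      (\<integral>y. indicator S (of_vec y) * (\<bar>edet (\<phi>' (of_vec y))\<bar> * h (\<phi> (of_vec y))) \<partial>lborel)"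
    using integral_of_vec[OF meas] by simp
  also have "\<dots> = (\<integral>y. indicator (to_vec ` S) y * (\<bar>det (matrix (g' y))\<bar> * h (of_vec (g y))) \<partial>lborel)"
    by (simp add: ind det g_def)
  also have "\<dots> = (\<integral>y. indicator (g ` to_vec ` S) y * h (of_vec y) \<partial>lborel)"
  proof (rule change_of_variables_lborel_vec)
    show "open (to_vec ` S)"
      unfolding vimage by (intro open_vimage S continuous_on_of_vec)
    show "(g has_derivative g' y) (at y)" if "y \<in> to_vec ` S" for y
    proof -
      have y: "of_vec y \<in> S" using that by (simp add: vimage)
      have "((\<lambda>y. \<phi> (of_vec y)) has_derivative (\<lambda>v. \<phi>' (of_vec y) (of_vec v))) (at y)"
        by (rule has_derivative_compose[OF bounded_linear_imp_has_derivative[OF bl(2)] der[OF y]])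
      then show ?thesis unfolding g_def g'_def
        by (rule bounded_linear.has_derivative[OF bl(1)])
    qed
    show "inj_on g (to_vec ` S)"
      using inj unfolding inj_on_def g_def by (metis imageE of_vec_to_vec)
    show "integrable lborel (\<lambda>y. indicator (g ` to_vec ` S) y * h (of_vec y))"
      using integrable_of_vec[OF h] by (simp add: image ind)
    show "(\<lambda>y. indicator (to_vec ` S) y * (\<bar>det (matrix (g' y))\<bar> * h (of_vec (g y)))) \<in> borel_measurable borel"
      using measurable_compose[OF borel_measurable_continuous_onI[OF continuous_on_of_vec] meas]
      by (simp add: ind det g_def)
  qed
  also have "\<dots> = (\<integral>y. indicator (\<phi> ` S) y * h y \<partial>lborel)"
    using integral_of_vec[OF borel_measurable_integrable[OF h, simplified]] by (simp add: image ind)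
  finally show ?thesis .
qed

section \<open>Riemannian metrics on open sets\<close>

lemma etrace_eq_sum_conj:
  fixes f P Q :: "'e::euclidean_space \<Rightarrow> 'e"
  assumes "linear f" "linear P" "linear Q" "\<And>x. Q (P x) = x" "\<And>x. P (Q x) = x"
  shows "etrace f = (\<Sum>b\<in>Basis. Q (f (P b)) \<bullet> b)"
proof -
  have "etrace f = etrace (\<lambda>x. P (Q (f x)))" by (simp add: assms)
  also have "\<dots> = etrace (\<lambda>x. Q (f (P x)))"
    using etrace_commute[of P "\<lambda>x. Q (f x)"] linear_compose[OF assms(1,3)] assms by (simp add: o_def)
  finally show ?thesis by (simp add: etrace_def)
qed

section \<open>Inner products and their orthonormal frames\<close>

locale inner_form =
  fixes G :: "'e::euclidean_space \<Rightarrow> 'e \<Rightarrow> real"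
  assumes linear_left: "linear (\<lambda>u. G u v)"
    and sym: "G u v = G v u"
    and pos: "u \<noteq> 0 \<Longrightarrow> G u u > 0"
begin

lemma linear_right: "linear (G u)"
proof -
  have "G u = (\<lambda>v. G v u)" by (rule ext) (rule sym)
  then show ?thesis using linear_left[of u] by metis
qed

lemma add_left: "G (u + v) w = G u w + G v w"
  by (rule linear_add[OF linear_left])
lemma add_right: "G w (u + v) = G w u + G w v"
  by (rule linear_add[OF linear_right])
lemma diff_left: "G (u - v) w = G u w - G v w"
  by (rule linear_diff[OF linear_left])
lemma diff_right: "G w (u - v) = G w u - G w v"
  by (rule linear_diff[OF linear_right])
lemma scale_left: "G (r *\<^sub>R u) w = r * G u w"
  using linear_scale[OF linear_left] by simp
lemma scale_right: "G w (r *\<^sub>R u) = r * G w u"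
  using linear_scale[OF linear_right] by simp
lemma zero_left [simp]: "G 0 w = 0"
  by (rule linear_0[OF linear_left])
lemma zero_right [simp]: "G w 0 = 0"
  by (rule linear_0[OF linear_right])
lemma sum_left: "G (\<Sum>i\<in>I. f i) w = (\<Sum>i\<in>I. G (f i) w)"
  by (rule linear_sum[OF linear_left])
lemma sum_right: "G w (\<Sum>i\<in>I. f i) = (\<Sum>i\<in>I. G w (f i))"
  by (rule linear_sum[OF linear_right])

lemmas bilin = add_left add_right diff_left diff_right scale_left scale_right

lemma nonneg: "G u u \<ge> 0"
  using pos[of u] by (cases "u = 0") auto

lemma eq_0_iff: "G u u = 0 \<longleftrightarrow> u = 0"
  using pos[of u] by (cases "u = 0") auto

lemma eqI: "(\<And>z. G u z = G v z) \<Longrightarrow> u = v"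
  using eq_0_iff[of "u - v"] by (simp add: diff_left)

definition orthonormal :: "'e set \<Rightarrow> bool" where
  "orthonormal B \<longleftrightarrow> (\<forall>a\<in>B. \<forall>b\<in>B. G a b = (if a = b then 1 else 0))"

lemma orthonormal_independent:
  assumes "orthonormal B" shows "independent B"
  unfolding dependent_explicit
proof -
  show "\<not> (\<exists>t u. finite t \<and> t \<subseteq> B \<and> (\<Sum>v\<in>t. u v *\<^sub>R v) = 0 \<and> (\<exists>v\<in>t. u v \<noteq> 0))"
  proof clarify
    fix t u v assume t: "finite t" "t \<subseteq> B" "(\<Sum>v\<in>t. u v *\<^sub>R v) = 0" "v \<in> t" "u v \<noteq> (0::real)"
    have "0 = G (\<Sum>w\<in>t. u w *\<^sub>R w) v" using t by simp
    also have "\<dots> = (\<Sum>w\<in>t. u w * G w v)" by (simp add: sum_left scale_left)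
    also have "\<dots> = (\<Sum>w\<in>t. if w = v then u w else 0)"
      using assms t by (intro sum.cong) (auto simp: orthonormal_def subset_iff)
    also have "\<dots> = u v" using t by simp
    finally show False using t by simp
  qed
qed

text \<open>Gram-Schmidt. The basis is packaged as a linear isometry \<open>P\<close> from the
  Euclidean inner product to \<open>G\<close>, with inverse \<open>Q\<close>, so that later sums
  range over \<open>P b\<close> for \<open>b\<close> in \<open>Basis\<close> and no separate index
  set is carried along.\<close>

lemma orthonormal_basis:
  "\<exists>P Q :: 'e \<Rightarrow> 'e. linear P \<and> linear Q \<and> (\<forall>x. Q (P x) = x) \<and> (\<forall>x. P (Q x) = x) \<and> (\<forall>u v. G (P u) (P v) = u \<bullet> v)"
proof -
  have "\<exists>B. orthonormal B \<and> card B = k" if "k \<le> DIM('e)" for k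
    using that
  proof (induction k)
    case 0 then show ?case by (intro exI[of _ "{}"]) (auto simp: orthonormal_def)
  next
    case (Suc k)
    then obtain B where B: "orthonormal B" "card B = k" by auto
    have fin: "finite B" using orthonormal_independent[OF B(1)] independent_imp_finite by auto
    have "span B \<noteq> UNIV"
    proof
      assume "span B = UNIV"
      then have "DIM('e) \<le> card B" using fin by (metis dim_UNIV dim_le_card dim_span order_refl span_superset)
      then show False using B Suc by simp
    qed
    then obtain x where x: "x \<notin> span B" by auto
    \<comment> \<open>The component of \<open>x\<close> orthogonal to \<open>B\<close>; it is
      nonzero because \<open>x\<close> lies outside the span, and normalising it extends the
      orthonormal set.\<close>
    define y where "y = x - (\<Sum>b\<in>B. G x b *\<^sub>R b)"
    have "(\<Sum>b\<in>B. G x b *\<^sub>R b) \<in> span B" by (intro span_sum span_scale span_base) auto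
    then have y0: "y \<noteq> 0" using x by (auto simp: y_def)
    have yB: "G y c = 0" if "c \<in> B" for c
    proof -
      have "G (\<Sum>b\<in>B. G x b *\<^sub>R b) c = (\<Sum>b\<in>B. G x b * G b c)" by (simp add: sum_left scale_left)
      also have "\<dots> = (\<Sum>b\<in>B. if b = c then G x b else 0)"
        using B that by (intro sum.cong) (auto simp: orthonormal_def)
      also have "\<dots> = G x c" using that fin by simp
      finally show ?thesis by (simp add: y_def diff_left)
    qed
    define z where "z = (1 / sqrt (G y y)) *\<^sub>R y"
    have p: "G y y > 0" using pos y0 by auto
    have zz: "G z z = 1" using p by (simp add: z_def scale_left scale_right)
    have zB: "G z c = 0" if "c \<in> B" for c using yB[OF that] by (simp add: z_def scale_left)
    then have Bz: "G c z = 0" if "c \<in> B" for c using that sym[of c z] by simp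
    have "z \<notin> B" using zz zB by force
    then have "card (insert z B) = Suc k" using B fin by simp
    moreover have "orthonormal (insert z B)"
      using B zz zB Bz \<open>z \<notin> B\<close> unfolding orthonormal_def by auto
    ultimately show ?case by blast
  qed
  then obtain B where B: "orthonormal B" "card B = DIM('e)" by blast
  have fin: "finite B" using orthonormal_independent[OF B(1)] independent_imp_finite by auto
  obtain \<beta> where \<beta>: "bij_betw \<beta> (Basis :: 'e set) B"
    using B(2) fin finite_same_card_bij[of "Basis :: 'e set" B] by auto
  define P where "P = (\<lambda>x. \<Sum>b\<in>Basis. (x \<bullet> b) *\<^sub>R \<beta> b)"
  define Q where "Q = (\<lambda>x. \<Sum>b\<in>Basis. G x (\<beta> b) *\<^sub>R b)"
  have lP: "linear P"
    by (rule linearI) (auto simp: P_def inner_add_left scaleR_add_left sum.distrib scaleR_sum_right)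
  have lQ: "linear Q"
    by (rule linearI) (auto simp: Q_def add_left scaleR_add_left sum.distrib scaleR_sum_right scale_left)
  have G\<beta>: "G (\<beta> b) (\<beta> c) = (if b = c then 1 else 0)" if "b \<in> Basis" "c \<in> Basis" for b c
    using B(1) \<beta> that unfolding orthonormal_def bij_betw_def inj_on_def by auto
  have GP: "G (P u) (\<beta> c) = u \<bullet> c" if "c \<in> Basis" for u c
  proof -
    have "G (P u) (\<beta> c) = (\<Sum>b\<in>Basis. (u \<bullet> b) * G (\<beta> b) (\<beta> c))"
      by (simp add: P_def sum_left scale_left)
    also have "\<dots> = (\<Sum>b\<in>Basis. if b = c then u \<bullet> b else 0)"
      using that by (intro sum.cong) (auto simp: G\<beta>)
    finally show ?thesis using that by simp
  qed
  have QP: "Q (P x) = x" for x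
    by (simp add: Q_def GP euclidean_representation cong: sum.cong)
  have "inj P" by (metis QP injI)
  then have "surj P" using lP linear_injective_imp_surjective by blast
  then have PQ: "P (Q x) = x" for x by (metis QP surjD)
  have "G (P u) (P v) = u \<bullet> v" for u v
  proof -
    have "G (P u) (P v) = (\<Sum>b\<in>Basis. (v \<bullet> b) * G (P u) (\<beta> b))"
      by (subst (2) P_def) (simp add: sum_right scale_right)
    also have "\<dots> = (\<Sum>b\<in>Basis. (v \<bullet> b) * (u \<bullet> b))" by (simp add: GP cong: sum.cong)
    finally show ?thesis by (subst euclidean_inner) (simp add: mult.commute)
  qed
  then show ?thesis using lP lQ QP PQ by blast
qed

lemma etrace_orthonormal:
  fixes f P Q :: "'e \<Rightarrow> 'e"
  assumes "linear f" "linear P" "linear Q" "\<And>x. Q (P x) = x" "\<And>x. P (Q x) = x"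
    "\<And>u v. G (P u) (P v) = u \<bullet> v"
  shows "etrace f = (\<Sum>b\<in>Basis. G (f (P b)) (P b))"
proof -
  have "Q y \<bullet> b = G y (P b)" for y b by (metis assms(5,6))
  then show ?thesis using etrace_eq_sum_conj[OF assms(1-5)] by simp
qed

text \<open>In an orthonormal frame the Gram matrix is the identity, so the determinant times the
  square of \<open>edet P\<close> is 1.\<close>

lemma det_pos: "det (\<chi> i j. G (Rep_bidx i) (Rep_bidx j)) > 0"
proof -
  obtain P Q :: "'e \<Rightarrow> 'e" where PQ': "linear P" "linear Q" "\<forall>x. Q (P x) = x" "\<forall>x. P (Q x) = x"
    "\<forall>u v. G (P u) (P v) = u \<bullet> v" using orthonormal_basis by blast
  note PQ = PQ'[rule_format]
  have "(\<chi> i j. G (P (Rep_bidx i)) (P (Rep_bidx j))) = (mat 1 :: real^'e bidx^'e bidx)"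
    by (auto simp: PQ mat_def vec_eq_iff Rep_bidx_inner)
  then have "1 = (edet P)\<^sup>2 * det (\<chi> i j. G (Rep_bidx i) (Rep_bidx j))"
    using edet_bilinear_form[OF PQ(1) linear_left linear_right] by simp
  then have "(edet P)\<^sup>2 * det (\<chi> i j. G (Rep_bidx i) (Rep_bidx j)) > 0" by simp
  then show ?thesis by (metis zero_le_power2 zero_less_mult_iff not_less)
qed

end

section \<open>Product rules for families of linear and bilinear maps\<close>

lemma has_derivative_linear_family:
  fixes B :: "'e::real_normed_vector \<Rightarrow> 'f::euclidean_space \<Rightarrow> 'g::real_normed_vector"
  assumes T: "open T" "x \<in> T" and lin: "\<And>y. y \<in> T \<Longrightarrow> linear (B y)"
    and B: "\<And>w. ((\<lambda>y. B y w) has_derivative B' w) (at x)" and X: "(X has_derivative X') (at x)"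
  shows "((\<lambda>y. B y (X y)) has_derivative (\<lambda>u. B' (X x) u + B x (X' u))) (at x)"
proof -
  \<comment> \<open>Linearity of \<open>B'\<close> in \<open>w\<close> is not among the assumptions;
    it follows from linearity of each \<open>B y\<close> and uniqueness of derivatives.\<close>
  have linB': "B' w u = (\<Sum>b\<in>Basis. (w \<bullet> b) *\<^sub>R B' b u)" for w u
  proof -
    have "((\<lambda>y. \<Sum>b\<in>Basis. (w \<bullet> b) *\<^sub>R B y b) has_derivative (\<lambda>u. \<Sum>b\<in>Basis. (w \<bullet> b) *\<^sub>R B' b u)) (at x)"
      by (intro has_derivative_sum has_derivative_scaleR_right B)
    then have "((\<lambda>y. B y w) has_derivative (\<lambda>u. \<Sum>b\<in>Basis. (w \<bullet> b) *\<^sub>R B' b u)) (at x)"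
      by (rule has_derivative_transform_within_open[OF _ T]) (metis lin linear_sum_Basis)
    then show ?thesis using has_derivative_unique[OF B] by metis
  qed
  have "((\<lambda>y. \<Sum>b\<in>Basis. (X y \<bullet> b) *\<^sub>R B y b) has_derivative
      (\<lambda>u. \<Sum>b\<in>Basis. (X x \<bullet> b) *\<^sub>R B' b u + (X' u \<bullet> b) *\<^sub>R B x b)) (at x)"
    by (intro has_derivative_sum has_derivative_scaleR has_derivative_inner_left X B)
  then have "((\<lambda>y. B y (X y)) has_derivative
      (\<lambda>u. \<Sum>b\<in>Basis. (X x \<bullet> b) *\<^sub>R B' b u + (X' u \<bullet> b) *\<^sub>R B x b)) (at x)"
    by (rule has_derivative_transform_within_open[OF _ T]) (metis lin linear_sum_Basis)
  moreover have "(\<Sum>b\<in>Basis. (X x \<bullet> b) *\<^sub>R B' b u + (X' u \<bullet> b) *\<^sub>R B x b) = B' (X x) u + B x (X' u)" for u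
    using linB'[of "X x" u] linear_sum_Basis[OF lin[OF T(2)], of "X' u"] by (simp add: sum.distrib)
  ultimately show ?thesis by simp
qed

lemma has_derivative_bilinear_family:
  fixes H :: "'e::real_normed_vector \<Rightarrow> 'f::euclidean_space \<Rightarrow> 'f \<Rightarrow> 'g::real_normed_vector"
  assumes T: "open T" "x \<in> T"
    and lin: "\<And>y v. y \<in> T \<Longrightarrow> linear (\<lambda>u. H y u v)" "\<And>y u. y \<in> T \<Longrightarrow> linear (H y u)"
    and H: "\<And>u v. ((\<lambda>y. H y u v) has_derivative H' u v) (at x)"
    and X: "(X has_derivative X') (at x)" and Y: "(Y has_derivative Y') (at x)"
  shows "((\<lambda>y. H y (X y) (Y y)) has_derivative
    (\<lambda>u. H' (X x) (Y x) u + H x (X' u) (Y x) + H x (X x) (Y' u))) (at x)"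
proof (rule has_derivative_linear_family[OF T, where B="\<lambda>y. H y (X y)"
      and B'="\<lambda>w u. H' (X x) w u + H x (X' u) w"])
  show "((\<lambda>y. H y (X y) w) has_derivative (\<lambda>u. H' (X x) w u + H x (X' u) w)) (at x)" for w
    by (rule has_derivative_linear_family[OF T, where B="\<lambda>y u. H y u w" and B'="\<lambda>u. H' u w"])
      (use lin H X in auto)
qed (use lin Y in auto)

section \<open>Connection, density and divergence of a metric in coordinates\<close>

locale metric_field =
  fixes S :: "'e::euclidean_space set" and G :: "'e \<Rightarrow> 'e \<Rightarrow> 'e \<Rightarrow> real"
  assumes open_S: "open S"
    and inner_form: "x \<in> S \<Longrightarrow> inner_form (G x)"
    and C1_metric: "C1_on S (\<lambda>x. G x u v)"
begin

definition DG :: "'e \<Rightarrow> 'e \<Rightarrow> 'e \<Rightarrow> 'e \<Rightarrow> real" where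
  "DG x z u v = fder (\<lambda>y. G y u v) x z"

definition Gam :: "'e \<Rightarrow> 'e \<Rightarrow> 'e \<Rightarrow> 'e" where
  "Gam x u v = (THE w. \<forall>z. 2 * G x w z = DG x u v z + DG x v u z - DG x z u v)"

definition nabla :: "('e \<Rightarrow> 'e) \<Rightarrow> 'e \<Rightarrow> 'e \<Rightarrow> 'e" where
  "nabla X x u = fder X x u + Gam x u (X x)"

text \<open>The density of the Riemannian volume with respect to Lebesgue measure.\<close>

definition dens :: "'e \<Rightarrow> real" where
  "dens x = sqrt (det (\<chi> i j. G x (Rep_bidx i) (Rep_bidx j)))"

lemma DG: "x \<in> S \<Longrightarrow> ((\<lambda>y. G y u v) has_derivative (\<lambda>z. DG x z u v)) (at x)"
  unfolding DG_def by (rule C1_on_has_derivative[OF C1_metric])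

lemma has_derivative_metric:
  assumes x: "x \<in> S" and X: "(X has_derivative X') (at x)" and Y: "(Y has_derivative Y') (at x)"
  shows "((\<lambda>y. G y (X y) (Y y)) has_derivative
    (\<lambda>u. DG x u (X x) (Y x) + G x (X' u) (Y x) + G x (X x) (Y' u))) (at x)"
  by (rule has_derivative_bilinear_family[OF open_S x, where H'="\<lambda>u v z. DG x z u v"])
    (use DG[OF x] X Y inner_form in \<open>auto intro: inner_form.linear_left inner_form.linear_right\<close>)

lemma DG_linear_dir: "x \<in> S \<Longrightarrow> linear (\<lambda>z. DG x z u v)"
  using DG by (rule has_derivative_linear)

lemma DG_sym: assumes "x \<in> S" shows "DG x z u v = DG x z v u"
  unfolding DG_def
  by (subst fder_cong_open[OF open_S assms]) (auto intro: inner_form.sym[OF inner_form])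

lemma DG_linear_left: assumes x: "x \<in> S" shows "linear (\<lambda>u. DG x z u v)"
proof (rule linearI)
  fix a b r
  have "((\<lambda>y. G y a v + G y b v) has_derivative (\<lambda>z. DG x z a v + DG x z b v)) (at x)"
    by (intro has_derivative_add DG x)
  then have "((\<lambda>y. G y (a + b) v) has_derivative (\<lambda>z. DG x z a v + DG x z b v)) (at x)"
    by (rule has_derivative_transform_within_open[OF _ open_S x]) (simp add: inner_form.add_left[OF inner_form])
  then show "DG x z (a + b) v = DG x z a v + DG x z b v"
    using has_derivative_unique[OF DG[OF x]] by metis
  have "((\<lambda>y. r * G y a v) has_derivative (\<lambda>z. r * DG x z a v)) (at x)"
    by (intro has_derivative_mult_right DG x)
  then have "((\<lambda>y. G y (r *\<^sub>R a) v) has_derivative (\<lambda>z. r * DG x z a v)) (at x)"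
    by (rule has_derivative_transform_within_open[OF _ open_S x]) (simp add: inner_form.scale_left[OF inner_form])
  then show "DG x z (r *\<^sub>R a) v = r *\<^sub>R DG x z a v"
    using has_derivative_unique[OF DG[OF x]] by (metis real_scaleR_def)
qed

lemma DG_linear_right: assumes x: "x \<in> S" shows "linear (DG x z u)"
proof -
  have "DG x z u = (\<lambda>v. DG x z v u)" using DG_sym[OF x] by auto
  then show ?thesis using DG_linear_left[OF x] by metis
qed

text \<open>The right-hand side is linear in \<open>z\<close>, hence represented by a vector with
  respect to the inner product; nondegeneracy makes that vector unique, so the definite description
  denotes it.\<close>

lemma Gam_eq:
  assumes x: "x \<in> S"
  shows "2 * G x (Gam x u v) z = DG x u v z + DG x v u z - DG x z u v"
proof -
  interpret inner_form "G x" using inner_form[OF x] .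
  let ?K = "\<lambda>z. DG x u v z + DG x v u z - DG x z u v"
  obtain P Q :: "'e \<Rightarrow> 'e" where PQ': "linear P" "linear Q" "\<forall>x. Q (P x) = x" "\<forall>x. P (Q x) = x"
    "\<forall>u v. G x (P u) (P v) = u \<bullet> v" using orthonormal_basis by blast
  note PQ = PQ'[rule_format]
  have "linear ?K"
    by (intro linear_compose_sub linear_compose_add DG_linear_right DG_linear_dir x)
  then have lin: "linear (\<lambda>y. ?K (P y))" using linear_compose[OF PQ(1)] by (simp add: o_def)
  \<comment> \<open>The Riesz vector of half the functional \<open>?K\<close>, written in the
    orthonormal frame.\<close>
  define w where "w = (\<Sum>b\<in>Basis. (?K (P b) / 2) *\<^sub>R P b)"
  have w: "2 * G x w z = ?K z" for z
  proof -
    have "G x (P b) z = Q z \<bullet> b" for b by (metis PQ(4,5) inner_commute)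
    then have "2 * G x w z = (\<Sum>b\<in>Basis. (Q z \<bullet> b) * ?K (P b))"
      by (simp add: w_def sum_left scale_left sum_distrib_left mult.commute)
    also have "\<dots> = ?K (P (Q z))" using linear_sum_Basis[OF lin, of "Q z"] by simp
    finally show ?thesis by (simp add: PQ)
  qed
  have "Gam x u v = w"
    unfolding Gam_def
  proof (rule the_equality)
    fix w' assume "\<forall>z. 2 * G x w' z = ?K z"
    then have "G x w' z = G x w z" for z using w[of z] by (metis mult_cancel_left zero_neq_numeral)
    then show "w' = w" by (rule eqI)
  qed (use w in blast)
  then show ?thesis using w by simp
qed

lemma Gam_eqI:
  assumes x: "x \<in> S" and "\<And>z. 2 * G x w z = DG x u v z + DG x v u z - DG x z u v"
  shows "Gam x u v = w"
proof (rule inner_form.eqI[OF inner_form[OF x]])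
  show "G x (Gam x u v) z = G x w z" for z using Gam_eq[OF x, of u v z] assms(2)[of z] by simp
qed

lemma Gam_sym: "x \<in> S \<Longrightarrow> Gam x u v = Gam x v u"
  by (rule Gam_eqI) (simp_all add: Gam_eq DG_sym[of x _ u v])

lemma Gam_linear: assumes x: "x \<in> S" shows "linear (\<lambda>u. Gam x u v)"
proof -
  interpret inner_form "G x" using inner_form[OF x] .
  note lin = DG_linear_dir[OF x] DG_linear_left[OF x] DG_linear_right[OF x]
  show ?thesis
  proof (rule linearI)
    show "Gam x (a + b) v = Gam x a v + Gam x b v" for a b
      using Gam_eq[OF x] lin[THEN linear_add]
      by (intro Gam_eqI[OF x]) (simp add: add_left distrib_left)
    show "Gam x (r *\<^sub>R a) v = r *\<^sub>R Gam x a v" for r a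
      using lin[THEN linear_scale]
      by (intro Gam_eqI[OF x]) (simp add: scale_left Gam_eq[OF x] right_diff_distrib distrib_left
          mult.left_commute[of 2])
  qed
qed

lemma Gam_linear_right: assumes x: "x \<in> S" shows "linear (Gam x u)"
proof -
  have "Gam x u = (\<lambda>v. Gam x v u)" using Gam_sym[OF x] by auto
  then show ?thesis using Gam_linear[OF x] by metis
qed

lemma nabla_linear:
  assumes "x \<in> S" "X differentiable (at x)" shows "linear (nabla X x)"
  unfolding nabla_def
  by (intro linear_compose_add Gam_linear assms linear_frechet_derivative)

text \<open>Add the Koszul formulas for the pairs (\<open>X x\<close>, \<open>Y x\<close>) and
  (\<open>Y x\<close>, \<open>X x\<close>): the derivatives of the metric in the directions
  \<open>X x\<close> and \<open>Y x\<close> cancel, and those in the direction \<open>u\<close>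
  remain.\<close>

lemma metric_compatible:
  assumes x: "x \<in> S" and X: "X differentiable (at x)" and Y: "Y differentiable (at x)"
  shows "fder (\<lambda>y. G y (X y) (Y y)) x u = G x (nabla X x u) (Y x) + G x (X x) (nabla Y x u)"
proof -
  interpret inner_form "G x" using inner_form[OF x] .
  have "fder (\<lambda>y. G y (X y) (Y y)) x = (\<lambda>u. DG x u (X x) (Y x) + G x (fder X x u) (Y x) + G x (X x) (fder Y x u))"
    by (rule fder_eqI, rule has_derivative_metric[OF x]) (use X Y in \<open>auto simp: frechet_derivative_works[symmetric]\<close>)
  moreover have "2 * (G x (Gam x u (X x)) (Y x) + G x (X x) (Gam x u (Y x))) = 2 * DG x u (X x) (Y x)"
    using Gam_eq[OF x, of u "X x" "Y x"] Gam_eq[OF x, of u "Y x" "X x"]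
      DG_sym[OF x, of u "X x" "Y x"] DG_sym[OF x, of "X x" u "Y x"] DG_sym[OF x, of "Y x" u "X x"]
    by (simp add: sym[of "X x" "Gam x u (Y x)"])
  ultimately show ?thesis by (simp add: nabla_def add_left add_right)
qed

lemma C1_metric_fields:
  assumes "C1_on S X" "C1_on S Y" shows "C1_on S (\<lambda>x. G x (X x) (Y x))"
proof (rule C1_on_cong[OF open_S])
  show "C1_on S (\<lambda>x. \<Sum>a\<in>Basis. \<Sum>b\<in>Basis. (X x \<bullet> a) * ((Y x \<bullet> b) * G x a b))"
    using assms by (intro C1_on_sum C1_on_mult C1_on_inner C1_on_const C1_metric)
  fix x assume x: "x \<in> S"
  interpret inner_form "G x" using inner_form[OF x] .
  have "G x (X x) (Y x) = (\<Sum>a\<in>Basis. (X x \<bullet> a) * G x a (Y x))"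
    using linear_sum_Basis[OF linear_left, of "X x" "Y x"] by simp
  also have "\<dots> = (\<Sum>a\<in>Basis. (X x \<bullet> a) * (\<Sum>b\<in>Basis. (Y x \<bullet> b) * G x a b))"
    using linear_sum_Basis[OF linear_right, of _ "Y x"] by simp
  finally show "G x (X x) (Y x) = (\<Sum>a\<in>Basis. \<Sum>b\<in>Basis. (X x \<bullet> a) * ((Y x \<bullet> b) * G x a b))"
    by (simp add: sum_distrib_left)
qed

lemma dens_pos: "x \<in> S \<Longrightarrow> dens x > 0"
  unfolding dens_def using inner_form.det_pos[OF inner_form] by simp

lemma C1_on_dens: "C1_on S dens"
proof -
  let ?D = "\<lambda>x. det (\<chi> i j. G x (Rep_bidx i) (Rep_bidx j))"
  have D: "C1_on S ?D"
    unfolding det_def by (intro C1_on_sum C1_on_mult C1_on_const C1_on_prod) (simp add: C1_metric)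
  have pos: "t > 0" if "t \<in> ?D ` S" for t using that inner_form.det_pos[OF inner_form] by auto
  have "C1_on S (\<lambda>x. sqrt (?D x))"
  proof (rule C1_on_real_compose[OF D])
    show "(sqrt has_real_derivative inverse (sqrt t) / 2) (at t)" if "t \<in> ?D ` S" for t
      using DERIV_real_sqrt[OF pos[OF that]] .
    show "continuous_on (?D ` S) (\<lambda>t. inverse (sqrt t) / 2)"
      using pos by (intro continuous_intros) fastforce+
  qed
  then show ?thesis unfolding dens_def .
qed

text \<open>The classical identity d_j sqrt(det g) = sqrt(det g) \<Gamma>^i_ij. In a constant frame
  orthonormal at \<open>x\<close> the Gram matrix is the identity there, so its determinant has the
  trace as derivative; in the trace of the Christoffel map the other two Koszul terms cancel by
  symmetry.\<close>

lemma fder_dens: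
  assumes x: "x \<in> S" shows "fder dens x v = dens x * etrace (\<lambda>u. Gam x u v)"
proof -
  interpret inner_form "G x" using inner_form[OF x] .
  obtain P Q :: "'e \<Rightarrow> 'e" where PQ': "linear P" "linear Q" "\<forall>x. Q (P x) = x" "\<forall>x. P (Q x) = x"
    "\<forall>u v. G x (P u) (P v) = u \<bullet> v" using orthonormal_basis by blast
  note PQ = PQ'[rule_format]
  define D where "D = (\<lambda>y. det (\<chi> i j. G y (Rep_bidx i) (Rep_bidx j)))"
  \<comment> \<open>The frame \<open>P\<close> is kept fixed while \<open>y\<close> varies, so
    \<open>det (M y)\<close> and \<open>D y\<close> differ by a constant factor, which is 1 /
    \<open>D x\<close>.\<close>
  define M where "M = (\<lambda>y. \<chi> i j. G y (P (Rep_bidx i)) (P (Rep_bidx j)))"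
  define s where "s = (\<lambda>v. \<Sum>b\<in>Basis. DG x v (P b) (P b))"
  have M: "det (M y) = (edet P)\<^sup>2 * D y" if "y \<in> S" for y
    unfolding M_def D_def
    by (rule edet_bilinear_form[OF PQ(1)])
      (use inner_form.linear_left[OF inner_form[OF that]] inner_form.linear_right[OF inner_form[OF that]] in auto)
  have M1: "M x = mat 1" by (auto simp: M_def PQ mat_def vec_eq_iff Rep_bidx_inner)
  then have e: "(edet P)\<^sup>2 * D x = 1" using M[OF x] by simp
  have "((\<lambda>y. det (M y)) has_derivative (\<lambda>v. \<Sum>i\<in>UNIV. DG x v (P (Rep_bidx i)) (P (Rep_bidx i)))) (at x)"
  proof (rule has_derivative_det_at_mat_1[where M'="\<lambda>i j v. DG x v (P (Rep_bidx i)) (P (Rep_bidx j))"])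
    show "((\<lambda>y. M y $ i $ j) has_derivative (\<lambda>v. DG x v (P (Rep_bidx i)) (P (Rep_bidx j)))) (at x)" for i j
      by (simp add: M_def DG[OF x])
  qed (rule M1)
  then have "((\<lambda>y. det (M y)) has_derivative s) (at x)"
    unfolding s_def sum_bidx[of "\<lambda>b. DG x _ (P b) (P b)"] .
  from has_derivative_mult_right[OF this, of "D x"]
  have "((\<lambda>y. D x * det (M y)) has_derivative (\<lambda>v. D x * s v)) (at x)" .
  then have D': "(D has_derivative (\<lambda>v. D x * s v)) (at x)"
    by (rule has_derivative_transform_within_open[OF _ open_S x])
      (use M e in \<open>simp add: mult.assoc[symmetric] mult.commute[of "D x"]\<close>)
  have Dp: "D x > 0" unfolding D_def by (rule det_pos)
  have "((\<lambda>y. sqrt (D y)) has_derivative (\<lambda>v. inverse (sqrt (D x)) / 2 * (D x * s v))) (at x)"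
    using has_derivative_compose[OF D' DERIV_real_sqrt[OF Dp, unfolded has_field_derivative_def]] .
  moreover have dD: "dens = (\<lambda>y. sqrt (D y))" by (auto simp: dens_def D_def)
  ultimately have "fder dens x v = inverse (sqrt (D x)) / 2 * (D x * s v)"
    using fder_eqI by metis
  also have "\<dots> = dens x * (s v / 2)"
    using Dp by (simp add: dD field_simps)
  also have "s v / 2 = etrace (\<lambda>u. Gam x u v)"
  proof -
    have "etrace (\<lambda>u. Gam x u v) = (\<Sum>b\<in>Basis. G x (Gam x (P b) v) (P b))"
      by (rule etrace_orthonormal[OF Gam_linear[OF x] PQ])
    also have "\<dots> = (\<Sum>b\<in>Basis. DG x v (P b) (P b) / 2)"
    proof (rule sum.cong[OF refl])
      show "G x (Gam x (P b) v) (P b) = DG x v (P b) (P b) / 2" for b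
        using Gam_eq[OF x, of "P b" v "P b"] DG_sym[OF x, of "P b" v "P b"] by simp
    qed
    finally show ?thesis by (simp add: s_def sum_divide_distrib)
  qed
  finally show ?thesis .
qed

text \<open>Multiplied by the density, the Riemannian divergence becomes a Euclidean one: the
  derivative of the density supplies exactly the trace of the Christoffel part.\<close>

lemma sum_fder_dens:
  assumes x: "x \<in> S" and X: "X differentiable (at x)"
  shows "(\<Sum>b\<in>Basis. fder (\<lambda>y. dens y * (X y \<bullet> b)) x b) = dens x * etrace (nabla X x)"
proof -
  have X': "(X has_derivative fder X x) (at x)" using X by (simp add: frechet_derivative_works[symmetric])
  have "fder (\<lambda>y. dens y * (X y \<bullet> b)) x = (\<lambda>u. dens x * (fder X x u \<bullet> b) + fder dens x u * (X x \<bullet> b))" for b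
    by (rule fder_eqI, intro has_derivative_mult C1_on_has_derivative[OF C1_on_dens x] has_derivative_inner_left X')
  then have "(\<Sum>b\<in>Basis. fder (\<lambda>y. dens y * (X y \<bullet> b)) x b)
      = dens x * etrace (fder X x) + (\<Sum>b\<in>Basis. (X x \<bullet> b) * fder dens x b)"
    by (simp add: etrace_def sum.distrib sum_distrib_left mult.commute)
  also have "(\<Sum>b\<in>Basis. (X x \<bullet> b) * fder dens x b) = fder dens x (X x)"
    using linear_sum_Basis[OF has_derivative_linear[OF C1_on_has_derivative[OF C1_on_dens x]], of "X x"] by simp
  also have "dens x * etrace (fder X x) + fder dens x (X x) = dens x * etrace (nabla X x)"
    by (simp add: fder_dens[OF x] nabla_def etrace_def inner_add_left sum.distrib distrib_left)
  finally show ?thesis .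
qed

lemma nabla_eq_0:
  assumes x: "x \<in> S" and "open T" "x \<in> T" "\<And>y. y \<in> T \<Longrightarrow> X y = 0"
  shows "nabla X x u = 0"
proof -
  have "fder X x = fder (\<lambda>_. 0) x" by (rule fder_cong_open[OF assms(2,3)]) (use assms in auto)
  then show ?thesis using linear_0[OF Gam_linear_right[OF x]] assms(3,4) by (simp add: nabla_def)
qed

lemma nabla_cong:
  assumes "open T" "x \<in> T" "\<And>y. y \<in> T \<Longrightarrow> X y = Y y"
  shows "nabla X x u = nabla Y x u"
  using fder_cong_open[OF assms] assms by (simp add: nabla_def)

lemma nabla_scaleR:
  assumes x: "x \<in> S" and h: "h differentiable (at x)" and X: "X differentiable (at x)"
  shows "nabla (\<lambda>y. h y *\<^sub>R X y) x u = fder h x u *\<^sub>R X x + h x *\<^sub>R nabla X x u"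
proof -
  have "fder (\<lambda>y. h y *\<^sub>R X y) x = (\<lambda>u. h x *\<^sub>R fder X x u + fder h x u *\<^sub>R X x)"
    by (rule fder_eqI, intro has_derivative_scaleR) (use h X in \<open>auto simp: frechet_derivative_works[symmetric]\<close>)
  then show ?thesis
    using linear_scale[OF Gam_linear_right[OF x]] by (simp add: nabla_def scaleR_add_right)
qed

lemma nabla_diff:
  assumes x: "x \<in> S" and X: "X differentiable (at x)" and Y: "Y differentiable (at x)"
  shows "nabla (\<lambda>y. X y - Y y) x u = nabla X x u - nabla Y x u"
proof -
  have "fder (\<lambda>y. X y - Y y) x = (\<lambda>u. fder X x u - fder Y x u)"
    by (rule fder_eqI, intro has_derivative_diff) (use X Y in \<open>auto simp: frechet_derivative_works[symmetric]\<close>)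
  then show ?thesis
    using linear_diff[OF Gam_linear_right[OF x]] by (simp add: nabla_def)
qed

lemma etrace_nabla_scaleR:
  assumes x: "x \<in> S" and h: "h differentiable (at x)" and X: "X differentiable (at x)"
  shows "etrace (nabla (\<lambda>y. h y *\<^sub>R X y) x) = fder h x (X x) + h x * etrace (nabla X x)"
proof -
  have "linear (fder h x)" using h by (rule linear_frechet_derivative)
  from linear_sum_Basis[OF this, of "X x"]
  have "fder h x (X x) = (\<Sum>b\<in>Basis. fder h x b * (X x \<bullet> b))" by (simp add: mult.commute)
  then show ?thesis
    by (simp add: etrace_def nabla_scaleR[OF assms] inner_add_left sum.distrib sum_distrib_left)
qed

text \<open>Dividing \<open>sum_fder_dens\<close> by the density expresses the divergence through
  derivatives of C1 functions, so continuity of \<open>Gam\<close>, a definite description, need not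
  be discussed.\<close>

lemma continuous_on_etrace_nabla:
  assumes "C1_on S X" shows "continuous_on S (\<lambda>x. etrace (nabla X x))"
proof -
  have X: "X differentiable (at x)" if "x \<in> S" for x
    using C1_on_has_derivative[OF assms that] by (rule differentiableI)
  have "etrace (nabla X x) = (\<Sum>b\<in>Basis. fder (\<lambda>y. dens y * (X y \<bullet> b)) x b) / dens x" if "x \<in> S" for x
    using sum_fder_dens[OF that X[OF that]] dens_pos[OF that] by (simp add: field_simps)
  moreover have "continuous_on S (\<lambda>x. (\<Sum>b\<in>Basis. fder (\<lambda>y. dens y * (X y \<bullet> b)) x b) / dens x)"
    using dens_pos
    by (intro continuous_on_divide continuous_on_sum C1_on_continuous_fder C1_on_mult C1_on_dens
        C1_on_inner C1_on_const assms C1_on_continuous) fastforce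
  ultimately show ?thesis by (simp cong: continuous_on_cong)
qed

text \<open>The field times the density is compactly supported inside \<open>S\<close> and extends
  by 0 to a C1 field on the whole space, where each component derivative has integral 0.\<close>

lemma integral_divergence:
  assumes Z: "C1_on UNIV Z" and C: "compact C" "C \<subseteq> S" "\<And>x. x \<notin> C \<Longrightarrow> Z x = 0"
  shows "continuous_on UNIV (\<lambda>x. indicator S x * (dens x * etrace (nabla Z x)))"
    and "(\<integral>x. indicator S x * (dens x * etrace (nabla Z x)) \<partial>lborel) = 0"
    and "x \<notin> C \<Longrightarrow> indicator S x * (dens x * etrace (nabla Z x)) = 0"
proof -
  let ?F = "\<lambda>b y. dens y * (Z y \<bullet> b)"
  have F: "C1_on UNIV (?F b)" for b
  proof (rule C1_on_UNIV_if_support[OF _ open_S compact_imp_closed[OF C(1)] C(2)])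
    show "C1_on S (?F b)"
      by (intro C1_on_mult C1_on_dens C1_on_inner C1_on_const C1_on_subset[OF Z]) auto
  qed (simp add: C)
  have F0: "fder (?F b) x v = 0" if "x \<notin> C" for b x v
    by (rule fder_eq_0_off_support[OF compact_imp_closed[OF C(1)] _ that]) (simp add: C)
  have eq: "indicator S x * (dens x * etrace (nabla Z x)) = (\<Sum>b\<in>Basis. fder (?F b) x b)" for x
  proof (cases "x \<in> S")
    case True
    then show ?thesis
      using sum_fder_dens[OF True differentiableI[OF C1_on_has_derivative[OF Z]]] by simp
  next
    case False
    then have "x \<notin> C" using C(2) by auto
    then show ?thesis using F0[of x] False by simp
  qed
  show "continuous_on UNIV (\<lambda>x. indicator S x * (dens x * etrace (nabla Z x)))"
    unfolding eq by (intro continuous_on_sum C1_on_continuous_fder F)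
  have int: "integrable lborel (\<lambda>x. fder (?F b) x v)" for b v
    by (rule integrable_compact_support[OF C1_on_continuous_fder[OF F] C(1) F0])
  show "(\<integral>x. indicator S x * (dens x * etrace (nabla Z x)) \<partial>lborel) = 0"
    unfolding eq
    by (simp add: Bochner_Integration.integral_sum[OF int] integral_fder_compact_support[OF F C(1)] C)
  show "x \<notin> C \<Longrightarrow> indicator S x * (dens x * etrace (nabla Z x)) = 0"
    unfolding eq by (simp add: F0)
qed

end

text \<open>The transformation law of the Christoffel symbols. Differentiating the relation between
  the metrics produces terms with the second derivative \<open>H\<close> of \<phi>; since
  \<open>H\<close> is symmetric, the Koszul combination keeps only twice the inner product of
  \<open>H u v\<close> with \<open>L z\<close>.\<close>

lemma metric_field_transform:
  fixes \<phi> :: "'e::euclidean_space \<Rightarrow> 'e"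
  assumes "metric_field S1 G1" "metric_field S2 G2" and T: "open T" "T \<subseteq> S1" "\<phi> ` T \<subseteq> S2"
    and \<phi>: "C1_on T \<phi>" "\<And>v. C1_on T (\<lambda>x. fder \<phi> x v)"
    and G: "\<And>x u v. x \<in> T \<Longrightarrow> G1 x u v = G2 (\<phi> x) (fder \<phi> x u) (fder \<phi> x v)"
    and x: "x \<in> T" and surj: "surj (fder \<phi> x)"
  shows "fder \<phi> x (metric_field.Gam G1 x u v) =
    metric_field.Gam G2 (\<phi> x) (fder \<phi> x u) (fder \<phi> x v) + fder (\<lambda>y. fder \<phi> y v) x u"
proof -
  interpret m1: metric_field S1 G1 by fact
  interpret m2: metric_field S2 G2 by fact
  have x1: "x \<in> S1" and x2: "\<phi> x \<in> S2" using T x by auto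
  interpret i2: inner_form "G2 (\<phi> x)" using m2.inner_form[OF x2] .
  define L where "L = fder \<phi> x"
  define H where "H = (\<lambda>u v. fder (\<lambda>y. fder \<phi> y v) x u)"
  have dL: "((\<lambda>y. fder \<phi> y v) has_derivative (\<lambda>u. H u v)) (at x)" for v
    unfolding H_def by (rule C1_on_has_derivative[OF \<phi>(2) x])
  \<comment> \<open>Done component by component, because the symmetry lemma is about real-valued
    functions.\<close>
  have Hsym: "H u v = H v u" for u v
  proof (rule euclidean_eqI)
    fix b :: 'e assume "b \<in> Basis"
    have d: "((\<lambda>y. \<phi> y \<bullet> b) has_derivative (\<lambda>v. fder \<phi> y v \<bullet> b)) (at y)" if "y \<in> T" for y
      by (intro has_derivative_inner_left C1_on_has_derivative[OF \<phi>(1) that])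
    have e: "fder (\<lambda>y. \<phi> y \<bullet> b) y v = fder \<phi> y v \<bullet> b" if "y \<in> T" for y v
      using fder_eqI[OF d[OF that]] by simp
    have "fder (\<lambda>y. fder (\<lambda>y. \<phi> y \<bullet> b) y v) x u = H u v \<bullet> b" for u v
    proof -
      have "fder (\<lambda>y. fder (\<lambda>y. \<phi> y \<bullet> b) y v) x = fder (\<lambda>y. fder \<phi> y v \<bullet> b) x"
        by (rule fder_cong_open[OF T(1) x e])
      also have "\<dots> = (\<lambda>u. H u v \<bullet> b)" by (rule fder_eqI[OF has_derivative_inner_left[OF dL]])
      finally show ?thesis by simp
    qed
    moreover have "C1_on T (\<lambda>y. fder (\<lambda>y. \<phi> y \<bullet> b) y v)" for v
      by (rule C1_on_cong[OF T(1) e]) (auto intro: C1_on_inner \<phi>(2))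
    ultimately show "H u v \<bullet> b = H v u \<bullet> b"
      using second_derivative_symmetric_real[OF T(1) x, of "\<lambda>y. \<phi> y \<bullet> b" v u] d
      by (metis differentiableI)
  qed
  have DG: "m1.DG x z u v = m2.DG (\<phi> x) (L z) (L u) (L v) + G2 (\<phi> x) (H z u) (L v) + G2 (\<phi> x) (L u) (H z v)" for z u v
  proof -
    have "((\<lambda>y. G2 (\<phi> y) (fder \<phi> y u) (fder \<phi> y v)) has_derivative (\<lambda>z. m2.DG (\<phi> x) (L z) (L u) (L v)
        + G2 (\<phi> x) (H z u) (L v) + G2 (\<phi> x) (L u) (H z v))) (at x)"
      unfolding L_def
    proof (rule has_derivative_bilinear_family[OF T(1) x, where H'="\<lambda>u v z. m2.DG (\<phi> x) (fder \<phi> x z) u v"])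
      show "((\<lambda>y. G2 (\<phi> y) u v) has_derivative (\<lambda>z. m2.DG (\<phi> x) (fder \<phi> x z) u v)) (at x)" for u v
        by (rule has_derivative_compose[OF C1_on_has_derivative[OF \<phi>(1) x] m2.DG[OF x2]])
    next
      fix y u v assume "y \<in> T"
      then interpret iy: inner_form "G2 (\<phi> y)" using T(3) by (auto intro: m2.inner_form)
      show "linear (\<lambda>u. G2 (\<phi> y) u v)" "linear (G2 (\<phi> y) u)" by (fact iy.linear_left iy.linear_right)+
    qed (use dL in auto)
    then have "((\<lambda>y. G1 y u v) has_derivative (\<lambda>z. m2.DG (\<phi> x) (L z) (L u) (L v)
        + G2 (\<phi> x) (H z u) (L v) + G2 (\<phi> x) (L u) (H z v))) (at x)"
      by (rule has_derivative_transform_within_open[OF _ T(1) x]) (use G in auto)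
    then show ?thesis using fun_cong[OF has_derivative_unique[OF m1.DG[OF x1]]] by blast
  qed
  \<comment> \<open>Surjectivity of the derivative gives a preimage \<open>w\<close> of the desired
    right-hand side, and the Koszul formula of the first metric identifies \<open>w\<close> with the
    Christoffel vector.\<close>
  obtain w where w: "L w = m2.Gam (\<phi> x) (L u) (L v) + H u v"
    using surj unfolding L_def by (metis surjD)
  have "m1.Gam x u v = w"
  proof (rule m1.Gam_eqI[OF x1])
    fix z
    have "2 * G1 x w z = 2 * G2 (\<phi> x) (m2.Gam (\<phi> x) (L u) (L v)) (L z) + 2 * G2 (\<phi> x) (H u v) (L z)"
      using G[OF x, of w z] w by (simp add: L_def[symmetric] i2.add_left)
    also have "\<dots> = m1.DG x u v z + m1.DG x v u z - m1.DG x z u v"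
      unfolding m2.Gam_eq[OF x2] DG
      using Hsym[of u v] Hsym[of u z] Hsym[of v z] i2.sym[of "H z v" "L u"] i2.sym[of "H z u" "L v"] by simp
    finally show "2 * G1 x w z = m1.DG x u v z + m1.DG x v u z - m1.DG x z u v" .
  qed
  then show ?thesis using w by (simp add: L_def H_def)
qed

text \<open>Differentiating the pushed-forward field yields a second-derivative term of \<phi>,
  which cancels the inhomogeneous term in the law for the Christoffel symbols.\<close>

lemma nabla_transform:
  fixes \<phi> :: "'e::euclidean_space \<Rightarrow> 'e"
  assumes "metric_field S1 G1" "metric_field S2 G2" and T: "open T" "T \<subseteq> S1" "\<phi> ` T \<subseteq> S2"
    and \<phi>: "C1_on T \<phi>" "\<And>v. C1_on T (\<lambda>x. fder \<phi> x v)"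
    and G: "\<And>x u v. x \<in> T \<Longrightarrow> G1 x u v = G2 (\<phi> x) (fder \<phi> x u) (fder \<phi> x v)"
    and x: "x \<in> T" and surj: "surj (fder \<phi> x)"
    and X1: "X1 differentiable (at x)" and X2: "X2 differentiable (at (\<phi> x))"
    and X: "\<And>y. y \<in> T \<Longrightarrow> X2 (\<phi> y) = fder \<phi> y (X1 y)"
  shows "fder \<phi> x (metric_field.nabla G1 X1 x u) = metric_field.nabla G2 X2 (\<phi> x) (fder \<phi> x u)"
proof -
  interpret m1: metric_field S1 G1 by fact
  interpret m2: metric_field S2 G2 by fact
  have X1': "(X1 has_derivative fder X1 x) (at x)" and X2': "(X2 has_derivative fder X2 (\<phi> x)) (at (\<phi> x))"
    using X1 X2 by (simp_all add: frechet_derivative_works[symmetric])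
  have lin: "linear (fder \<phi> y)" if "y \<in> T" for y
    using C1_on_has_derivative[OF \<phi>(1) that] by (rule has_derivative_linear)
  have d1: "((\<lambda>y. fder \<phi> y (X1 y)) has_derivative (\<lambda>u. fder (\<lambda>y. fder \<phi> y (X1 x)) x u + fder \<phi> x (fder X1 x u))) (at x)"
    by (rule has_derivative_linear_family[OF T(1) x, where B'="\<lambda>w. fder (\<lambda>y. fder \<phi> y w) x"])
      (use lin X1' C1_on_has_derivative[OF \<phi>(2) x] in auto)
  have d2: "((\<lambda>y. fder \<phi> y (X1 y)) has_derivative (\<lambda>u. fder X2 (\<phi> x) (fder \<phi> x u))) (at x)"
    by (rule has_derivative_transform_within_open[OF has_derivative_compose[OF C1_on_has_derivative[OF \<phi>(1) x] X2'] T(1) x])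
      (use X in auto)
  have "fder X2 (\<phi> x) (fder \<phi> x u) = fder (\<lambda>y. fder \<phi> y (X1 x)) x u + fder \<phi> x (fder X1 x u)"
    by (rule fun_cong[OF has_derivative_unique[OF d2 d1]])
  then show ?thesis
    using metric_field_transform[OF assms(1-10), of u "X1 x"] X[OF x]
    by (simp add: m1.nabla_def m2.nabla_def linear_add[OF lin[OF x]])
qed

section \<open>Charts and the Riemannian density\<close>

locale smooth_manifold =
  fixes \<A> :: "('a::{t2_space,second_countable_topology}, 'e::euclidean_space) chart set"
  assumes smooth_structure: "smooth_structure \<A>"
begin

definition overlap :: "('a, 'e) chart \<Rightarrow> ('a, 'e) chart \<Rightarrow> 'e set" where
  "overlap c d = cmap c ` (cdom c \<inter> cdom d)"

abbreviation trans :: "('a, 'e) chart \<Rightarrow> ('a, 'e) chart \<Rightarrow> 'e \<Rightarrow> 'e" where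
  "trans c d \<equiv> cmap d \<circ> cinv c"

context
  fixes c assumes c: "c \<in> \<A>"
begin

lemma chart: "is_chart c"
  using smooth_structure c unfolding smooth_structure_def by blast

lemma open_cdom: "open (cdom c)" and open_cimg: "open (cimg c)"
  using chart unfolding is_chart_def by auto

lemma chart_homeo: "homeomorphism (cdom c) (cimg c) (cmap c) (cinv c)"
  using chart unfolding is_chart_def by auto

lemma cinv_cmap: "p \<in> cdom c \<Longrightarrow> cinv c (cmap c p) = p"
  using chart_homeo unfolding homeomorphism_def by auto

lemma cmap_cinv: "x \<in> cimg c \<Longrightarrow> cmap c (cinv c x) = x"
  using chart_homeo unfolding homeomorphism_def by auto

lemma cmap_in: "p \<in> cdom c \<Longrightarrow> cmap c p \<in> cimg c"
  unfolding cimg_def by auto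

lemma cinv_in: "x \<in> cimg c \<Longrightarrow> cinv c x \<in> cdom c"
  using chart_homeo unfolding homeomorphism_def by auto

lemma continuous_on_cmap: "continuous_on (cdom c) (cmap c)"
  and continuous_on_cinv: "continuous_on (cimg c) (cinv c)"
  using chart_homeo unfolding homeomorphism_def by auto

lemma cmap_image_eq: "W \<subseteq> cdom c \<Longrightarrow> cmap c ` W = {x \<in> cimg c. cinv c x \<in> W}"
  by (auto simp: cmap_in cinv_cmap cmap_cinv image_iff subset_iff) (metis cmap_cinv)

lemma open_cmap_image: assumes "open W" "W \<subseteq> cdom c" shows "open (cmap c ` W)"
proof -
  have "cmap c ` W = cinv c -` W \<inter> cimg c" using cmap_image_eq[OF assms(2)] by auto
  then show ?thesis
    using continuous_on_open_vimage[OF open_cimg, of "cinv c"] continuous_on_cinv assms by auto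
qed

lemma compact_cmap_image: "compact C \<Longrightarrow> C \<subseteq> cdom c \<Longrightarrow> compact (cmap c ` C)"
  by (meson compact_continuous_image continuous_on_cmap continuous_on_subset)

end

lemma chart_ex: "\<exists>c\<in>\<A>. p \<in> cdom c"
  using smooth_structure unfolding smooth_structure_def by blast

lemma overlap_eq: "c \<in> \<A> \<Longrightarrow> overlap c d = {x \<in> cimg c. cinv c x \<in> cdom d}"
  unfolding overlap_def by (subst cmap_image_eq) (auto intro: cinv_in)

context
  fixes c d assumes c: "c \<in> \<A>" and d: "d \<in> \<A>"
begin

lemma open_overlap: "open (overlap c d)"
  unfolding overlap_def by (intro open_cmap_image open_Int open_cdom c d) auto

lemma overlap_subset: "overlap c d \<subseteq> cimg c"
  unfolding overlap_eq[OF c] by auto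

lemma overlapI: "p \<in> cdom c \<Longrightarrow> p \<in> cdom d \<Longrightarrow> cmap c p \<in> overlap c d"
  unfolding overlap_def by auto

lemma trans_in: "x \<in> overlap c d \<Longrightarrow> trans c d x \<in> overlap d c"
  by (auto simp: overlap_def cinv_cmap c d)

lemma trans_image: "trans c d ` overlap c d = overlap d c"
  by (force simp: overlap_def image_iff cinv_cmap c d)

lemma cinv_trans: "x \<in> overlap c d \<Longrightarrow> cinv d (trans c d x) = cinv c x"
  by (auto simp: overlap_def cinv_cmap c d)

lemma trans_trans: "x \<in> overlap c d \<Longrightarrow> trans d c (trans c d x) = x"
  by (auto simp: overlap_def cinv_cmap c d)

lemma inj_on_trans: "inj_on (trans c d) (overlap c d)"
  by (metis inj_onI trans_trans)

lemma C1_on_trans: "C1_on (overlap c d) (trans c d)"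
  and C1_on_fder_trans: "C1_on (overlap c d) (\<lambda>x. fder (trans c d) x v)"
proof -
  have *: "Ck_on k (overlap c d) (trans c d)" for k
    using smooth_structure c d
    unfolding smooth_structure_def smooth_transition_def smooth_on_def overlap_def by blast
  show "C1_on (overlap c d) (trans c d)" using *[of "Suc 0"] unfolding C1_on_iff_Ck .
  show "C1_on (overlap c d) (\<lambda>x. fder (trans c d) x v)"
    using *[of "Suc (Suc 0)"] unfolding C1_on_iff_Ck Ck_on.simps(2)[of "Suc 0"] by blast
qed

lemma has_derivative_trans: "p \<in> cdom c \<Longrightarrow> p \<in> cdom d \<Longrightarrow>
    (trans c d has_derivative transition_deriv c d p) (at (cmap c p))"
  unfolding transition_deriv_def by (intro C1_on_has_derivative[OF C1_on_trans] overlapI)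

lemma linear_transition: "p \<in> cdom c \<Longrightarrow> p \<in> cdom d \<Longrightarrow> linear (transition_deriv c d p)"
  using has_derivative_trans by (rule has_derivative_linear)

end

section \<open>Transition derivatives and components of tangent vectors\<close>

lemma transition_id:
  assumes "c \<in> \<A>" "p \<in> cdom c" shows "transition_deriv c c p u = u"
proof -
  have "((\<lambda>x. x) has_derivative transition_deriv c c p) (at (cmap c p))"
    by (rule has_derivative_transform_within_open[OF has_derivative_trans[OF assms(1,1,2,2)] open_cimg[OF assms(1)]])
      (use assms in \<open>auto simp: cmap_in cmap_cinv\<close>)
  from has_derivative_unique[OF this has_derivative_ident] show ?thesis by simp
qed

lemma transition_transition:
  assumes "c \<in> \<A>" "d \<in> \<A>" "e \<in> \<A>" "p \<in> cdom c" "p \<in> cdom d" "p \<in> cdom e"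
  shows "transition_deriv d e p (transition_deriv c d p u) = transition_deriv c e p u"
proof -
  let ?W = "cmap c ` (cdom c \<inter> cdom d \<inter> cdom e)"
  have "(trans d e has_derivative transition_deriv d e p) (at (trans c d (cmap c p)))"
    using has_derivative_trans[of d e p] assms by (simp add: cinv_cmap)
  from has_derivative_compose[OF has_derivative_trans[of c d p] this]
  have "((\<lambda>x. trans d e (trans c d x)) has_derivative (\<lambda>u. transition_deriv d e p (transition_deriv c d p u))) (at (cmap c p))"
    using assms by blast
  then have "(trans c e has_derivative (\<lambda>u. transition_deriv d e p (transition_deriv c d p u))) (at (cmap c p))"
    by (rule has_derivative_transform_within_open[where s="?W"])
      (use assms in \<open>auto intro!: open_cmap_image open_Int open_cdom simp: cinv_cmap\<close>)
  from has_derivative_unique[OF this has_derivative_trans[of c e p]] assms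
  show ?thesis by metis
qed

lemma transition_inverse:
  assumes "c \<in> \<A>" "d \<in> \<A>" "p \<in> cdom c" "p \<in> cdom d"
  shows "transition_deriv d c p (transition_deriv c d p u) = u"
  using transition_transition[OF assms(1,2,1,3,4,3)] transition_id[OF assms(1,3)] by simp

context
  fixes c p assumes c: "c \<in> \<A>" and p: "p \<in> cdom c"
begin

lemma coord_vec_tangent: "coord_vec \<A> c p u \<in> tangent_space \<A> p"
  unfolding tangent_space_def coord_vec_def using c p by (auto simp: transition_transition[OF c _ _ p])

lemma coord_vec_chart: "d \<in> \<A> \<Longrightarrow> p \<in> cdom d \<Longrightarrow> coord_vec \<A> c p u d = transition_deriv c d p u"
  by (simp add: coord_vec_def)

lemma coord_vec_self [simp]: "coord_vec \<A> c p u c = u"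
  using c p by (simp add: coord_vec_def transition_id)

lemma coord_vec_eq:
  assumes "v \<in> tangent_space \<A> p" shows "coord_vec \<A> c p (v c) = v"
proof
  fix d
  have "v d = transition_deriv c d p (v c)" if "d \<in> \<A>" "p \<in> cdom d"
    using assms that c p unfolding tangent_space_def by blast
  moreover have "v d = 0" if "\<not> (d \<in> \<A> \<and> p \<in> cdom d)"
    using assms that unfolding tangent_space_def by blast
  ultimately show "coord_vec \<A> c p (v c) d = v d" by (simp add: coord_vec_def)
qed

lemma coord_vec_add: "coord_vec \<A> c p (u + v) = tadd (coord_vec \<A> c p u) (coord_vec \<A> c p v)"
  using c p by (auto simp: coord_vec_def tadd_def fun_eq_iff linear_add[OF linear_transition])

lemma coord_vec_scale: "coord_vec \<A> c p (r *\<^sub>R u) = tscale r (coord_vec \<A> c p u)"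
  using c p by (auto simp: coord_vec_def tscale_def fun_eq_iff linear_scale[OF linear_transition])

lemma coord_vec_transition:
  "d \<in> \<A> \<Longrightarrow> p \<in> cdom d \<Longrightarrow> coord_vec \<A> d p (transition_deriv c d p u) = coord_vec \<A> c p u"
  using c p by (auto simp: coord_vec_def fun_eq_iff transition_transition[OF c _ _ p])

end

lemma tangent_transition:
  assumes "v \<in> tangent_space \<A> p" "c \<in> \<A>" "d \<in> \<A>" "p \<in> cdom c" "p \<in> cdom d"
  shows "transition_deriv c d p (v c) = v d"
  using assms(1)[unfolded tangent_space_def, THEN CollectD, THEN conjunct1, rule_format, OF assms(2,3)] assms(4,5)
  by (metis IntI)

end

locale riemannian_manifold = smooth_manifold \<A>
  for \<A> :: "('a::{t2_space,second_countable_topology}, 'e::euclidean_space) chart set" +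
  fixes g :: "('a, 'e) metric"
  assumes riemannian_metric: "riemannian_metric \<A> g"
begin

lemma metric_field_chart:
  assumes c: "c \<in> \<A>" shows "metric_field (cimg c) (local_metric \<A> g c)"
proof (rule metric_field.intro)
  show "open (cimg c)" by (rule open_cimg[OF c])
  show "C1_on (cimg c) (\<lambda>x. local_metric \<A> g c x u v)" for u v
    using riemannian_metric c unfolding riemannian_metric_def smooth_on_def C1_on_iff_Ck by blast
  fix x assume x: "x \<in> cimg c"
  let ?p = "cinv c x"
  have p: "?p \<in> cdom c" by (rule cinv_in[OF c x])
  note tan = coord_vec_tangent[OF c p]
  note rm = riemannian_metric[unfolded riemannian_metric_def]
  show "inner_form (local_metric \<A> g c x)"
  proof (rule inner_form.intro)
    show "linear (\<lambda>u. local_metric \<A> g c x u v)" for v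
      unfolding local_metric_def
      by (rule linearI) (use rm tan in \<open>auto simp: coord_vec_add[OF c p] coord_vec_scale[OF c p]\<close>)
    show "local_metric \<A> g c x u v = local_metric \<A> g c x v u" for u v
      unfolding local_metric_def using rm tan by blast
    show "local_metric \<A> g c x u u > 0" if "u \<noteq> 0" for u
    proof -
      have "coord_vec \<A> c ?p u \<noteq> tzero"
        using that coord_vec_self[OF c p] by (metis tzero_def)
      then show ?thesis unfolding local_metric_def using rm tan by blast
    qed
  qed
qed

lemma metric_chart:
  assumes "c \<in> \<A>" "p \<in> cdom c" "u \<in> tangent_space \<A> p" "v \<in> tangent_space \<A> p"
  shows "local_metric \<A> g c (cmap c p) (u c) (v c) = g p u v"
  using assms by (simp add: local_metric_def cinv_cmap coord_vec_eq)

lemma local_metric_trans: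
  assumes "c \<in> \<A>" "d \<in> \<A>" "x \<in> overlap c d"
  shows "local_metric \<A> g c x u v =
    local_metric \<A> g d (trans c d x) (fder (trans c d) x u) (fder (trans c d) x v)"
proof -
  obtain p where p: "p \<in> cdom c" "p \<in> cdom d" "x = cmap c p" using assms by (auto simp: overlap_def)
  then show ?thesis
    using coord_vec_transition[of c p d] assms
    by (simp add: local_metric_def cinv_cmap transition_deriv_def)
qed

abbreviation cnabla :: "('a, 'e) chart \<Rightarrow> ('a \<Rightarrow> ('a, 'e) tvec) \<Rightarrow> 'e \<Rightarrow> 'e \<Rightarrow> 'e" where
  "cnabla c X \<equiv> metric_field.nabla (local_metric \<A> g c) (\<lambda>x. X (cinv c x) c)"

abbreviation cdens :: "('a, 'e) chart \<Rightarrow> 'e \<Rightarrow> real" where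
  "cdens c \<equiv> metric_field.dens (local_metric \<A> g c)"

lemma cov_deriv_chart:
  assumes "c \<in> \<A>" "p \<in> cdom c"
  shows "cov_deriv \<A> g X p v c = cnabla c X (cmap c p) (v c)"
proof -
  interpret m: metric_field "cimg c" "local_metric \<A> g c" by (rule metric_field_chart[OF assms(1)])
  have "christoffel \<A> g c (cmap c p) (v c) (X p c) = m.Gam (cmap c p) (v c) (X p c)"
    unfolding christoffel_def m.Gam_def m.DG_def ..
  then show ?thesis using assms by (simp add: cov_deriv_def m.nabla_def cinv_cmap)
qed

definition C1_field :: "('a \<Rightarrow> ('a, 'e) tvec) \<Rightarrow> bool" where
  "C1_field X \<longleftrightarrow> (\<forall>p. X p \<in> tangent_space \<A> p) \<and> (\<forall>c\<in>\<A>. C1_on (cimg c) (\<lambda>x. X (cinv c x) c))"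

lemma vector_field_C1: "vector_field \<A> X \<Longrightarrow> C1_field X"
  unfolding vector_field_def C1_field_def smooth_on_def C1_on_iff_Ck by blast

lemma field_trans:
  assumes "C1_field X" "c \<in> \<A>" "d \<in> \<A>" "x \<in> overlap c d"
  shows "X (cinv d (trans c d x)) d = fder (trans c d) x (X (cinv c x) c)"
proof -
  obtain p where p: "p \<in> cdom c" "p \<in> cdom d" "x = cmap c p" using assms by (auto simp: overlap_def)
  have "X p d = transition_deriv c d p (X p c)"
    using assms p unfolding C1_field_def tangent_space_def by blast
  then show ?thesis using assms p by (simp add: cinv_cmap transition_deriv_def)
qed

lemma C1_field_differentiable:
  "C1_field X \<Longrightarrow> c \<in> \<A> \<Longrightarrow> x \<in> cimg c \<Longrightarrow> (\<lambda>x. X (cinv c x) c) differentiable (at x)"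
  unfolding C1_field_def by (meson C1_on_has_derivative differentiableI)

text \<open>\<open>cov_deriv\<close> is a family of chart expressions;
  \<open>nabla_transform\<close> shows that they are the components of one vector. Only then may the
  metric axioms be applied to it.\<close>

lemma cov_deriv_tangent:
  assumes X: "C1_field X" and v: "v \<in> tangent_space \<A> p"
  shows "cov_deriv \<A> g X p v \<in> tangent_space \<A> p"
  unfolding tangent_space_def
proof (intro CollectI conjI ballI allI impI)
  fix c d assume c: "c \<in> \<A>" and d: "d \<in> \<A>" and "p \<in> cdom c \<inter> cdom d"
  then have p: "p \<in> cdom c" "p \<in> cdom d" by auto
  let ?x = "cmap c p"
  have x: "?x \<in> overlap c d" by (rule overlapI[OF c d p])
  have "fder (trans c d) ?x (cnabla c X ?x (v c)) = cnabla d X (trans c d ?x) (fder (trans c d) ?x (v c))"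
  proof (rule nabla_transform[OF metric_field_chart[OF c] metric_field_chart[OF d] open_overlap[OF c d]
        overlap_subset[OF c d] _ C1_on_trans[OF c d] C1_on_fder_trans[OF c d] local_metric_trans[OF c d] x])
    show "trans c d ` overlap c d \<subseteq> cimg d" using trans_image[OF c d] overlap_subset[OF d c] by simp
    show "surj (fder (trans c d) ?x)"
      using transition_inverse[OF d c p(2,1)] unfolding transition_deriv_def by (metis surjI)
    show "(\<lambda>x. X (cinv c x) c) differentiable at ?x"
      by (rule C1_field_differentiable[OF X c cmap_in[OF c p(1)]])
    show "(\<lambda>x. X (cinv d x) d) differentiable at (trans c d ?x)"
      by (rule C1_field_differentiable[OF X d]) (use p c in \<open>simp add: cinv_cmap cmap_in d\<close>)
    show "X (cinv d (trans c d y)) d = fder (trans c d) y (X (cinv c y) c)" if "y \<in> overlap c d" for y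
      by (rule field_trans[OF X c d that])
  qed
  moreover have "v d = fder (trans c d) ?x (v c)"
    using v c d p unfolding tangent_space_def transition_deriv_def by blast
  ultimately show "cov_deriv \<A> g X p v d = transition_deriv c d p (cov_deriv \<A> g X p v c)"
    using p c d by (simp add: cov_deriv_chart transition_deriv_def cinv_cmap)
qed (auto simp: cov_deriv_def)

text \<open>Gram determinants change by the square of the Jacobian determinant; the square root
  leaves its absolute value.\<close>

lemma cdens_trans:
  assumes c: "c \<in> \<A>" and d: "d \<in> \<A>" and x: "x \<in> overlap c d"
  shows "cdens c x = \<bar>edet (fder (trans c d) x)\<bar> * cdens d (trans c d x)"
proof -
  interpret mc: metric_field "cimg c" "local_metric \<A> g c" by (rule metric_field_chart[OF c])
  interpret md: metric_field "cimg d" "local_metric \<A> g d" by (rule metric_field_chart[OF d])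
  interpret i: inner_form "local_metric \<A> g d (trans c d x)"
    using md.inner_form trans_in[OF c d x] overlap_subset[OF d c] by auto
  have lin: "linear (fder (trans c d) x)"
    using C1_on_has_derivative[OF C1_on_trans[OF c d] x] by (rule has_derivative_linear)
  have "det (\<chi> i j. local_metric \<A> g c x (Rep_bidx i) (Rep_bidx j)) =
    (edet (fder (trans c d) x))\<^sup>2 * det (\<chi> i j. local_metric \<A> g d (trans c d x) (Rep_bidx i) (Rep_bidx j))"
    unfolding local_metric_trans[OF c d x]
    by (rule edet_bilinear_form[OF lin i.linear_left i.linear_right])
  then show ?thesis by (simp add: mc.dens_def md.dens_def real_sqrt_mult)
qed

text \<open>The integral of \<open>h\<close> against the Riemannian volume, as seen by one chart. It
  is meaningful for \<open>h\<close> supported in the domain of \<open>c\<close>; the indicator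
  removes the arbitrary values of \<open>cinv c\<close> off the image.\<close>

definition cint :: "('a, 'e) chart \<Rightarrow> ('a \<Rightarrow> real) \<Rightarrow> real" where
  "cint c h = (\<integral>x. indicator (cimg c) x * (cdens c x * h (cinv c x)) \<partial>lborel)"

context
  fixes c and h :: "'a \<Rightarrow> real" and C
  assumes c: "c \<in> \<A>" and h: "continuous_on UNIV h" and C: "compact C" "C \<subseteq> cdom c" "\<And>p. p \<notin> C \<Longrightarrow> h p = 0"
begin

lemma chart_integrand_eq_0:
  assumes "x \<notin> cmap c ` C" shows "indicator (cimg c) x * (cdens c x * h (cinv c x)) = 0"
proof (cases "x \<in> cimg c")
  case True
  then have "cinv c x \<notin> C" using assms by (metis c cmap_cinv image_eqI)
  then show ?thesis using C by simp
qed simp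

lemma continuous_on_chart_integrand:
  "continuous_on UNIV (\<lambda>x. indicator (cimg c) x * (cdens c x * h (cinv c x)))" (is "continuous_on _ ?F")
proof -
  interpret m: metric_field "cimg c" "local_metric \<A> g c" by (rule metric_field_chart[OF c])
  have cl: "closed (cmap c ` C)" using compact_cmap_image[OF c C(1,2)] by (rule compact_imp_closed)
  have "continuous_on (cimg c) (\<lambda>x. cdens c x * h (cinv c x))"
    by (intro continuous_on_mult C1_on_continuous[OF m.C1_on_dens] continuous_on_compose2[OF h continuous_on_cinv[OF c]]) auto
  then have "continuous_on (cimg c) ?F" by (simp cong: continuous_on_cong)
  moreover have "continuous_on (- cmap c ` C) ?F"
    by (subst continuous_on_cong[OF refl chart_integrand_eq_0]) auto
  ultimately have "continuous_on (cimg c \<union> - cmap c ` C) ?F"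
    using cl open_cimg[OF c] by (intro continuous_on_open_Un) auto
  moreover have "cimg c \<union> - cmap c ` C = UNIV" using C(2) cmap_in[OF c] by auto
  ultimately show ?thesis by simp
qed

lemma integrable_chart_integrand: "integrable lborel (\<lambda>x. indicator (cimg c) x * (cdens c x * h (cinv c x)))"
  by (rule integrable_compact_support[OF continuous_on_chart_integrand compact_cmap_image[OF c C(1,2)]
        chart_integrand_eq_0])

end

text \<open>Change of variables along the transition map: the Jacobian factor is exactly the
  quotient of the two densities.\<close>

lemma cint_eq:
  assumes c: "c \<in> \<A>" and d: "d \<in> \<A>" and h: "continuous_on UNIV h"
    and C: "compact C" "C \<subseteq> cdom c \<inter> cdom d" "\<And>p. p \<notin> C \<Longrightarrow> h p = 0"
  shows "cint c h = cint d h"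
proof -
  let ?T = "overlap c d" and ?\<phi> = "trans c d"
  \<comment> \<open>Because \<open>h\<close> is supported in both domains, integrating over the
    overlap or over the full image of a chart is the same.\<close>
  have rest: "indicator (overlap c' d') x * (cdens c' x * h (cinv c' x)) = indicator (cimg c') x * (cdens c' x * h (cinv c' x))"
    if "c' \<in> \<A>" "C \<subseteq> cdom d'" for c' d' x
    using that C(3)[of "cinv c' x"] by (auto simp: indicator_def overlap_eq)
  have eq: "indicator ?T x * (\<bar>edet (fder ?\<phi> x)\<bar> * (cdens d (?\<phi> x) * h (cinv d (?\<phi> x)))) =
      indicator (cimg c) x * (cdens c x * h (cinv c x))" for x
    unfolding rest[OF c, of d x, symmetric, OF order_trans[OF C(2) Int_lower2]]
    using cinv_trans[OF c d, of x] cdens_trans[OF c d, of x] by (auto simp: indicator_def)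
  have eq2: "indicator (?\<phi> ` ?T) y * (cdens d y * h (cinv d y)) = indicator (cimg d) y * (cdens d y * h (cinv d y))" for y
    unfolding trans_image[OF c d] using rest[OF d, of c] C(2) by auto
  have Cc: "C \<subseteq> cdom c" and Cd: "C \<subseteq> cdom d" using C(2) by auto
  have "(\<integral>x. indicator ?T x * (\<bar>edet (fder ?\<phi> x)\<bar> * (cdens d (?\<phi> x) * h (cinv d (?\<phi> x)))) \<partial>lborel)
      = (\<integral>y. indicator (?\<phi> ` ?T) y * (cdens d y * h (cinv d y)) \<partial>lborel)"
  proof (rule change_of_variables_lborel[OF open_overlap[OF c d] C1_on_has_derivative[OF C1_on_trans[OF c d]] inj_on_trans[OF c d]])
    show "integrable lborel (\<lambda>y. indicator (?\<phi> ` ?T) y * (cdens d y * h (cinv d y)))"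
      unfolding eq2 by (rule integrable_chart_integrand[OF d h C(1) Cd C(3)])
    show "(\<lambda>x. indicator ?T x * (\<bar>edet (fder ?\<phi> x)\<bar> * (cdens d (?\<phi> x) * h (cinv d (?\<phi> x))))) \<in> borel_measurable borel"
      unfolding eq by (intro borel_measurable_continuous_onI continuous_on_chart_integrand[OF c h C(1) Cc C(3)])
  qed
  then show ?thesis unfolding eq eq2 cint_def .
qed

end

section \<open>The divergence theorem\<close>

text \<open>The C1 cutoff from which both the bump functions and the coefficients of the comparison
  field are built.\<close>

lemma has_real_derivative_max_0_square: "((\<lambda>t. (max 0 t)\<^sup>2) has_real_derivative 2 * max 0 t) (at t)" for t :: real
proof -
  consider "t > 0" | "t < 0" | "t = 0" by linarith
  then show ?thesis
  proof cases
    case 1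
    have "((\<lambda>t. t\<^sup>2) has_real_derivative 2 * max 0 t) (at t)"
      using 1 by (auto intro!: derivative_eq_intros)
    then show ?thesis
      by (rule has_field_derivative_transform_within_open[of _ _ _ "{0<..}"]) (use 1 in auto)
  next
    case 2
    have "((\<lambda>t. 0) has_real_derivative 2 * max 0 t) (at t)" using 2 by simp
    then show ?thesis
      by (rule has_field_derivative_transform_within_open[of _ _ _ "{..<0}"]) (use 2 in auto)
  next
    case 3
    \<comment> \<open>At 0 the difference quotient is \<open>max 0 z\<close> itself, so
      Caratheodory's criterion applies.\<close>
    have "isCont (\<lambda>z::real. max 0 z) 0" by (intro continuous_intros)
    moreover have "\<forall>z::real. (max 0 z)\<^sup>2 - (max 0 0)\<^sup>2 = max 0 z * (z - 0)"
      by (auto simp: power2_eq_square max_def)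
    ultimately show ?thesis unfolding CARAT_DERIV 3
      by (intro exI[of _ "\<lambda>z. max 0 z"] conjI) simp_all
  qed
qed

lemma C1_on_max_0_square:
  fixes f :: "'e::euclidean_space \<Rightarrow> real"
  shows "C1_on S f \<Longrightarrow> C1_on S (\<lambda>x. (max 0 (f x))\<^sup>2)"
  by (rule C1_on_real_compose[OF _ has_real_derivative_max_0_square]) (auto intro!: continuous_intros)

lemma C1_on_divide:
  fixes f g :: "'e::euclidean_space \<Rightarrow> real"
  assumes f: "C1_on S f" and g: "C1_on S g" and nz: "\<And>x. x \<in> S \<Longrightarrow> g x \<noteq> 0"
  shows "C1_on S (\<lambda>x. f x / g x)"
proof -
  have "C1_on S (\<lambda>x. inverse (g x))"
  proof (rule C1_on_real_compose[OF g])
    show "(inverse has_real_derivative - (inverse t ^ Suc (Suc 0))) (at t)" if "t \<in> g ` S" for t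
      using nz that by (intro DERIV_inverse) auto
    show "continuous_on (g ` S) (\<lambda>t. - (inverse t ^ Suc (Suc 0)))"
      using nz by (intro continuous_intros) auto
  qed
  then show ?thesis unfolding divide_inverse by (intro C1_on_mult f)
qed

lemma continuous_on_fder_field:
  fixes f :: "'e::euclidean_space \<Rightarrow> real"
  assumes f: "C1_on S f" and X: "continuous_on S X"
  shows "continuous_on S (\<lambda>x. fder f x (X x))"
proof (subst continuous_on_cong[OF refl])
  show "fder f x (X x) = (\<Sum>b\<in>Basis. (X x \<bullet> b) *\<^sub>R fder f x b)" if "x \<in> S" for x
    by (rule linear_sum_Basis[OF has_derivative_linear[OF C1_on_has_derivative[OF f that]]])
  show "continuous_on S (\<lambda>x. \<Sum>b\<in>Basis. (X x \<bullet> b) *\<^sub>R fder f x b)"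
    by (intro continuous_intros X C1_on_continuous_fder[OF f])
qed

text \<open>The set where \<open>f\<close> is nonzero is open and null, hence empty.\<close>

lemma continuous_nonneg_integral_eq_0:
  fixes f :: "'e::euclidean_space \<Rightarrow> real"
  assumes f: "continuous_on UNIV f" "integrable lborel f" "\<And>x. f x \<ge> 0" and 0: "integral\<^sup>L lborel f = 0"
  shows "f x = 0"
proof (rule ccontr)
  assume "f x \<noteq> 0"
  have "AE x in lborel. f x = 0"
    using integral_nonneg_eq_0_iff_AE[OF f(2)] f(3) 0 by simp
  moreover have op: "open {x. f x \<noteq> 0}"
    by (rule open_Collect_neq[OF f(1)]) simp
  ultimately have "{x. f x \<noteq> 0} \<in> null_sets lborel"
    using AE_iff_null_sets[of "{x. f x \<noteq> 0}" lborel] by simp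
  then have "negligible {x. f x \<noteq> 0}"
    unfolding negligible_iff_null_sets by (rule null_sets_completionI)
  then show False using open_not_negligible[OF op] \<open>f x \<noteq> 0\<close> by auto
qed

section \<open>Functions of class C1 on the manifold\<close>

context smooth_manifold
begin

lemma continuous_on_chartwise:
  fixes F :: "'a \<Rightarrow> 'b::topological_space"
  assumes U: "open U" and F: "\<And>c. c \<in> \<A> \<Longrightarrow> continuous_on (cmap c ` (cdom c \<inter> U)) (\<lambda>x. F (cinv c x))"
  shows "continuous_on U F"
proof -
  have "continuous_on (\<Union>c\<in>\<A>. cdom c \<inter> U) F"
  proof (rule continuous_on_open_UN)
    fix c assume c: "c \<in> \<A>"
    show "open (cdom c \<inter> U)" using U open_cdom[OF c] by auto
    have "continuous_on (cdom c \<inter> U) (\<lambda>p. F (cinv c (cmap c p)))"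
      by (rule continuous_on_compose2[OF F[OF c]]) (auto intro: continuous_on_subset[OF continuous_on_cmap[OF c]])
    then show "continuous_on (cdom c \<inter> U) F"
      by (rule continuous_on_eq) (simp add: cinv_cmap[OF c])
  qed
  moreover have "(\<Union>c\<in>\<A>. cdom c \<inter> U) = U" using chart_ex by blast
  ultimately show ?thesis by simp
qed

definition C1_fun :: "'a set \<Rightarrow> ('a \<Rightarrow> real) \<Rightarrow> bool" where
  "C1_fun U F \<longleftrightarrow> (\<forall>c\<in>\<A>. C1_on (cmap c ` (cdom c \<inter> U)) (\<lambda>x. F (cinv c x)))"

lemma C1_funD: "C1_fun U F \<Longrightarrow> c \<in> \<A> \<Longrightarrow> C1_on (cmap c ` (cdom c \<inter> U)) (\<lambda>x. F (cinv c x))"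
  unfolding C1_fun_def by blast

lemma C1_fun_continuous: "open U \<Longrightarrow> C1_fun U F \<Longrightarrow> continuous_on U F"
  by (rule continuous_on_chartwise) (auto intro: C1_on_continuous C1_funD)

text \<open>The squared positive part of r^2 - |x - a|^2 in the chart, extended by 0. The compact
  image of the ball is closed in the Hausdorff space, so in any other chart the function is C1 on
  two open sets that cover everything.\<close>

lemma bump_function:
  assumes c: "c \<in> \<A>" and p: "p \<in> cdom c"
  shows "\<exists>\<rho> C. compact C \<and> C \<subseteq> cdom c \<and> (\<forall>q. \<rho> q \<ge> 0) \<and> (\<forall>q. q \<notin> C \<longrightarrow> \<rho> q = 0) \<and> C1_fun UNIV \<rho> \<and> \<rho> p > 0"
proof -
  let ?a = "cmap c p"
  obtain r where r: "r > 0" "cball ?a r \<subseteq> cimg c"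
    using open_cimg[OF c] cmap_in[OF c p] open_contains_cball by blast
  define \<beta> where "\<beta> = (\<lambda>x. (max 0 (r\<^sup>2 - (x - ?a) \<bullet> (x - ?a)))\<^sup>2)"
  have id: "C1_on S (\<lambda>x. x)" for S :: "'e set" by (intro C1_on_bounded_linear) simp
  have \<beta>: "C1_on S \<beta>" for S
    unfolding \<beta>_def
    by (intro C1_on_max_0_square C1_on_minus C1_on_const C1_on_inner id)
  have \<beta>0: "\<beta> x = 0" if "x \<notin> cball ?a r" for x
  proof -
    have "r\<^sup>2 \<le> (norm (x - ?a))\<^sup>2" using that r by (intro power_mono) (auto simp: dist_norm norm_minus_commute)
    then show ?thesis by (simp add: \<beta>_def power2_norm_eq_inner[symmetric])
  qed
  define \<rho> where "\<rho> = (\<lambda>q. if q \<in> cdom c then \<beta> (cmap c q) else 0)"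
  define C where "C = cinv c ` cball ?a r"
  have C: "compact C" "C \<subseteq> cdom c"
    unfolding C_def using r cinv_in[OF c]
    by (auto intro!: compact_continuous_image continuous_on_subset[OF continuous_on_cinv[OF c]])
  have \<rho>0: "\<rho> q = 0" if "q \<notin> C" for q
    using \<beta>0[of "cmap c q"] that unfolding \<rho>_def C_def by (metis c cinv_cmap image_eqI)
  have "C1_fun UNIV \<rho>"
    unfolding C1_fun_def
  proof
    fix d assume d: "d \<in> \<A>"
    let ?W = "cmap d ` (cdom d \<inter> - C)"
    have W: "open ?W"
      by (intro open_cmap_image[OF d] open_Int open_cdom[OF d]) (use compact_imp_closed[OF C(1)] in auto)
    have 1: "C1_on (overlap d c) (\<lambda>x. \<rho> (cinv d x))"
    proof (rule C1_on_cong[OF open_overlap[OF d c]])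
      show "C1_on (overlap d c) (\<lambda>x. \<beta> (trans d c x))"
        by (rule C1_on_compose[OF C1_on_trans[OF d c] \<beta>[of UNIV]]) simp
      show "\<rho> (cinv d x) = \<beta> (trans d c x)" if "x \<in> overlap d c" for x
        using that by (auto simp: \<rho>_def overlap_eq[OF d])
    qed
    have 2: "C1_on ?W (\<lambda>x. \<rho> (cinv d x))"
      by (rule C1_on_cong[OF W, of _ "\<lambda>_. 0"]) (auto simp: cinv_cmap[OF d] \<rho>0)
    have "cmap d ` (cdom d \<inter> UNIV) \<subseteq> overlap d c \<union> ?W" using C(2) by (auto simp: overlap_def)
    then show "C1_on (cmap d ` (cdom d \<inter> UNIV)) (\<lambda>x. \<rho> (cinv d x))"
      using C1_on_Un[OF 1 2 open_overlap[OF d c] W] C1_on_subset by blast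
  qed
  moreover have "\<rho> p > 0" using p r by (simp add: \<rho>_def \<beta>_def)
  moreover have "\<rho> q \<ge> 0" for q by (simp add: \<rho>_def \<beta>_def)
  ultimately show ?thesis using C \<rho>0 by blast
qed

text \<open>The derivative X(F) at a point; the arbitrary choice of chart is harmless for tangent
  \<open>X p\<close> by the chain rule, see \<open>dir_deriv_chart\<close>.\<close>

definition dir_deriv :: "('a \<Rightarrow> real) \<Rightarrow> ('a \<Rightarrow> ('a, 'e) tvec) \<Rightarrow> 'a \<Rightarrow> real" where
  "dir_deriv F X p = (let c = (SOME c. c \<in> \<A> \<and> p \<in> cdom c) in fder (\<lambda>x. F (cinv c x)) (cmap c p) (X p c))"

lemma dir_deriv_chart:
  assumes F: "C1_fun U F" and p: "p \<in> U" "p \<in> cdom c" and c: "c \<in> \<A>" and X: "X p \<in> tangent_space \<A> p"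
  shows "dir_deriv F X p = fder (\<lambda>x. F (cinv c x)) (cmap c p) (X p c)"
proof -
  define d where "d = (SOME c. c \<in> \<A> \<and> p \<in> cdom c)"
  have "d \<in> \<A> \<and> p \<in> cdom d" unfolding d_def by (rule someI_ex) (use chart_ex in blast)
  then have d: "d \<in> \<A>" and pd: "p \<in> cdom d" by auto
  have "((\<lambda>x. F (cinv d x)) has_derivative fder (\<lambda>x. F (cinv d x)) (cmap d p)) (at (trans c d (cmap c p)))"
    using C1_on_has_derivative[OF C1_funD[OF F d], of "cmap d p"] p pd by (simp add: cinv_cmap[OF c])
  from has_derivative_compose[OF has_derivative_trans[OF c d p(2) pd] this]
  have "((\<lambda>x. F (cinv d (trans c d x))) has_derivative
      (\<lambda>u. fder (\<lambda>x. F (cinv d x)) (cmap d p) (transition_deriv c d p u))) (at (cmap c p))" .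
  then have "((\<lambda>x. F (cinv c x)) has_derivative
      (\<lambda>u. fder (\<lambda>x. F (cinv d x)) (cmap d p) (transition_deriv c d p u))) (at (cmap c p))"
    by (rule has_derivative_transform_within_open[OF _ open_overlap[OF c d] overlapI[OF c d p(2) pd]])
      (simp only: cinv_trans[OF c d])
  then have "fder (\<lambda>x. F (cinv c x)) (cmap c p) (X p c) = fder (\<lambda>x. F (cinv d x)) (cmap d p) (transition_deriv c d p (X p c))"
    by (simp only: fder_eqI)
  also have "transition_deriv c d p (X p c) = X p d"
    by (rule tangent_transition[OF X c d p(2) pd])
  finally show ?thesis by (simp add: dir_deriv_def d_def[symmetric])
qed

end

context riemannian_manifold
begin

lemma C1_field_tangent: "C1_field X \<Longrightarrow> X p \<in> tangent_space \<A> p"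
  unfolding C1_field_def by blast

lemma C1_field_C1: "C1_field X \<Longrightarrow> c \<in> \<A> \<Longrightarrow> C1_on (cimg c) (\<lambda>x. X (cinv c x) c)"
  unfolding C1_field_def by blast

lemma continuous_on_dir_deriv:
  assumes U: "open U" and F: "C1_fun U F" and X: "C1_field X"
  shows "continuous_on U (dir_deriv F X)"
proof (rule continuous_on_chartwise[OF U])
  fix c assume c: "c \<in> \<A>"
  let ?T = "cmap c ` (cdom c \<inter> U)"
  have "continuous_on ?T (\<lambda>x. fder (\<lambda>x. F (cinv c x)) x (X (cinv c x) c))"
    by (rule continuous_on_fder_field[OF C1_funD[OF F c]])
      (use C1_on_continuous[OF C1_field_C1[OF X c]] in \<open>auto simp: cimg_def intro: continuous_on_subset\<close>)
  then show "continuous_on ?T (\<lambda>x. dir_deriv F X (cinv c x))"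
    by (rule continuous_on_eq)
      (auto simp: cinv_cmap[OF c] dir_deriv_chart[OF F _ _ c C1_field_tangent[OF X]])
qed

lemma cint_sum:
  assumes c: "c \<in> \<A>"
    and h: "\<And>i. i \<in> J \<Longrightarrow> continuous_on UNIV (h i)"
    and C: "\<And>i. i \<in> J \<Longrightarrow> compact (C i) \<and> C i \<subseteq> cdom c \<and> (\<forall>p. p \<notin> C i \<longrightarrow> h i p = 0)"
  shows "cint c (\<lambda>q. \<Sum>i\<in>J. h i q) = (\<Sum>i\<in>J. cint c (h i))"
proof -
  have int: "integrable lborel (\<lambda>x. indicator (cimg c) x * (cdens c x * h i (cinv c x)))" if "i \<in> J" for i
    using integrable_chart_integrand[OF c h[OF that], of "C i"] C[OF that] by blast
  have "cint c (\<lambda>q. \<Sum>i\<in>J. h i q) = (\<integral>x. (\<Sum>i\<in>J. indicator (cimg c) x * (cdens c x * h i (cinv c x))) \<partial>lborel)"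
    unfolding cint_def by (simp add: sum_distrib_left)
  also have "\<dots> = (\<Sum>i\<in>J. cint c (h i))"
    unfolding cint_def by (rule Bochner_Integration.integral_sum[OF int])
  finally show ?thesis .
qed

text \<open>With a partition of unity \<eta>_i near \<open>K\<close>, div(\<eta>_i X) = X(\<eta>_i)
  + \<eta>_i div X has integral 0 in its chart, and the integrals of X(\<eta>_i) add up to 0. Hence
  the nonnegative integrals of \<eta>_i div X add up to 0, so each vanishes, and continuity makes
  the integrands vanish pointwise.\<close>

theorem nonneg_divergence_eq_0:
  assumes X: "C1_field X" and K: "compact K" and X0: "\<And>p. p \<notin> K \<Longrightarrow> X p = tzero"
    and \<Phi>: "\<Phi> \<subseteq> \<A>" "\<And>p. \<exists>c\<in>\<Phi>. p \<in> cdom c"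
    and nonneg: "\<And>c x. c \<in> \<Phi> \<Longrightarrow> x \<in> cimg c \<Longrightarrow> etrace (cnabla c X x) \<ge> 0"
    and c0: "c0 \<in> \<Phi>" and p0: "p0 \<in> cdom c0" "p0 \<in> K"
  shows "etrace (cnabla c0 X (cmap c0 p0)) = 0"
proof -
  define I where "I = {(c, p). c \<in> \<Phi> \<and> p \<in> cdom c}"
  have "\<exists>\<rho> C. compact C \<and> C \<subseteq> cdom (fst i) \<and> (\<forall>q. \<rho> q \<ge> 0) \<and> (\<forall>q. q \<notin> C \<longrightarrow> \<rho> q = 0) \<and>
      C1_fun UNIV \<rho> \<and> \<rho> (snd i) > 0" if "i \<in> I" for i
    using that \<Phi>(1) unfolding I_def by (auto intro!: bump_function)
  then obtain \<rho> Cs where \<rho>: "\<And>i. i \<in> I \<Longrightarrow> compact (Cs i) \<and> Cs i \<subseteq> cdom (fst i) \<and> (\<forall>q. \<rho> i q \<ge> 0) \<and>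
      (\<forall>q. q \<notin> Cs i \<longrightarrow> \<rho> i q = 0) \<and> C1_fun UNIV (\<rho> i) \<and> \<rho> i (snd i) > 0"
    by metis
  obtain \<gamma> where \<gamma>: "\<And>p. \<gamma> p \<in> \<Phi> \<and> p \<in> cdom (\<gamma> p)" using \<Phi>(2) by metis
  have \<gamma>I: "(\<gamma> p, p) \<in> I" for p using \<gamma> by (auto simp: I_def)
  have \<rho>cont: "continuous_on UNIV (\<rho> i)" if "i \<in> I" for i
    using \<rho>[OF that] C1_fun_continuous by blast
  define V where "V = (\<lambda>p. {q. \<rho> (\<gamma> p, p) q > 0})"
  have V: "open (V p)" for p
    unfolding V_def by (rule open_Collect_less[OF _ \<rho>cont[OF \<gamma>I]]) simp
  have KV: "K \<subseteq> (\<Union>p\<in>K. V p)" using \<rho>[OF \<gamma>I] by (auto simp: V_def)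
  obtain D where D: "D \<subseteq> K" "finite D" "K \<subseteq> (\<Union>p\<in>D. V p)"
    by (rule compactE_image[OF K V KV])
  \<comment> \<open>The pair \<open>(c0, p0)\<close> is added to the finite cover so that some
    member lives in the chart \<open>c0\<close> and is positive at \<open>p0\<close>.\<close>
  define J where "J = insert (c0, p0) ((\<lambda>p. (\<gamma> p, p)) ` D)"
  have J: "finite J" "J \<subseteq> I" using D \<gamma>I c0 p0 by (auto simp: J_def I_def)
  note \<rho> = \<rho>[OF subsetD[OF J(2)]] and \<rho>cont = \<rho>cont[OF subsetD[OF J(2)]]
  have chart: "fst i \<in> \<A>" "fst i \<in> \<Phi>" if "i \<in> J" for i using subsetD[OF J(2) that] \<Phi>(1) by (auto simp: I_def)
  define R where "R = (\<lambda>q. \<Sum>i\<in>J. \<rho> i q)"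
  define U where "U = {q. R q > 0}"
  have "continuous_on UNIV R" unfolding R_def by (intro continuous_on_sum \<rho>cont)
  then have U: "open U" unfolding U_def by (intro open_Collect_less) auto
  have Rge: "R q \<ge> \<rho> i q" if "i \<in> J" for i q
    unfolding R_def by (rule member_le_sum) (use \<rho> J that in auto)
  have R0: "R q \<ge> 0" for q unfolding R_def using \<rho> by (intro sum_nonneg) auto
  have KU: "K \<subseteq> U"
  proof
    fix q assume "q \<in> K"
    then obtain p where "p \<in> D" "\<rho> (\<gamma> p, p) q > 0" using D by (auto simp: V_def)
    then show "q \<in> U" using Rge[of "(\<gamma> p, p)" q] by (auto simp: U_def J_def)
  qed
  have Kcl: "open (- K)" using compact_imp_closed[OF K] by auto
  have UK: "U \<union> - K = UNIV" using KU by auto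
  \<comment> \<open>Where \<open>R\<close> is 0 the quotient is 0 by convention, so \<eta> vanishes
    off \<open>U\<close>; regularity is claimed on \<open>U\<close> only, which contains
    \<open>K\<close>.\<close>
  define \<eta> where "\<eta> = (\<lambda>i q. \<rho> i q / R q)"
  have \<eta>U: "\<eta> i q = 0" if "q \<notin> U" for i q
    using R0[of q] that by (simp add: \<eta>_def U_def)
  have \<eta>0: "\<eta> i q \<ge> 0" if "i \<in> J" for i q using \<rho>[OF that] R0 by (simp add: \<eta>_def)
  have \<eta>C: "\<eta> i q = 0" if "i \<in> J" "q \<notin> Cs i" for i q using \<rho>[OF that(1)] that(2) by (simp add: \<eta>_def)
  have \<eta>1: "(\<Sum>i\<in>J. \<eta> i q) = 1" if "q \<in> U" for q
  proof -
    have "(\<Sum>i\<in>J. \<rho> i q) = R q" by (simp add: R_def)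
    then show ?thesis using that by (simp add: \<eta>_def sum_divide_distrib[symmetric] U_def)
  qed
  have \<eta>C1: "C1_fun U (\<eta> i)" if "i \<in> J" for i
    unfolding C1_fun_def
  proof
    fix c assume c: "c \<in> \<A>"
    let ?T = "cmap c ` (cdom c \<inter> U)"
    have r: "C1_on ?T (\<lambda>x. \<rho> i (cinv c x))" if "i \<in> J" for i
    proof (rule C1_on_subset)
      show "C1_on (cmap c ` (cdom c \<inter> UNIV)) (\<lambda>x. \<rho> i (cinv c x))"
        using \<rho>[OF that] by (intro C1_funD c) auto
    qed auto
    have "C1_on ?T (\<lambda>x. R (cinv c x))" unfolding R_def by (intro C1_on_sum r)
    then show "C1_on ?T (\<lambda>x. \<eta> i (cinv c x))"
      unfolding \<eta>_def by (intro C1_on_divide r that) (auto simp: cinv_cmap[OF c] U_def)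
  qed
  have \<eta>cont: "continuous_on U (\<eta> i)" if "i \<in> J" for i by (rule C1_fun_continuous[OF U \<eta>C1[OF that]])
  have Xtan: "X q \<in> tangent_space \<A> q" for q by (rule C1_field_tangent[OF X])
  \<comment> \<open>X(\<eta>_i) with the value 0 forced off \<open>K\<close>, where \<open>X\<close>
    vanishes anyway. This makes it globally continuous although \<eta>_i is regular only on
    \<open>U\<close>.\<close>
  define e where "e = (\<lambda>i q. if q \<in> K then dir_deriv (\<eta> i) X q else 0)"
  have e_chart: "e i q = fder (\<lambda>x. \<eta> i (cinv c x)) (cmap c q) (X q c)"
    if "i \<in> J" "q \<in> U" "q \<in> cdom c" "c \<in> \<A>" for i q c
  proof (cases "q \<in> K")
    case True
    then show ?thesis using dir_deriv_chart[where X=X, OF \<eta>C1[OF that(1)] that(2-4) Xtan] by (simp add: e_def)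
  next
    case False
    then have "X q c = 0" using X0 by (simp add: tzero_def)
    then show ?thesis
      using linear_0[OF has_derivative_linear[OF C1_on_has_derivative[OF C1_funD[OF \<eta>C1[OF that(1)] that(4)]]]]
        that False by (simp add: e_def)
  qed
  have e_cont: "continuous_on UNIV (e i)" if i: "i \<in> J" for i
  proof -
    have "continuous_on U (e i)"
    proof (rule continuous_on_eq[OF continuous_on_dir_deriv[OF U \<eta>C1[OF i] X]])
      fix q assume q: "q \<in> U"
      obtain c where "c \<in> \<A>" "q \<in> cdom c" using chart_ex by blast
      then show "dir_deriv (\<eta> i) X q = e i q"
        using e_chart[OF i q] dir_deriv_chart[where X=X, OF \<eta>C1[OF i] q _ _ Xtan] by simp
    qed
    moreover have "continuous_on (- K) (e i)"
      by (rule continuous_on_eq[of _ "\<lambda>_. 0"]) (auto simp: e_def)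
    ultimately have "continuous_on (U \<union> - K) (e i)" using U Kcl by (intro continuous_on_open_Un)
    then show ?thesis unfolding UK .
  qed
  have e_supp: "e i q = 0" if i: "i \<in> J" and q: "q \<notin> Cs i" for i q
  proof (cases "q \<in> K")
    case True
    then have qU: "q \<in> U" using KU by auto
    obtain c where c: "c \<in> \<A>" "q \<in> cdom c" using chart_ex by blast
    have "closed (Cs i)" using \<rho>[OF i] compact_imp_closed by blast
    then have "open (cmap c ` (cdom c \<inter> - Cs i))"
      by (intro open_cmap_image[OF c(1)] open_Int open_cdom[OF c(1)]) auto
    then have "fder (\<lambda>x. \<eta> i (cinv c x)) (cmap c q) = fder (\<lambda>_. 0) (cmap c q)"
      by (rule fder_cong_open) (use c q \<eta>C[OF i] in \<open>auto simp: cinv_cmap[OF c(1)]\<close>)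
    then show ?thesis using e_chart[OF i qU c(2,1)] by simp
  qed (simp add: e_def)
  have e_sum: "(\<Sum>i\<in>J. e i q) = 0" for q
  proof (cases "q \<in> K")
    case True
    then have qU: "q \<in> U" using KU by auto
    obtain c where c: "c \<in> \<A>" "q \<in> cdom c" using chart_ex by blast
    let ?T = "cmap c ` (cdom c \<inter> U)"
    have xT: "cmap c q \<in> ?T" using c qU by auto
    have "((\<lambda>x. \<Sum>i\<in>J. \<eta> i (cinv c x)) has_derivative
        (\<lambda>u. \<Sum>i\<in>J. fder (\<lambda>x. \<eta> i (cinv c x)) (cmap c q) u)) (at (cmap c q))"
      by (intro has_derivative_sum C1_on_has_derivative[OF C1_funD[OF \<eta>C1 c(1)] xT])
    moreover have "fder (\<lambda>x. \<Sum>i\<in>J. \<eta> i (cinv c x)) (cmap c q) = fder (\<lambda>_. 1) (cmap c q)"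
      by (rule fder_cong_open[OF open_cmap_image[OF c(1)] xT])
        (use U open_cdom[OF c(1)] in \<open>auto simp: cinv_cmap[OF c(1)] \<eta>1\<close>)
    ultimately have "(\<lambda>u. \<Sum>i\<in>J. fder (\<lambda>x. \<eta> i (cinv c x)) (cmap c q) u) = (\<lambda>u. 0)"
      by (simp add: fder_eqI)
    then show ?thesis using e_chart[OF _ qU c(2,1)] by (simp add: fun_eq_iff)
  qed (simp add: e_def)
  define h where "h = (\<lambda>i j q. \<eta> j q * e i q)"
  have h_cont: "continuous_on UNIV (h i j)" if i: "i \<in> J" and j: "j \<in> J" for i j
  proof -
    have "continuous_on U (h i j)" unfolding h_def
      by (intro continuous_on_mult \<eta>cont[OF j] continuous_on_subset[OF e_cont[OF i]]) auto
    moreover have "continuous_on (- K) (h i j)"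
      by (rule continuous_on_eq[of _ "\<lambda>_. 0"]) (auto simp: e_def h_def)
    ultimately have "continuous_on (U \<union> - K) (h i j)" using U Kcl by (intro continuous_on_open_Un)
    then show ?thesis unfolding UK .
  qed
  have h_supp: "compact (Cs i \<inter> Cs j) \<and> Cs i \<inter> Cs j \<subseteq> cdom (fst i) \<inter> cdom (fst j) \<and>
      (\<forall>q. q \<notin> Cs i \<inter> Cs j \<longrightarrow> h i j q = 0)" if i: "i \<in> J" and j: "j \<in> J" for i j
    using \<rho>[OF i] \<rho>[OF j] e_supp[OF i] \<eta>C[OF j] compact_Int[of "Cs i" "Cs j"] by (auto simp: h_def)
  \<comment> \<open>Inserting the partition of unity once more moves the integral of \<open>X(\<eta>\<^sub>i)\<close> from the
    \<open>i\<close>-th to the \<open>j\<close>-th chart; there the sum over \<open>i\<close> vanishes since \<open>\<Sum> \<eta>\<^sub>i = 1\<close> near \<open>K\<close>.\<close>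
  have "(\<Sum>i\<in>J. cint (fst i) (e i)) = (\<Sum>i\<in>J. \<Sum>j\<in>J. cint (fst i) (h i j))"
  proof (rule sum.cong[OF refl])
    fix i assume i: "i \<in> J"
    have "e i q = (\<Sum>j\<in>J. h i j q)" for q
      using \<eta>1[of q] KU by (cases "q \<in> U") (auto simp: h_def sum_distrib_right[symmetric] e_def)
    then have "cint (fst i) (e i) = cint (fst i) (\<lambda>q. \<Sum>j\<in>J. h i j q)" by presburger
    also have "\<dots> = (\<Sum>j\<in>J. cint (fst i) (h i j))"
      by (rule cint_sum[where C="\<lambda>j. Cs i \<inter> Cs j", OF chart(1)[OF i] h_cont[OF i]]) (use h_supp[OF i] in auto)
    finally show "cint (fst i) (e i) = (\<Sum>j\<in>J. cint (fst i) (h i j))" .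
  qed
  also have "\<dots> = (\<Sum>i\<in>J. \<Sum>j\<in>J. cint (fst j) (h i j))"
  proof (intro sum.cong refl)
    fix i j assume i: "i \<in> J" and j: "j \<in> J"
    show "cint (fst i) (h i j) = cint (fst j) (h i j)"
      by (rule cint_eq[where C="Cs i \<inter> Cs j", OF chart(1)[OF i] chart(1)[OF j] h_cont[OF i j]])
        (use h_supp[OF i j] in auto)
  qed
  also have "\<dots> = (\<Sum>j\<in>J. \<Sum>i\<in>J. cint (fst j) (h i j))" by (rule sum.swap)
  also have "\<dots> = (\<Sum>j\<in>J. cint (fst j) (\<lambda>q. \<Sum>i\<in>J. h i j q))"
  proof (rule sum.cong[OF refl])
    fix j assume j: "j \<in> J"
    show "(\<Sum>i\<in>J. cint (fst j) (h i j)) = cint (fst j) (\<lambda>q. \<Sum>i\<in>J. h i j q)"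
      by (rule cint_sum[where C="\<lambda>i. Cs i \<inter> Cs j", OF chart(1)[OF j] h_cont[OF _ j], symmetric]) (use h_supp[OF _ j] in auto)
  qed
  also have "\<dots> = 0"
    by (simp add: h_def sum_distrib_left[symmetric] e_sum cint_def)
  finally have sum_e: "(\<Sum>i\<in>J. cint (fst i) (e i)) = 0" .
  \<comment> \<open>The integrand of \<eta>_i div X against the density in the \<open>i\<close>-th
    chart.\<close>
  define G where "G = (\<lambda>i x. indicator (cimg (fst i)) x *
      (cdens (fst i) x * (\<eta> i (cinv (fst i) x) * etrace (cnabla (fst i) X x))))"
  have G: "continuous_on UNIV (G i) \<and> integrable lborel (G i) \<and> integral\<^sup>L lborel (G i) = - cint (fst i) (e i)"
    if i: "i \<in> J" for i
  proof -
    define c where "c = fst i"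
    have c: "c \<in> \<A>" using chart[OF i] by (simp add: c_def)
    interpret m: metric_field "cimg c" "local_metric \<A> g c" by (rule metric_field_chart[OF c])
    let ?C = "cmap c ` (Cs i \<inter> K)" and ?T = "cmap c ` (cdom c \<inter> U)" and ?X = "\<lambda>x. X (cinv c x) c"
    have Cs: "compact (Cs i)" "Cs i \<subseteq> cdom c" using \<rho>[OF i] by (auto simp: c_def)
    have C: "compact ?C" "?C \<subseteq> ?T" "?C \<subseteq> cimg c"
      using Cs KU K cmap_in[OF c] by (auto intro!: compact_cmap_image[OF c] compact_Int)
    have T: "open ?T" using U open_cdom[OF c] by (intro open_cmap_image[OF c]) auto
    have Ts: "?T \<subseteq> cimg c" using cmap_in[OF c] by auto
    \<comment> \<open>The chart expression of \<eta>_i X, set to 0 off the image of its compact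
      support so that it is a C1 field on the whole model space.\<close>
    define Z where "Z = (\<lambda>x. if x \<in> ?C then \<eta> i (cinv c x) *\<^sub>R ?X x else 0)"
    have ZT: "Z x = \<eta> i (cinv c x) *\<^sub>R ?X x" if "x \<in> ?T" for x
    proof (cases "x \<in> ?C")
      case False
      then have "cinv c x \<notin> Cs i \<or> cinv c x \<notin> K" using that by (auto simp: cinv_cmap[OF c])
      then show ?thesis using \<eta>C[OF i] X0 False by (auto simp: Z_def tzero_def)
    qed (simp add: Z_def)
    have "C1_on ?T Z"
      by (rule C1_on_cong[OF T ZT], assumption) (intro C1_on_scaleR C1_funD[OF \<eta>C1[OF i] c] C1_on_subset[OF C1_field_C1[OF X c] Ts])
    then have Z: "C1_on UNIV Z"
      by (rule C1_on_UNIV_if_support[OF _ T compact_imp_closed[OF C(1)] C(2)]) (simp add: Z_def)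
    have Z0: "Z x = 0" if "x \<notin> ?C" for x using that by (simp add: Z_def)
    note div = m.integral_divergence[OF Z C(1,3) Z0]
    have tr: "etrace (m.nabla Z x) = \<eta> i (cinv c x) * etrace (m.nabla ?X x) + e i (cinv c x)" if x: "x \<in> cimg c" for x
    proof (cases "x \<in> ?T")
      case True
      then have q: "cinv c x \<in> U" "cinv c x \<in> cdom c" by (auto simp: cinv_cmap[OF c])
      have "etrace (m.nabla Z x) = etrace (m.nabla (\<lambda>x. \<eta> i (cinv c x) *\<^sub>R ?X x) x)"
        unfolding etrace_def using m.nabla_cong[OF T True ZT] by simp
      also have "\<dots> = fder (\<lambda>x. \<eta> i (cinv c x)) x (?X x) + \<eta> i (cinv c x) * etrace (m.nabla ?X x)"
        by (rule m.etrace_nabla_scaleR[OF x differentiableI[OF C1_on_has_derivative[OF C1_funD[OF \<eta>C1[OF i] c] True]]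
              C1_field_differentiable[OF X c x]])
      finally show ?thesis using e_chart[OF i q c] by (simp add: cmap_cinv[OF c x])
    next
      case False
      then have q: "cinv c x \<notin> U" using x by (metis Int_iff c cinv_in cmap_cinv image_eqI)
      have "m.nabla Z x u = 0" for u
        by (rule m.nabla_eq_0[OF x, of "- ?C"]) (use False C(2) compact_imp_closed[OF C(1)] Z0 in auto)
      then show ?thesis using \<eta>U[OF q] q KU by (auto simp: etrace_def e_def)
    qed
    let ?A = "\<lambda>x. indicator (cimg c) x * (m.dens x * etrace (m.nabla Z x))"
    let ?B = "\<lambda>x. indicator (cimg c) x * (m.dens x * e i (cinv c x))"
    have GAB: "G i = (\<lambda>x. ?A x - ?B x)"
    proof
      show "G i x = ?A x - ?B x" for x
        using tr[of x] by (cases "x \<in> cimg c") (simp_all add: G_def c_def[symmetric] algebra_simps)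
    qed
    have A: "integrable lborel ?A" by (rule integrable_compact_support[OF div(1) C(1) div(3)])
    have B: "continuous_on UNIV ?B" "integrable lborel ?B"
      using continuous_on_chart_integrand[OF c e_cont[OF i] Cs e_supp[OF i]]
        integrable_chart_integrand[OF c e_cont[OF i] Cs e_supp[OF i]] by auto
    show ?thesis
      unfolding GAB using A B div(2)
      by (auto simp: cint_def c_def[symmetric] intro!: continuous_on_diff div(1))
  qed
  have Gpos: "G i x \<ge> 0" if i: "i \<in> J" for i x
  proof (cases "x \<in> cimg (fst i)")
    case True
    then show ?thesis
      using nonneg[OF chart(2)[OF i] True] \<eta>0[OF i]
        metric_field.dens_pos[OF metric_field_chart[OF chart(1)[OF i]] True] by (simp add: G_def)
  qed (simp add: G_def)
  have "(\<Sum>i\<in>J. integral\<^sup>L lborel (G i)) = 0" using G sum_e by (simp add: sum_negf)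
  moreover have "integral\<^sup>L lborel (G i) \<ge> 0" if "i \<in> J" for i
    using Gpos[OF that] by (intro Bochner_Integration.integral_nonneg) auto
  ultimately have G0: "integral\<^sup>L lborel (G i) = 0" if "i \<in> J" for i
    using sum_nonneg_eq_0_iff[OF J(1), of "\<lambda>i. integral\<^sup>L lborel (G i)"] that by auto
  have i0: "(c0, p0) \<in> J" by (simp add: J_def)
  have "G (c0, p0) (cmap c0 p0) = 0"
    by (rule continuous_nonneg_integral_eq_0) (use G[OF i0] Gpos[OF i0] G0[OF i0] in auto)
  moreover have x0: "cmap c0 p0 \<in> cimg c0" using cmap_in chart[OF i0] p0 by auto
  moreover have "cdens c0 (cmap c0 p0) > 0"
    by (rule metric_field.dens_pos[OF metric_field_chart x0]) (use chart[OF i0] in auto)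
  moreover have "\<eta> (c0, p0) p0 > 0"
    using \<rho>[OF i0] Rge[OF i0, of p0] by (simp add: \<eta>_def)
  ultimately show ?thesis
    using chart[OF i0] p0 by (simp add: G_def cinv_cmap)
qed

end

section \<open>The divergence of the comparison field\<close>

context inner_form
begin

lemma unit_inner_le_1:
  assumes "G u u = 1" "G v v = 1" shows "G u v \<le> 1" "G u v = 1 \<Longrightarrow> u = v"
proof -
  have "G (u - v) (u - v) = 2 - 2 * G u v"
    using assms sym[of v u] by (simp add: diff_left diff_right)
  then show "G u v \<le> 1" "G u v = 1 \<Longrightarrow> u = v"
    using nonneg[of "u - v"] eq_0_iff[of "u - v"] by auto
qed

context
  fixes n :: 'e and S :: "'e \<Rightarrow> 'e"
  assumes n: "G n n = 1" and S: "linear S" and Sn: "\<And>u. G (S u) n = 0"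
    and nonpos: "\<And>u. G n u = 0 \<Longrightarrow> G (S u) u \<le> 0"
begin

text \<open>Since \<open>S\<close> takes values orthogonal to \<open>n\<close>, its trace is that of
  its quadratic form on the orthogonal complement of \<open>n\<close>. If this sum of nonpositive
  terms is 0, every term is 0, and a null vector of a symmetric semidefinite form lies in its
  radical.\<close>

lemma etrace_nonpos: "etrace S \<le> 0"
  and etrace_0_imp: "(\<And>u v. G n u = 0 \<Longrightarrow> G n v = 0 \<Longrightarrow> G (S u) v = G (S v) u) \<Longrightarrow>
    etrace S = 0 \<Longrightarrow> G n u = 0 \<Longrightarrow> S u = 0"
proof -
  define proj where "proj = (\<lambda>u. u - G n u *\<^sub>R n)"
  have nP: "G n (proj u) = 0" for u by (simp add: proj_def diff_right scale_right n)
  obtain P Q :: "'e \<Rightarrow> 'e" where PQ': "linear P" "linear Q" "\<forall>x. Q (P x) = x" "\<forall>x. P (Q x) = x"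
    "\<forall>u v. G (P u) (P v) = u \<bullet> v" using orthonormal_basis by blast
  note PQ = PQ'[rule_format]
  have GS: "G (S (P b)) (P b) = G (S (proj (P b))) (proj (P b)) + G n (P b) * G (S n) (P b)" for b
  proof -
    have "S (P b) = S (proj (P b)) + G n (P b) *\<^sub>R S n"
      by (simp add: proj_def linear_diff[OF S] linear_scale[OF S])
    moreover have "G (S (proj (P b))) (P b) = G (S (proj (P b))) (proj (P b))"
      by (simp add: proj_def diff_right scale_right Sn)
    ultimately show ?thesis by (simp add: add_left scale_left)
  qed
  \<comment> \<open>The contribution of the direction \<open>n\<close> to the trace is the inner
    product of \<open>n\<close> with \<open>S n\<close>, by Parseval in the orthonormal
    frame.\<close>
  have "(\<Sum>b\<in>Basis. G n (P b) * G (S n) (P b)) = (\<Sum>b\<in>Basis. (Q n \<bullet> b) * (Q (S n) \<bullet> b))"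
    by (intro sum.cong refl) (metis PQ(4,5))
  also have "\<dots> = Q n \<bullet> Q (S n)" by (rule euclidean_inner[symmetric])
  also have "\<dots> = G n (S n)" by (metis PQ(4,5))
  finally have 0: "(\<Sum>b\<in>Basis. G n (P b) * G (S n) (P b)) = 0" using Sn sym[of n] by simp
  have tr: "etrace S = (\<Sum>b\<in>Basis. G (S (proj (P b))) (proj (P b)))"
    unfolding etrace_orthonormal[OF S PQ] GS by (simp add: sum.distrib 0)
  show "etrace S \<le> 0" unfolding tr by (intro sum_nonpos nonpos nP)
  assume sm: "\<And>u v. G n u = 0 \<Longrightarrow> G n v = 0 \<Longrightarrow> G (S u) v = G (S v) u"
    and tr0: "etrace S = 0" and u: "G n u = 0"
  have B0: "G (S (proj (P b))) (proj (P b)) = 0" if "b \<in> Basis" for b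
    using tr0 sum_nonneg_eq_0_iff[of Basis "\<lambda>b. - G (S (proj (P b))) (proj (P b))"] nonpos[OF nP] that
    unfolding tr by (auto simp: sum_negf)
  \<comment> \<open>Along the line w + t v the form is 2 t \<alpha> + t^2 \<beta>. Its being
    nonpositive for all t forces \<alpha> = 0: test t = \<alpha> when \<beta> = 0, and otherwise the
    maximum point t = -\<alpha> / \<beta>.\<close>
  have rad: "G (S w) v = 0" if w: "G n w = 0" "G (S w) w = 0" and v: "G n v = 0" for w v
  proof -
    define \<alpha> \<beta> where "\<alpha> = G (S w) v" and "\<beta> = G (S v) v"
    have le: "2 * t * \<alpha> + t\<^sup>2 * \<beta> \<le> 0" for t
    proof -
      have "G (S (w + t *\<^sub>R v)) (w + t *\<^sub>R v) \<le> 0"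
        using w v by (intro nonpos) (simp add: add_right scale_right)
      then show ?thesis using sm[OF v w(1)] w(2)
        by (simp add: linear_add[OF S] linear_scale[OF S] bilin \<alpha>_def \<beta>_def power2_eq_square algebra_simps)
    qed
    have "\<beta> \<le> 0" unfolding \<beta>_def by (rule nonpos[OF v])
    show ?thesis
    proof (cases "\<beta> = 0")
      case True
      then show ?thesis using le[of \<alpha>] by (auto simp: \<alpha>_def mult_le_0_iff)
    next
      case False
      with \<open>\<beta> \<le> 0\<close> have "\<beta> < 0" by simp
      have "- (\<alpha>\<^sup>2 / \<beta>) \<le> 0"
        using le[of "- \<alpha> / \<beta>"] False by (simp add: power2_eq_square field_simps)
      then have "\<alpha>\<^sup>2 \<le> 0" using \<open>\<beta> < 0\<close> by (simp add: divide_le_0_iff zero_le_divide_iff)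
      then show ?thesis by (simp add: \<alpha>_def)
    qed
  qed
  have "u = proj (P (Q u))" using u by (simp add: PQ proj_def)
  have linS: "linear (\<lambda>y. S (proj (P y)))"
    by (rule linearI)
      (simp_all add: proj_def linear_add[OF PQ(1)] linear_scale[OF PQ(1)] linear_add[OF S] linear_scale[OF S]
        linear_diff[OF S] bilin algebra_simps)
  have Su: "G (S u) v = 0" if "G n v = 0" for v
  proof -
    have "S u = (\<Sum>b\<in>Basis. (Q u \<bullet> b) *\<^sub>R S (proj (P b)))"
      using linear_sum_Basis[OF linS, of "Q u"] \<open>u = proj (P (Q u))\<close> by simp
    then show ?thesis using rad[OF nP B0 that] by (simp add: sum_left scale_left)
  qed
  have "G n (S u) = 0" using Sn sym by metis
  then show "S u = 0" using Su[of "S u"] eq_0_iff by simp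
qed

end

end

section \<open>Foliated charts and the tangent spaces of leaves\<close>

lemma linear_height: "linear height"
  unfolding height_def by (rule linearI) (auto simp: inner_add_left)

context smooth_manifold
begin

text \<open>The line through the point in direction \<open>u\<close> stays in a plaque of
  \<open>c\<close>, so near the point its image has constant height in \<open>d\<close>; the
  derivative of that height at 0 is the quantity in question. Thus tangency to the leaf can be
  tested in a single foliated chart.\<close>

lemma height_transition:
  assumes fol: "foliation \<A> \<Phi>" and c: "c \<in> \<Phi>" and d: "d \<in> \<Phi>" and p: "p \<in> cdom c" "p \<in> cdom d"
    and u: "height u = 0"
  shows "height (transition_deriv c d p u) = 0"
proof -
  have cA: "c \<in> \<A>" and dA: "d \<in> \<A>" using fol c d unfolding foliation_def by auto
  obtain W where W: "open W" "p \<in> W" "W \<subseteq> cdom c \<inter> cdom d"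
    "\<And>q r. q \<in> W \<Longrightarrow> r \<in> W \<Longrightarrow> height (cmap c q) = height (cmap c r) \<Longrightarrow> height (cmap d q) = height (cmap d r)"
    using fol c d p unfolding foliation_def by (metis IntI)
  let ?x = "cmap c p"
  let ?T = "cmap c ` W"
  have T: "open ?T" using W by (intro open_cmap_image[OF cA]) auto
  have line: "((\<lambda>t. ?x + t *\<^sub>R u) has_derivative (\<lambda>h. h *\<^sub>R u)) (at 0)"
    by (auto intro!: derivative_eq_intros)
  have "(trans c d has_derivative transition_deriv c d p) (at (?x + 0 *\<^sub>R u))"
    using has_derivative_trans[OF cA dA p] by simp
  from bounded_linear.has_derivative[OF linear_height[unfolded linear_conv_bounded_linear] has_derivative_compose[OF line this]]
  have D: "((\<lambda>t. height (trans c d (?x + t *\<^sub>R u))) has_derivative (\<lambda>h. height (transition_deriv c d p (h *\<^sub>R u)))) (at 0)" .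
  have "open ((\<lambda>t. ?x + t *\<^sub>R u) -` ?T)"
    by (rule open_vimage[OF T]) (intro continuous_intros)
  then have "((\<lambda>t. height (cmap d p)) has_derivative (\<lambda>h. height (transition_deriv c d p (h *\<^sub>R u)))) (at 0)"
  proof (rule has_derivative_transform_within_open[OF D])
    show "0 \<in> (\<lambda>t. ?x + t *\<^sub>R u) -` ?T" using W(2) by simp
    fix t assume "t \<in> (\<lambda>t. ?x + t *\<^sub>R u) -` ?T"
    then obtain q where q: "q \<in> W" "?x + t *\<^sub>R u = cmap c q" by auto
    have "height (cmap c q) = height ?x"
      unfolding q(2)[symmetric] by (simp add: linear_add[OF linear_height] linear_scale[OF linear_height] u)
    then have "height (cmap d q) = height (cmap d p)" using W q by blast
    then show "height (trans c d (?x + t *\<^sub>R u)) = height (cmap d p)"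
      using q W(3) by (simp add: q cinv_cmap[OF cA] subset_iff)
  qed
  from fun_cong[OF has_derivative_unique[OF this has_derivative_const], of 1] show ?thesis by simp
qed

lemma leaf_tangent_spaceI:
  assumes fol: "foliation \<A> \<Phi>" and c: "c \<in> \<Phi>" and p: "p \<in> cdom c" and u: "height u = 0"
  shows "coord_vec \<A> c p u \<in> leaf_tangent_space \<A> \<Phi> p"
proof -
  have A: "\<Phi> \<subseteq> \<A>" using fol unfolding foliation_def by auto
  then have cA: "c \<in> \<A>" using c by auto
  show ?thesis
    unfolding leaf_tangent_space_def
    using coord_vec_tangent[OF cA p] height_transition[OF fol c _ p _ u] A
    by (auto simp: coord_vec_chart[OF cA p])
qed

end

context riemannian_manifold
begin

lemma metric_scale: "u \<in> tangent_space \<A> p \<Longrightarrow> v \<in> tangent_space \<A> p \<Longrightarrow> g p (tscale a u) v = a * g p u v"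
  using riemannian_metric unfolding riemannian_metric_def by blast

lemma unit_field_chart:
  assumes "C1_field X" "tnorm g p (X p) = 1" "c \<in> \<A>" "p \<in> cdom c"
  shows "local_metric \<A> g c (cmap c p) (X p c) (X p c) = 1"
  using assms metric_chart[OF assms(3,4) C1_field_tangent[OF assms(1)] C1_field_tangent[OF assms(1)]]
  by (simp add: tnorm_def)

lemma cnabla_unit_orthogonal:
  assumes X: "C1_field X" "\<forall>p. tnorm g p (X p) = 1" and c: "c \<in> \<A>" and x: "x \<in> cimg c"
  shows "local_metric \<A> g c x (cnabla c X x u) (X (cinv c x) c) = 0"
proof -
  interpret m: metric_field "cimg c" "local_metric \<A> g c" by (rule metric_field_chart[OF c])
  interpret inner_form "local_metric \<A> g c x" by (rule m.inner_form[OF x])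
  let ?X = "\<lambda>x. X (cinv c x) c"
  have "fder (\<lambda>y. local_metric \<A> g c y (?X y) (?X y)) x = fder (\<lambda>_. 1) x"
    by (rule fder_cong_open[OF open_cimg[OF c] x])
      (metis X c cinv_in cmap_cinv unit_field_chart)
  then have "local_metric \<A> g c x (m.nabla ?X x u) (?X x) + local_metric \<A> g c x (?X x) (m.nabla ?X x u) = 0"
    using m.metric_compatible[OF x C1_field_differentiable[OF X(1) c x] C1_field_differentiable[OF X(1) c x], of u] by simp
  then show ?thesis using sym[of "?X x" "m.nabla ?X x u"] by simp
qed

lemma closed_conformal_unit_parallel:
  assumes cc: "closed_conformal \<A> g \<xi>" and unit: "\<forall>p. tnorm g p (\<xi> p) = 1" and c: "c \<in> \<A>" and x: "x \<in> cimg c"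
  shows "cnabla c \<xi> x u = 0"
proof -
  interpret m: metric_field "cimg c" "local_metric \<A> g c" by (rule metric_field_chart[OF c])
  interpret inner_form "local_metric \<A> g c x" by (rule m.inner_form[OF x])
  obtain \<sigma> where \<sigma>: "\<And>p v. v \<in> tangent_space \<A> p \<Longrightarrow> cov_deriv \<A> g \<xi> p v = tscale (\<sigma> p) v"
    and vf: "vector_field \<A> \<xi>" using cc unfolding closed_conformal_def by blast
  have \<xi>: "C1_field \<xi>" by (rule vector_field_C1[OF vf])
  let ?p = "cinv c x"
  have p: "?p \<in> cdom c" by (rule cinv_in[OF c x])
  have eq: "cnabla c \<xi> x u = \<sigma> ?p *\<^sub>R u" for u
    using cov_deriv_chart[OF c p, of \<xi> "coord_vec \<A> c ?p u"] \<sigma>[OF coord_vec_tangent[OF c p]]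
    by (simp add: coord_vec_self[OF c p] cmap_cinv[OF c x] tscale_def)
  \<comment> \<open>The derivative of the constant norm is tested in the direction of \<xi> itself,
    where it equals \<sigma>.\<close>
  have "\<sigma> ?p = 0"
    using cnabla_unit_orthogonal[OF \<xi> unit c x, of "\<xi> ?p c"] unit_field_chart[OF \<xi> unit[rule_format] c p]
    by (simp add: eq scale_left cmap_cinv[OF c x])
  then show ?thesis by (simp add: eq)
qed

end

section \<open>The normal field, the parallel field and their angle in a foliated chart\<close>

locale transversal_foliation = riemannian_manifold \<A> g
  for \<A> :: "('a::{t2_space,second_countable_topology}, 'e::euclidean_space) chart set" and g +
  fixes \<xi> N :: "'a \<Rightarrow> ('a, 'e) tvec" and \<Phi> :: "('a, 'e) chart set"
  assumes conformal: "closed_conformal \<A> g \<xi>" and unit_xi: "\<forall>p. tnorm g p (\<xi> p) = 1"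
    and foliation: "foliation \<A> \<Phi>" and normal: "unit_normal_field \<A> g \<Phi> N"
    and positive: "\<forall>p. g p (N p) (\<xi> p) > 0"
    and nonneg_sff: "\<forall>L\<in>leaves \<Phi>. nonneg_second_fundamental_form \<A> g \<Phi> N L"
begin

lemma charts: "\<Phi> \<subseteq> \<A>" "\<exists>c\<in>\<Phi>. p \<in> cdom c"
  using foliation unfolding foliation_def by auto

lemma xi_C1: "C1_field \<xi>" and N_C1: "C1_field N" and unit_N: "\<forall>p. tnorm g p (N p) = 1"
  using conformal normal vector_field_C1 unfolding closed_conformal_def unit_normal_field_def by auto

abbreviation cosine :: "'a \<Rightarrow> real" where "cosine p \<equiv> g p (N p) (\<xi> p)"

lemma nonneg_sff_at:
  assumes "Y \<in> leaf_tangent_space \<A> \<Phi> p" shows "g p (second_fundamental_form \<A> g N p Y) Y \<ge> 0"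
proof -
  have "(plaque_rel \<Phi>)\<^sup>* `` {p} \<in> leaves \<Phi>" unfolding leaves_def by (rule quotientI) simp
  then have "nonneg_second_fundamental_form \<A> g \<Phi> N ((plaque_rel \<Phi>)\<^sup>* `` {p})" using nonneg_sff by blast
  then show ?thesis using assms unfolding nonneg_second_fundamental_form_def by blast
qed

context
  fixes c assumes c: "c \<in> \<Phi>"
begin

lemma cA: "c \<in> \<A>" using c charts by auto

interpretation m: metric_field "cimg c" "local_metric \<A> g c" by (rule metric_field_chart[OF cA])

abbreviation "n \<equiv> \<lambda>x. N (cinv c x) c"
abbreviation "z \<equiv> \<lambda>x. \<xi> (cinv c x) c"
abbreviation "f \<equiv> \<lambda>x. local_metric \<A> g c x (n x) (z x)"

lemma f_eq: "x \<in> cimg c \<Longrightarrow> f x = cosine (cinv c x)"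
  using metric_chart[OF cA cinv_in[OF cA] C1_field_tangent[OF N_C1] C1_field_tangent[OF xi_C1]]
  by (simp add: cmap_cinv[OF cA])

lemma n_C1: "C1_on (cimg c) n" and z_C1: "C1_on (cimg c) z"
  by (rule C1_field_C1[OF N_C1 cA] C1_field_C1[OF xi_C1 cA])+

lemma f_C1: "C1_on (cimg c) f"
  by (rule m.C1_metric_fields[OF n_C1 z_C1])

context
  fixes x assumes x: "x \<in> cimg c"
begin

interpretation inner_form "local_metric \<A> g c x" by (rule m.inner_form[OF x])

lemma diff: "n differentiable (at x)" "z differentiable (at x)" "f differentiable (at x)"
  using C1_on_has_derivative[OF n_C1 x] C1_on_has_derivative[OF z_C1 x] C1_on_has_derivative[OF f_C1 x]
  by (auto intro: differentiableI)

lemma nn: "local_metric \<A> g c x (n x) (n x) = 1" and zz: "local_metric \<A> g c x (z x) (z x) = 1"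
  using unit_field_chart[OF N_C1 unit_N[rule_format] cA cinv_in[OF cA x]]
    unit_field_chart[OF xi_C1 unit_xi[rule_format] cA cinv_in[OF cA x]] by (simp_all add: cmap_cinv[OF cA x])

lemma nabla_n_orthogonal: "local_metric \<A> g c x (m.nabla n x u) (n x) = 0"
  by (rule cnabla_unit_orthogonal[OF N_C1 unit_N cA x])

lemma nabla_z: "m.nabla z x u = 0"
  by (rule closed_conformal_unit_parallel[OF conformal unit_xi cA x])

lemma linear_nabla_n: "linear (m.nabla n x)"
  by (rule m.nabla_linear[OF x diff(1)])

lemma normal_height: "height u = 0 \<Longrightarrow> local_metric \<A> g c x (n x) u = 0"
proof -
  assume u: "height u = 0"
  have p: "cinv c x \<in> cdom c" by (rule cinv_in[OF cA x])
  have "g (cinv c x) (N (cinv c x)) (coord_vec \<A> c (cinv c x) u) = 0"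
    using normal leaf_tangent_spaceI[OF foliation c p u] unfolding unit_normal_field_def by blast
  then show ?thesis
    using metric_chart[OF cA p C1_field_tangent[OF N_C1] coord_vec_tangent[OF cA p, of u]]
    by (simp add: cmap_cinv[OF cA x] coord_vec_self[OF cA p])
qed

text \<open>Vectors tangent to the leaf are exactly those orthogonal to \<open>n\<close>. If an
  orthogonal \<open>u\<close> had nonzero height, subtracting a multiple of it from \<open>n\<close>
  would give a leaf tangent vector whose product with \<open>n\<close> is 1.\<close>

lemma height_normal:
  assumes "local_metric \<A> g c x (n x) u = 0" shows "height u = 0"
proof (rule ccontr)
  assume h: "height u \<noteq> 0"
  define r where "r = height (n x) / height u"
  have "height (n x - r *\<^sub>R u) = 0"
    using h by (simp add: r_def linear_diff[OF linear_height] linear_scale[OF linear_height])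
  then have "local_metric \<A> g c x (n x) (n x - r *\<^sub>R u) = 0" by (rule normal_height)
  then show False using nn assms by (simp add: diff_right scale_right)
qed

lemma nabla_n_nonpos:
  assumes "local_metric \<A> g c x (n x) u = 0"
  shows "local_metric \<A> g c x (m.nabla n x u) u \<le> 0"
proof -
  let ?p = "cinv c x" let ?Y = "coord_vec \<A> c (cinv c x) u"
  have p: "?p \<in> cdom c" by (rule cinv_in[OF cA x])
  note Y = coord_vec_tangent[OF cA p, of u]
  note D = cov_deriv_tangent[OF N_C1 Y]
  have "g ?p (second_fundamental_form \<A> g N ?p ?Y) ?Y \<ge> 0"
    by (rule nonneg_sff_at[OF leaf_tangent_spaceI[OF foliation c p height_normal[OF assms]]])
  then have "g ?p (cov_deriv \<A> g N ?p ?Y) ?Y \<le> 0"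
    by (simp add: second_fundamental_form_def metric_scale[OF D Y])
  then show ?thesis
    using metric_chart[OF cA p D Y] by (simp add: cov_deriv_chart[OF cA p] coord_vec_self[OF cA p] cmap_cinv[OF cA x])
qed

lemma fder_f: "fder f x u = local_metric \<A> g c x (m.nabla n x u) (z x)"
  using m.metric_compatible[OF x diff(1,2), of u] by (simp add: nabla_z)

end

text \<open>A constant field \<open>v\<close> of height 0 is tangent to the leaves throughout the
  chart, so its product with \<open>n\<close> is identically 0. Differentiating along
  \<open>u\<close> leaves the normal component of \<open>Gam x u v\<close>, which is symmetric in
  \<open>u\<close> and \<open>v\<close>.\<close>

lemma nabla_n_symmetric:
  assumes x: "x \<in> cimg c" and u: "local_metric \<A> g c x (n x) u = 0" and v: "local_metric \<A> g c x (n x) v = 0"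
  shows "local_metric \<A> g c x (m.nabla n x u) v = local_metric \<A> g c x (m.nabla n x v) u"
proof -
  have *: "local_metric \<A> g c x (m.nabla n x u) v = - local_metric \<A> g c x (n x) (m.Gam x u v)"
    if v: "local_metric \<A> g c x (n x) v = 0" for u v
  proof -
    have "fder (\<lambda>y. local_metric \<A> g c y (n y) v) x = fder (\<lambda>_. 0) x"
      by (rule fder_cong_open[OF m.open_S x]) (rule normal_height[OF _ height_normal[OF x v]])
    then show ?thesis
      using m.metric_compatible[OF x diff(1)[OF x], of "\<lambda>_. v" u] by (simp add: m.nabla_def)
  qed
  show ?thesis using *[OF v, of u] *[OF u, of v] m.Gam_sym[OF x, of u v] by simp
qed

lemma etrace_nabla_n_nonpos: "x \<in> cimg c \<Longrightarrow> etrace (m.nabla n x) \<le> 0"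
  by (rule inner_form.etrace_nonpos[OF m.inner_form nn linear_nabla_n nabla_n_orthogonal nabla_n_nonpos])

lemma nabla_n_eq_0:
  assumes x: "x \<in> cimg c" and "etrace (m.nabla n x) = 0" and "height u = 0"
  shows "m.nabla n x u = 0"
  by (rule inner_form.etrace_0_imp[OF m.inner_form[OF x] nn[OF x] linear_nabla_n[OF x] nabla_n_orthogonal[OF x]
        nabla_n_nonpos[OF x] nabla_n_symmetric[OF x]])
    (use assms normal_height[OF x] in auto)

text \<open>The relation \<open>b' = f a'\<close> makes the derivative of \<open>f\<close> along \<open>N\<close>, whose sign is unknown, drop out
  of the divergence of \<open>a(f) \<xi> - b(f) N\<close>; what remains is the derivative of \<open>f\<close> along the
  projection of \<open>\<xi>\<close> to the leaf, which is nonpositive.\<close>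

lemma etrace_nabla_combination:
  assumes x: "x \<in> cimg c"
    and a: "(a has_real_derivative a') (at (f x))" and b: "(b has_real_derivative f x * a') (at (f x))"
    and a': "a' \<le> 0"
  shows "etrace (m.nabla (\<lambda>y. a (f y) *\<^sub>R z y - b (f y) *\<^sub>R n y) x) \<ge> - b (f x) * etrace (m.nabla n x)"
proof -
  interpret inner_form "local_metric \<A> g c x" by (rule m.inner_form[OF x])
  note diff = diff[OF x]
  have f': "(f has_derivative fder f x) (at x)" using diff by (simp add: frechet_derivative_works[symmetric])
  have D: "((\<lambda>y. h (f y)) has_derivative (\<lambda>u. h' * fder f x u)) (at x)"
    if "(h has_real_derivative h') (at (f x))" for h h'
    using has_derivative_compose[OF f' that[unfolded has_field_derivative_def]] .
  note Da = D[OF a] and Db = D[OF b]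
  define T where "T = z x - f x *\<^sub>R n x"
  have nT: "local_metric \<A> g c x (n x) T = 0" using nn[OF x] by (simp add: T_def diff_right scale_right)
  have zT: "z x = T + f x *\<^sub>R n x" by (simp add: T_def)
  have lin: "linear (fder f x)" using f' by (rule has_derivative_linear)
  \<comment> \<open>Derivatives of the unit field \<open>n\<close> are orthogonal to
    \<open>n\<close>, so \<xi> may be replaced by its tangential part.\<close>
  have "local_metric \<A> g c x (m.nabla n x T) (z x) = local_metric \<A> g c x (m.nabla n x T) T"
    by (subst zT) (simp add: add_right scale_right nabla_n_orthogonal[OF x])
  then have fT: "fder f x T \<le> 0" using nabla_n_nonpos[OF x nT] fder_f[OF x] by simp
  have fz: "fder f x (z x) = fder f x T + f x * fder f x (n x)"
    by (subst zT) (simp add: linear_add[OF lin] linear_scale[OF lin])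
  have "m.nabla (\<lambda>y. a (f y) *\<^sub>R z y - b (f y) *\<^sub>R n y) x u =
      m.nabla (\<lambda>y. a (f y) *\<^sub>R z y) x u - m.nabla (\<lambda>y. b (f y) *\<^sub>R n y) x u" for u
    by (rule m.nabla_diff[OF x]) (intro differentiable_scaleR diff differentiableI[OF Da] differentiableI[OF Db])+
  then have "etrace (m.nabla (\<lambda>y. a (f y) *\<^sub>R z y - b (f y) *\<^sub>R n y) x) =
      etrace (m.nabla (\<lambda>y. a (f y) *\<^sub>R z y) x) - etrace (m.nabla (\<lambda>y. b (f y) *\<^sub>R n y) x)"
    by (simp add: etrace_def inner_diff_left sum_subtractf)
  also have "\<dots> = a' * fder f x (z x) - (f x * a' * fder f x (n x) + b (f x) * etrace (m.nabla n x))"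
    using m.etrace_nabla_scaleR[OF x differentiableI[OF Da] diff(2)] m.etrace_nabla_scaleR[OF x differentiableI[OF Db] diff(1)]
    by (simp add: fder_eqI[OF Da] fder_eqI[OF Db] etrace_def nabla_z[OF x])
  also have "\<dots> = a' * fder f x T - b (f x) * etrace (m.nabla n x)"
    by (simp add: fz algebra_simps)
  finally show ?thesis using mult_nonpos_nonpos[OF a' fT] by simp
qed

end

lemma cosine_le_1: "cosine p \<le> 1"
proof -
  obtain c where c: "c \<in> \<Phi>" "p \<in> cdom c" using charts by blast
  have x: "cmap c p \<in> cimg c" using cmap_in[OF cA[OF c(1)] c(2)] .
  show ?thesis
    using inner_form.unit_inner_le_1(1)[OF metric_field.inner_form[OF metric_field_chart[OF cA[OF c(1)]] x] nn[OF c(1) x] zz[OF c(1) x]]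
      f_eq[OF c(1) x] cinv_cmap[OF cA[OF c(1)] c(2)] by simp
qed

lemma etrace_nabla_N_eq_0:
  assumes conv: "converges_at_infinity g N \<xi>" and c: "c \<in> \<Phi>" and p: "p \<in> cdom c" and lt: "cosine p < 1"
  shows "etrace (cnabla c N (cmap c p)) = 0"
proof -
  \<comment> \<open>The midpoint between the cosine at \<open>p\<close> and 1: below 1, so that the
    cutoff field has compact support, and above the cosine at \<open>p\<close>, so that the
    coefficient of the trace is positive there.\<close>
  define s where "s = (cosine p + 1) / 2"
  have s: "cosine p < s" "s < 1" "s > 0" using lt positive[rule_format, of p] by (auto simp: s_def field_simps)
  define m where "m = (\<lambda>t. max 0 (s - t))"
  define a where "a = (\<lambda>t. (m t)\<^sup>2)"
  \<comment> \<open>For t below s this is the integral of 2 \<tau> (s - \<tau>) over \<tau> from t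
    to s, that is, the primitive of t a'(t) that vanishes at s.\<close>
  define b where "b = (\<lambda>t. (m t)\<^sup>2 * (s + 2 * t) / 3)"
  have a: "(a has_real_derivative - 2 * m t) (at t)" for t
  proof -
    have "((\<lambda>t. s - t) has_real_derivative - 1) (at t)" by (auto intro!: derivative_eq_intros)
    from DERIV_chain2[OF has_real_derivative_max_0_square this] show ?thesis by (simp add: a_def m_def)
  qed
  have b: "(b has_real_derivative t * (- 2 * m t)) (at t)" for t
  proof -
    have "((\<lambda>t. a t * (s + 2 * t) / 3) has_real_derivative (- 2 * m t * (s + 2 * t) + a t * 2) / 3) (at t)"
      by (auto intro!: derivative_eq_intros a)
    moreover have "(- 2 * m t * (s + 2 * t) + a t * 2) / 3 = t * (- 2 * m t)"
      by (auto simp: a_def m_def max_def power2_eq_square field_simps)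
    ultimately show ?thesis unfolding b_def a_def by (simp only:)
  qed
  have b0: "b t \<ge> 0" if "t > 0" for t using that s by (simp add: b_def)
  define X where "X = (\<lambda>q. tadd (tscale (a (cosine q)) (\<xi> q)) (tscale (- b (cosine q)) (N q)))"
  have Xc: "X (cinv d x) d = a (cosine (cinv d x)) *\<^sub>R \<xi> (cinv d x) d - b (cosine (cinv d x)) *\<^sub>R N (cinv d x) d" for d x
    by (simp add: X_def tadd_def tscale_def)
  \<comment> \<open>\<open>arccos s\<close> plays the part of \<epsilon>: an angle below it means
    that the cosine exceeds \<open>s\<close>, where both coefficients vanish.\<close>
  have "arccos s > 0" using s by (intro arccos_lt_bounded[THEN conjunct1]) auto
  then obtain K where K: "compact K" "\<And>q. q \<notin> K \<Longrightarrow> angle g N \<xi> q < arccos s"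
    using conv unfolding converges_at_infinity_def by blast
  have Ks: "cosine q > s" if "q \<notin> K" for q
    using K(2)[OF that] cosine_le_1[of q] positive[rule_format, of q] s
    by (simp add: angle_def arccos_less_mono)
  have XC: "C1_field X"
    unfolding C1_field_def
  proof (intro conjI allI ballI)
    show "X q \<in> tangent_space \<A> q" for q
    proof -
      obtain d where d: "d \<in> \<A>" "q \<in> cdom d" using chart_ex by blast
      have "X q = coord_vec \<A> d q (a (cosine q) *\<^sub>R \<xi> q d + (- b (cosine q)) *\<^sub>R N q d)"
        unfolding coord_vec_add[OF d] coord_vec_scale[OF d] X_def
        by (simp add: coord_vec_eq[OF d] C1_field_tangent[OF xi_C1] C1_field_tangent[OF N_C1])
      then show ?thesis using coord_vec_tangent[OF d] by simp
    qed
    fix d assume d: "d \<in> \<A>"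
    interpret md: metric_field "cimg d" "local_metric \<A> g d" by (rule metric_field_chart[OF d])
    have cosC1: "C1_on (cimg d) (\<lambda>x. cosine (cinv d x))"
    proof (rule C1_on_cong[OF open_cimg[OF d]])
      show "C1_on (cimg d) (\<lambda>x. local_metric \<A> g d x (N (cinv d x) d) (\<xi> (cinv d x) d))"
        by (rule md.C1_metric_fields[OF C1_field_C1[OF N_C1 d] C1_field_C1[OF xi_C1 d]])
      show "cosine (cinv d x) = local_metric \<A> g d x (N (cinv d x) d) (\<xi> (cinv d x) d)" if "x \<in> cimg d" for x
        using metric_chart[OF d cinv_in[OF d that] C1_field_tangent[OF N_C1] C1_field_tangent[OF xi_C1]]
        by (simp add: cmap_cinv[OF d that])
    qed
    have "continuous_on S m" for S unfolding m_def by (intro continuous_intros)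
    then have "C1_on (cimg d) (\<lambda>x. a (cosine (cinv d x)))" "C1_on (cimg d) (\<lambda>x. b (cosine (cinv d x)))"
      by (auto intro!: C1_on_real_compose[OF cosC1 a] C1_on_real_compose[OF cosC1 b] continuous_intros)
    then show "C1_on (cimg d) (\<lambda>x. X (cinv d x) d)"
      unfolding Xc by (intro C1_on_minus C1_on_scaleR C1_field_C1[OF xi_C1 d] C1_field_C1[OF N_C1 d])
  qed
  have X0: "X q = tzero" if "q \<notin> K" for q
    using Ks[OF that] by (simp add: X_def a_def b_def m_def tadd_def tscale_def tzero_def)
  have div: "etrace (cnabla d X x) \<ge> - b (cosine (cinv d x)) * etrace (cnabla d N x)" if d: "d \<in> \<Phi>" and x: "x \<in> cimg d" for d x
  proof -
    interpret md: metric_field "cimg d" "local_metric \<A> g d" by (rule metric_field_chart[OF cA[OF d]])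
    let ?f = "\<lambda>x. local_metric \<A> g d x (N (cinv d x) d) (\<xi> (cinv d x) d)"
    have "cnabla d X x u = md.nabla (\<lambda>y. a (?f y) *\<^sub>R \<xi> (cinv d y) d - b (?f y) *\<^sub>R N (cinv d y) d) x u" for u
      by (rule md.nabla_cong[OF md.open_S x]) (simp add: Xc f_eq[OF d])
    then have "etrace (cnabla d X x) = etrace (md.nabla (\<lambda>y. a (?f y) *\<^sub>R \<xi> (cinv d y) d - b (?f y) *\<^sub>R N (cinv d y) d) x)"
      by (simp add: etrace_def)
    moreover have "- 2 * m (?f x) \<le> 0" by (simp add: m_def)
    ultimately show ?thesis
      using etrace_nabla_combination[OF d x a b] f_eq[OF d x] by simp
  qed
  have nonneg: "etrace (cnabla d X x) \<ge> 0" if d: "d \<in> \<Phi>" and x: "x \<in> cimg d" for d x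
    using div[OF d x] mult_nonneg_nonpos[OF b0[OF positive[rule_format]] etrace_nabla_n_nonpos[OF d x], of "cinv d x"] by simp
  \<comment> \<open>Off \<open>K\<close> the cosine exceeds \<open>s\<close>, whereas at
    \<open>p\<close> it is smaller.\<close>
  have pK: "p \<in> K" using Ks s by fastforce
  have x: "cmap c p \<in> cimg c" by (rule cmap_in[OF cA[OF c] p])
  have "etrace (cnabla c X (cmap c p)) = 0"
    by (rule nonneg_divergence_eq_0[OF XC K(1) X0 charts nonneg c p pK])
  then have "- b (cosine p) * etrace (cnabla c N (cmap c p)) \<le> 0"
    using div[OF c x] by (simp add: cinv_cmap[OF cA[OF c] p])
  moreover have "b (cosine p) > 0" using s positive[rule_format, of p] by (simp add: b_def m_def)
  ultimately show ?thesis
    using etrace_nabla_n_nonpos[OF c x] by (simp add: zero_le_mult_iff)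
qed

theorem totally_geodesic:
  assumes conv: "converges_at_infinity g N \<xi>" and Y: "Y \<in> leaf_tangent_space \<A> \<Phi> p"
  shows "second_fundamental_form \<A> g N p Y = tzero"
proof -
  obtain c where c: "c \<in> \<Phi>" "p \<in> cdom c" using charts by blast
  note cA = cA[OF c(1)]
  interpret m: metric_field "cimg c" "local_metric \<A> g c" by (rule metric_field_chart[OF cA])
  let ?x = "cmap c p"
  have x: "?x \<in> cimg c" by (rule cmap_in[OF cA c(2)])
  have "etrace (cnabla c N ?x) = 0"
  proof (rule ccontr)
    assume ne: "etrace (cnabla c N ?x) \<noteq> 0"
    \<comment> \<open>A nonzero trace forces cosine 1, hence N = \<xi>. Being nonzero is an open
      condition, so the two fields agree on a neighbourhood and have the same derivative, which is 0
      for the parallel field.\<close>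
    let ?V = "{y \<in> cimg c. etrace (cnabla c N y) \<noteq> 0}"
    have V: "open ?V"
    proof -
      have "open ((\<lambda>y. etrace (cnabla c N y)) -` (- {0}) \<inter> cimg c)"
        using continuous_on_open_vimage[OF m.open_S] m.continuous_on_etrace_nabla[OF C1_field_C1[OF N_C1 cA]] by blast
      then show ?thesis by (simp add: vimage_def Int_def conj_commute)
    qed
    have eq: "N (cinv c y) c = \<xi> (cinv c y) c" if y: "y \<in> ?V" for y
    proof -
      have yc: "y \<in> cimg c" using y by simp
      have "cosine (cinv c y) = 1"
        using etrace_nabla_N_eq_0[OF conv c(1) cinv_in[OF cA yc]] cosine_le_1[of "cinv c y"] y
        by (fastforce simp: cmap_cinv[OF cA])
      then show ?thesis
        using inner_form.unit_inner_le_1(2)[OF m.inner_form[OF yc] nn[OF c(1) yc] zz[OF c(1) yc]] f_eq[OF c(1) yc] by simp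
    qed
    have "cnabla c N ?x u = cnabla c \<xi> ?x u" for u
      by (rule m.nabla_cong[OF V _ eq]) (use x ne in auto)
    then have "cnabla c N ?x u = 0" for u using closed_conformal_unit_parallel[OF conformal unit_xi cA x] by simp
    then show False using ne by (simp add: etrace_def)
  qed
  moreover have Yt: "Y \<in> tangent_space \<A> p" and "height (Y c) = 0"
    using Y c unfolding leaf_tangent_space_def by auto
  ultimately have "cov_deriv \<A> g N p Y c = 0"
    using nabla_n_eq_0[OF c(1) x] cov_deriv_chart[OF cA c(2)] by simp
  \<comment> \<open>A tangent vector is determined by its components in one chart, so vanishing in
    \<open>c\<close> gives vanishing in all charts.\<close>
  then have "cov_deriv \<A> g N p Y = tscale 0 (cov_deriv \<A> g N p Y)"
    using coord_vec_eq[OF cA c(2) cov_deriv_tangent[OF N_C1 Yt]] coord_vec_scale[OF cA c(2), of 0 0] by (simp add: tscale_def)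
  then show ?thesis
    unfolding second_fundamental_form_def tscale_def tzero_def by (metis scaleR_zero_left scaleR_zero_right)
qed

end

theorem theorem4p2:
  fixes \<A> :: "('a::{t2_space,second_countable_topology}, 'e::euclidean_space) chart set"
    and g :: "('a, 'e) metric"
    and \<xi> N :: "'a \<Rightarrow> ('a, 'e) tvec"
    and \<Phi> :: "('a, 'e) chart set"
  assumes "smooth_structure \<A>"
    and "riemannian_metric \<A> g"
    and "closed_conformal \<A> g \<xi>"
    and "\<forall>p. tnorm g p (\<xi> p) = 1"
    and "foliation \<A> \<Phi>"
    and "\<forall>L\<in>leaves \<Phi>. complete_leaf \<A> g \<Phi> L \<and> noncompact_leaf \<Phi> L"
    and "unit_normal_field \<A> g \<Phi> N"
    and "transversal \<A> \<Phi> \<xi>"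
    and "\<forall>p. g p (N p) (\<xi> p) > 0"
    and "\<forall>p. g p (N p) (tscale (H_xi \<A> g \<xi> p) (\<xi> p)) \<le> 0"
    and "\<forall>L\<in>leaves \<Phi>. nonneg_second_fundamental_form \<A> g \<Phi> N L"
    and "converges_at_infinity g N \<xi>"
  shows "\<forall>L\<in>leaves \<Phi>. totally_geodesic_leaf \<A> g \<Phi> N L"
proof -
  interpret transversal_foliation \<A> g \<xi> N \<Phi>
    using assms by (intro transversal_foliation.intro riemannian_manifold.intro smooth_manifold.intro
        riemannian_manifold_axioms.intro transversal_foliation_axioms.intro)
  show ?thesis
    unfolding totally_geodesic_leaf_def using totally_geodesic[OF assms(12)] by blast
qed

end
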